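(* Let $\Gamma\subseteq[n]\times[n]$ be an index set such that $(1,i)\in\Gamma$ for $2\le i\le n$ and $(i,i)\notin\Gamma$ for $1\le i\le n$. For an arbitrary field $k$ let $k[\Gamma]=k[x_{ij}]_{(i,j)\in\Gamma}$, and let $I$ be the ideal of $k[\Gamma]$ generated by the following monomials: $x_{ij}x_{kj}$ for $(i,j),(k,j)\in\Gamma$ with $i\ne k$; and $x_{i_1i_2}x_{i_2i_3}\cdots x_{i_ti_1}$ for $t\ge2$, $(i_t,i_1)\in\Gamma$ and $(i_j,i_{j+1})\in\Gamma$ for $j\in[t-1]$. Then the ring $k[\Gamma]/I$ is Cohen–Macaulay.
   Context: $[n]=\{1,\dots,n\}$; $k[x_{ij}]_{(i,j)\in\Gamma}$ is the polynomial ring with one variable for each element of $\Gamma$. In the second family of monomials the indices $i_1,\dots,i_t$ are the distinct vertices of a directed cycle. *)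

theory Defs
  imports "HOL-Algebra.Algebra" "HOL-Library.Poly_Mapping" "HOL-Library.Extended_Nat"
begin

section \<open>Localization of a commutative ring\<close>

definition loc_rel :: "('a, 'b) ring_scheme \<Rightarrow> 'a set \<Rightarrow> (('a \<times> 'a) \<times> ('a \<times> 'a)) set"
  where "loc_rel R S =
    {((r, s), (r', s')). r \<in> carrier R \<and> s \<in> S \<and> r' \<in> carrier R \<and> s' \<in> S \<and>
       (\<exists>u\<in>S. u \<otimes>\<^bsub>R\<^esub> ((r \<otimes>\<^bsub>R\<^esub> s') \<ominus>\<^bsub>R\<^esub> (r' \<otimes>\<^bsub>R\<^esub> s)) = \<zero>\<^bsub>R\<^esub>)}"

definition loc_frac :: "('a, 'b) ring_scheme \<Rightarrow> 'a set \<Rightarrow> 'a \<Rightarrow> 'a \<Rightarrow> ('a \<times> 'a) set"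
  where "loc_frac R S r s = loc_rel R S `` {(r, s)}"

text \<open>The operations take the union of the results over all pairs of representatives. If
  \<open>S\<close> is multiplicatively closed and contains \<open>\<one>\<close>, all these results are the same class, so
  the union is that class.\<close>

definition localization :: "('a, 'b) ring_scheme \<Rightarrow> 'a set \<Rightarrow> ('a \<times> 'a) set ring"
  where "localization R S =
    \<lparr>carrier = (carrier R \<times> S) // loc_rel R S,
     monoid.mult = (\<lambda>A B. \<Union>p\<in>A. \<Union>q\<in>B. loc_frac R S (fst p \<otimes>\<^bsub>R\<^esub> fst q) (snd p \<otimes>\<^bsub>R\<^esub> snd q)),
     one = loc_frac R S \<one>\<^bsub>R\<^esub> \<one>\<^bsub>R\<^esub>,
     ring.zero = loc_frac R S \<zero>\<^bsub>R\<^esub> \<one>\<^bsub>R\<^esub>,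
     add = (\<lambda>A B. \<Union>p\<in>A. \<Union>q\<in>B.
              loc_frac R S ((fst p \<otimes>\<^bsub>R\<^esub> snd q) \<oplus>\<^bsub>R\<^esub> (fst q \<otimes>\<^bsub>R\<^esub> snd p))
                (snd p \<otimes>\<^bsub>R\<^esub> snd q))\<rparr>"


section \<open>Cohen--Macaulay rings\<close>

text \<open>For the zero ring the supremum is over the empty set and equals \<open>0\<close>; this case does not
  arise below, where the dimension is only taken of local rings.\<close>

definition krull_dim :: "('a, 'b) ring_scheme \<Rightarrow> enat"
  where "krull_dim R =
    Sup {enat l | l. \<exists>P :: nat \<Rightarrow> 'a set. (\<forall>i\<le>l. primeideal (P i) R) \<and> (\<forall>i<l. P i \<subset> P (Suc i))}"

text \<open>The second conjunct says that each element is a non-zero-divisor on the quotient of \<open>R\<close> by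
  the ideal generated by the preceding elements.\<close>

definition regular_sequence :: "('a, 'b) ring_scheme \<Rightarrow> 'a list \<Rightarrow> bool"
  where "regular_sequence R xs \<longleftrightarrow>
    set xs \<subseteq> carrier R \<and>
    (\<forall>i<length xs. \<forall>r\<in>carrier R.
       xs ! i \<otimes>\<^bsub>R\<^esub> r \<in> Idl\<^bsub>R\<^esub> (set (take i xs)) \<longrightarrow> r \<in> Idl\<^bsub>R\<^esub> (set (take i xs))) \<and>
    Idl\<^bsub>R\<^esub> (set xs) \<noteq> carrier R"

definition ideal_depth :: "('a, 'b) ring_scheme \<Rightarrow> 'a set \<Rightarrow> enat"
  where "ideal_depth R J = Sup {enat (length xs) | xs. regular_sequence R xs \<and> set xs \<subseteq> J}"

definition cohen_macaulay_local :: "('a, 'b) ring_scheme \<Rightarrow> bool"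
  where "cohen_macaulay_local R \<longleftrightarrow>
    cring R \<and> noetherian_ring R \<and>
    (\<exists>m. maximalideal m R \<and> (\<forall>m'. maximalideal m' R \<longrightarrow> m' = m) \<and>
         ideal_depth R m = krull_dim R)"

definition cohen_macaulay :: "('a, 'b) ring_scheme \<Rightarrow> bool"
  where "cohen_macaulay R \<longleftrightarrow>
    cring R \<and> noetherian_ring R \<and>
    (\<forall>m. maximalideal m R \<longrightarrow> cohen_macaulay_local (localization R (carrier R - m)))"


section \<open>Polynomial rings\<close>

text \<open>A polynomial is a finitely supported function from monomials to coefficients, and a monomial
  is a finitely supported function from variables to exponents; addition and multiplication
  (convolution) are those of the type \<open>poly_mapping\<close>. Here \<open>V\<close> is the set of variables.\<close>

definition mpoly_ring :: "'v set \<Rightarrow> (('v \<Rightarrow>\<^sub>0 nat) \<Rightarrow>\<^sub>0 'k::comm_ring_1) ring"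
  where "mpoly_ring V =
    \<lparr>carrier = {p. \<forall>m\<in>Poly_Mapping.keys p. Poly_Mapping.keys m \<subseteq> V},
     monoid.mult = (*), one = 1, ring.zero = 0, add = (+)\<rparr>"

definition mvar :: "'v \<Rightarrow> ('v \<Rightarrow>\<^sub>0 nat) \<Rightarrow>\<^sub>0 'k::comm_ring_1"
  where "mvar v = Poly_Mapping.single (Poly_Mapping.single v 1) 1"


section \<open>The ideal of an index set\<close>

definition in_pair_monomials ::
  "(nat \<times> nat) set \<Rightarrow> (((nat \<times> nat) \<Rightarrow>\<^sub>0 nat) \<Rightarrow>\<^sub>0 'k::comm_ring_1) set"
  where "in_pair_monomials \<Gamma> =
    {mvar (i, j) * mvar (l, j) | i l j. (i, j) \<in> \<Gamma> \<and> (l, j) \<in> \<Gamma> \<and> i \<noteq> l}"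

definition cycle_monomials ::
  "(nat \<times> nat) set \<Rightarrow> (((nat \<times> nat) \<Rightarrow>\<^sub>0 nat) \<Rightarrow>\<^sub>0 'k::comm_ring_1) set"
  where "cycle_monomials \<Gamma> =
    {(\<Prod>j = 1..t - 1. mvar (c j, c (j + 1))) * mvar (c t, c 1) | (t :: nat) (c :: nat \<Rightarrow> nat).
       t \<ge> 2 \<and> inj_on c {1..t} \<and> (c t, c 1) \<in> \<Gamma> \<and> (\<forall>j\<in>{1..t - 1}. (c j, c (j + 1)) \<in> \<Gamma>)}"

definition index_ideal ::
  "(nat \<times> nat) set \<Rightarrow> (((nat \<times> nat) \<Rightarrow>\<^sub>0 nat) \<Rightarrow>\<^sub>0 'k::comm_ring_1) set"
  where "index_ideal \<Gamma> = Idl\<^bsub>mpoly_ring \<Gamma>\<^esub> (in_pair_monomials \<Gamma> \<union> cycle_monomials \<Gamma>)"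

end

theory Submission
  imports Defs "HOL-Computational_Algebra.Polynomial"
begin

text \<open>
  Let \<open>R\<close> be a polynomial ring in all the variables and \<open>J\<close> the ideal of the polynomials none of
  whose monomials has a directed forest of \<open>\<Gamma>\<close> as its support; the ring in question is \<open>R/J\<close>.
  Forests have at most \<open>n - 1\<close> edges. Counting monomials, \<open>n\<close> elements of \<open>R\<close> are algebraically
  dependent modulo \<open>J\<close>, and such a relation excludes a chain of more than \<open>n\<close> primes above \<open>J\<close>.
  Hence a localization at a maximal ideal \<open>M\<close> has dimension at most \<open>n - 1\<close>, and as the depth never
  exceeds the dimension, a regular sequence of length \<open>n - 1\<close> in \<open>M\<close> suffices.

  For a vertex \<open>v\<close> let \<open>\<theta>\<^sub>v\<close> be the sum of the variables of the edges into \<open>v\<close> minus the sum of those of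
  the edges out of \<open>v\<close>. By the Nullstellensatz \<open>M\<close> contains nonzero polynomials \<open>f\<^sub>v(\<theta>\<^sub>v)\<close>, for
  \<open>v = 2, \<dots>, n\<close>. These form a regular sequence: deleting and contracting edges that do not leave
  the vertex \<open>1\<close> filters \<open>R/J\<close> by quotients \<open>R/(x\<^sub>e | e \<notin> T)\<close> for spanning trees \<open>T\<close>, where the edges out
  of \<open>1\<close> ensure that only spanning trees occur. Incidence matrices of trees are unimodular, so on such
  a quotient the \<open>\<theta>\<^sub>v\<close> are a linear coordinate system, and nonzero univariate polynomials in distinct
  coordinates form a regular sequence.
\<close>

hide_const (open) UnivPoly.coeff UnivPoly.monom Polynomials.degree Poly_Mapping.degree Module.module

section \<open>Ideals and weakly regular sequences in type-class rings\<close>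

text \<open>The ideal \<open>M\<close> is arbitrary and so is the field \<open>k\<close>, so neither
  the forms \<open>\<theta>\<^sub>v\<close> nor their translates by constants need lie in
  \<open>M\<close>. This forces the passage to univariate polynomials in them, and regularity has to
  be shown for every choice of nonzero polynomials; linear coordinates on the tree quotients are
  exactly what makes that possible.

  Regularity is carried along the filtration in the weak sense \<open>wreg\<close>, in which
  quotients may vanish; properness is established only after localizing, where the sequence lies in
  the maximal ideal. All quotients are formed from one ring containing every variable: deleting an
  edge adds its variable to the ideal, contracting an edge takes a colon ideal, and the ring changes
  only on the tree quotients.

  The Nullstellensatz goes through Goldman's property because that property descends from
  \<open>E[v]\<close> to \<open>E\<close>, whereas being a field modulo a prime is only seen to
  ascend, once \<open>v\<close> is known to be algebraic.\<close>

abbreviation ispan :: "'a::comm_ring_1 set \<Rightarrow> 'a set"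
  where "ispan \<equiv> Modules.module.span (*)"

abbreviation is_ideal :: "'a::comm_ring_1 set \<Rightarrow> bool"
  where "is_ideal \<equiv> Modules.module.subspace (*)"

interpretation ri: Modules.module "(*) :: 'a::comm_ring_1 \<Rightarrow> 'a \<Rightarrow> 'a"
  by unfold_locales (auto simp: algebra_simps)

declare ri.scale_scale [simp del] \<comment> \<open>the reverse of \<open>mult.assoc\<close>\<close>

lemma is_ideal_mult: "is_ideal J \<Longrightarrow> x \<in> J \<Longrightarrow> x * y \<in> J"
  by (metis mult.commute ri.subspace_scale)

text \<open>Properness of the last ideal is left out on purpose: the quotient may be zero, so
  inductions along exact sequences have no exceptional cases.\<close>

fun wreg :: "'a::comm_ring_1 set \<Rightarrow> 'a list \<Rightarrow> bool" where
  "wreg J [] = True"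
| "wreg J (f # fs) = ((\<forall>r. f * r \<in> J \<longrightarrow> r \<in> J) \<and> wreg (ispan (insert f J)) fs)"

lemma ispan_insert_ideal:
  assumes "is_ideal J"
  shows "ispan (insert f J) = {r. \<exists>j\<in>J. \<exists>s. r = j + f * s}"
proof -
  have "ispan J = J" using assms by simp
  show ?thesis
    unfolding ri.span_insert \<open>ispan J = J\<close>
  proof safe
    fix x k assume "x - k * f \<in> J"
    moreover have "x = (x - k * f) + f * k" by (simp add: algebra_simps)
    ultimately show "\<exists>j\<in>J. \<exists>s. x = j + f * s" by blast
  next
    fix j s assume "j \<in> J"
    then show "\<exists>k. j + f * s - k * f \<in> J" by (intro exI[of _ s]) (simp add: algebra_simps)
  qed
qed

lemma ispan_Un_ispan: "ispan (ispan A \<union> B) = ispan (A \<union> B)"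
proof (intro equalityI ri.span_minimal ri.subspace_span)
  show "ispan A \<union> B \<subseteq> ispan (A \<union> B)"
    using ri.span_mono[of A "A \<union> B"] ri.span_superset[of "A \<union> B"] by blast
  show "A \<union> B \<subseteq> ispan (ispan A \<union> B)"
    using ri.span_superset[of "ispan A \<union> B"] ri.span_superset[of A] by blast
qed

lemma ispan_insert_ispan: "ispan (insert x (ispan A)) = ispan (insert x A)"
  using ispan_Un_ispan[of A "{x}"] by simp

text \<open>The exact sequence \<open>0 \<rightarrow> R/(J : x) \<rightarrow> R/J \<rightarrow> R/(J + (x)) \<rightarrow> 0\<close>.\<close>

lemma wreg_colon:
  assumes "is_ideal J" "wreg {r. x * r \<in> J} fs" "wreg (ispan (insert x J)) fs"
  shows "wreg J fs"
  using assms
proof (induction fs arbitrary: J)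
  case Nil
  then show ?case by simp
next
  case (Cons f fs)
  have J: "is_ideal J" by fact
  \<comment> \<open>Regularity of \<open>f\<close> modulo J + (x) puts \<open>r\<close> into J +
    (x); the remaining multiple of \<open>x\<close> is treated in the colon ideal.\<close>
  have reg: "r \<in> J" if fr: "f * r \<in> J" for r
  proof -
    have "f * r \<in> ispan (insert x J)" using fr by (simp add: ri.span_base)
    then have "r \<in> ispan (insert x J)" using Cons.prems(3) by simp
    then obtain j s where js: "j \<in> J" "r = j + x * s" using ispan_insert_ideal[OF J] by blast
    have "f * j \<in> J" using js J by (simp add: ri.subspace_scale)
    then have "f * r - f * j \<in> J" using fr J by (simp add: ri.subspace_diff)
    moreover have "f * r - f * j = x * (f * s)" unfolding js(2) by (simp add: algebra_simps)
    ultimately have "x * (f * s) \<in> J" by simp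
    then have "x * s \<in> J" using Cons.prems(2) by simp
    then show ?thesis using js J by (simp add: ri.subspace_add)
  qed
  let ?J = "ispan (insert f J)"
  have colon_ideal: "is_ideal {r. x * r \<in> J}"
    using J by (auto simp: ri.subspace_def algebra_simps)
  \<comment> \<open>The exact sequence survives reduction modulo \<open>f\<close> because
    \<open>f\<close> is regular modulo J + (x). This lets the induction continue with J + (f) in
    place of \<open>J\<close>.\<close>
  have eq1: "{r. x * r \<in> ?J} = ispan (insert f {r. x * r \<in> J})"
  proof safe
    fix r assume "x * r \<in> ?J"
    then obtain j s where js: "j \<in> J" "x * r = j + f * s" using ispan_insert_ideal[OF J] by blast
    have "f * s = x * r - j" using js by simp
    then have "f * s \<in> ispan (insert x J)"
      using js by (metis insertI1 insertI2 mult.commute ri.span_base ri.span_diff ri.span_scale)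
    then have "s \<in> ispan (insert x J)" using Cons.prems(3) by simp
    then obtain j' s' where js': "j' \<in> J" "s = j' + x * s'" using ispan_insert_ideal[OF J] by blast
    have "x * (r - f * s') = x * r - f * s + f * j'"
      unfolding js'(2) by (simp add: algebra_simps)
    then have "x * (r - f * s') = j + f * j'" using js(2) by simp
    then have mem: "x * (r - f * s') \<in> J" using js js' J by (simp add: ri.subspace_add ri.subspace_scale)
    have "r = (r - f * s') + f * s'" by simp
    with mem show "r \<in> ispan (insert f {r. x * r \<in> J})"
      unfolding ispan_insert_ideal[OF colon_ideal] by blast
  next
    fix r assume "r \<in> ispan (insert f {r. x * r \<in> J})"
    then obtain j s where js: "x * j \<in> J" "r = j + f * s"
      using ispan_insert_ideal[OF colon_ideal] by auto
    have "x * r = x * j + f * (x * s)" unfolding js(2) by (simp add: algebra_simps)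
    then show "x * r \<in> ?J" unfolding ispan_insert_ideal[OF J] using js by blast
  qed
  have eq2: "ispan (insert x ?J) = ispan (insert f (ispan (insert x J)))"
    by (simp only: ispan_insert_ispan insert_commute)
  have "wreg ?J fs"
    by (rule Cons.IH) (use Cons.prems eq1 eq2 in auto)
  then show ?case using reg by simp
qed

text \<open>The maps make the quotient by \<open>J\<close> a retract of the quotient by
  \<open>K\<close>, so a zero product in the former is tested in the latter and pulled back by
  \<open>\<psi>\<close>. The retraction persists when \<open>f\<close> is adjoined to
  \<open>J\<close> and \<open>\<phi> f\<close> to \<open>K\<close>, since
  \<open>\<psi> (\<phi> f)\<close> is congruent to \<open>f\<close>.\<close>

lemma wreg_transfer:
  fixes \<phi> :: "'a::comm_ring_1 \<Rightarrow> 'b::comm_ring_1" and \<psi> :: "'b \<Rightarrow> 'a"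
  assumes \<phi>: "\<And>a b. \<phi> (a + b) = \<phi> a + \<phi> b" "\<And>a b. \<phi> (a * b) = \<phi> a * \<phi> b"
    and \<psi>: "\<And>a b. \<psi> (a + b) = \<psi> a + \<psi> b" "\<And>a b. \<psi> (a * b) = \<psi> a * \<psi> b"
    and "is_ideal J" "is_ideal K" "\<And>j. j \<in> J \<Longrightarrow> \<phi> j \<in> K" "\<And>k. k \<in> K \<Longrightarrow> \<psi> k \<in> J"
    and "\<And>r. \<psi> (\<phi> r) - r \<in> J"
    and "wreg K (map \<phi> fs)"
  shows "wreg J fs"
  using assms(5-)
proof (induction fs arbitrary: J K)
  case Nil
  then show ?case by simp
next
  case (Cons f fs)
  note J = Cons.prems(1) and K = Cons.prems(2)
  have pull: "r \<in> J" if "\<phi> r \<in> K" for r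
  proof -
    have "\<psi> (\<phi> r) - (\<psi> (\<phi> r) - r) \<in> J"
      using Cons.prems(4)[OF that] Cons.prems(5) J ri.subspace_diff by blast
    then show ?thesis by simp
  qed
  have "\<psi> (\<phi> f) - f \<in> ispan (insert f J)" by (simp add: Cons.prems(5) ri.span_base)
  then have psi: "\<psi> (\<phi> f) \<in> ispan (insert f J)"
    by (metis diff_add_cancel insertI1 ri.span_add ri.span_base)
  have "wreg (ispan (insert f J)) fs"
  proof (rule Cons.IH[where K = "ispan (insert (\<phi> f) K)"])
    show "\<phi> j \<in> ispan (insert (\<phi> f) K)" if "j \<in> ispan (insert f J)" for j
      using that Cons.prems(3) unfolding ispan_insert_ideal[OF J] ispan_insert_ideal[OF K]
      by (auto simp: \<phi>) blast
    show "\<psi> k \<in> ispan (insert f J)" if k: "k \<in> ispan (insert (\<phi> f) K)" for k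
    proof -
      obtain j s where js: "j \<in> K" "k = j + \<phi> f * s" using k ispan_insert_ideal[OF K] by blast
      have "\<psi> (\<phi> f) * \<psi> s \<in> ispan (insert f J)" using psi by (simp add: is_ideal_mult)
      then show ?thesis using js Cons.prems(4)[of j] by (auto simp: \<psi> intro!: ri.span_add intro: ri.span_base)
    qed
    show "\<psi> (\<phi> r) - r \<in> ispan (insert f J)" for r by (simp add: Cons.prems(5) ri.span_base)
  qed (use Cons.prems in auto)
  moreover have "r \<in> J" if "f * r \<in> J" for r
    using Cons.prems(3)[OF that] Cons.prems(6) pull by (simp add: \<phi>)
  ultimately show ?case by simp
qed

text \<open>Turns the recursion of \<open>wreg\<close> into the indexed condition used by
  \<open>regular_sequence\<close>.\<close>

lemma wreg_nth:
  assumes "is_ideal J" "wreg J fs" "i < length fs" "fs ! i * r \<in> ispan (J \<union> set (take i fs))"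
  shows "r \<in> ispan (J \<union> set (take i fs))"
  using assms
proof (induction fs arbitrary: J i)
  case Nil
  then show ?case by simp
next
  case (Cons f fs)
  show ?case
  proof (cases i)
    case 0
    have eq: "ispan (J \<union> set (take i (f # fs))) = J" using 0 Cons.prems(1) by simp
    show ?thesis using Cons.prems(2,4) 0 unfolding eq by auto
  next
    case (Suc k)
    have eq: "ispan (J \<union> set (take i (f # fs))) = ispan (ispan (insert f J) \<union> set (take k fs))"
      unfolding Suc
      using ispan_Un_ispan[of "insert f J"] by simp
    show ?thesis unfolding eq
      by (rule Cons.IH) (use Cons.prems Suc eq in auto)
  qed
qed

section \<open>Linear maps and substitutions on polynomial rings\<close>

abbreviation (input) lookup where "lookup \<equiv> Poly_Mapping.lookup"

abbreviation (input) keys where "keys \<equiv> Poly_Mapping.keys"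

abbreviation (input) single where "single \<equiv> Poly_Mapping.single"

type_synonym ('v, 'k) mpoly = "('v \<Rightarrow>\<^sub>0 nat) \<Rightarrow>\<^sub>0 'k"

abbreviation cst :: "'k::comm_ring_1 \<Rightarrow> 'm::comm_monoid_add \<Rightarrow>\<^sub>0 'k"
  where "cst \<equiv> single 0"

lemma cst_add: "cst (a + b) = cst a + cst b"
  by (rule single_add)

lemma cst_mult: "cst (a * b) = cst a * cst b"
  by (simp add: mult_single)

lemma cst_sum: "cst (sum f A) = (\<Sum>x\<in>A. cst (f x))"
  by (induction A rule: infinite_finite_induct) (auto simp: cst_add)

lemma sum_singles:
  fixes p :: "'m \<Rightarrow>\<^sub>0 'k::comm_monoid_add"
  shows "(\<Sum>m\<in>keys p. single m (lookup p m)) = p"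
  by (rule poly_mapping_eqI)
    (auto simp: lookup_sum lookup_single when_def in_keys_iff sum.delta')

lemma mpoly_induct [case_names single add]:
  fixes p :: "'m \<Rightarrow>\<^sub>0 'k::comm_monoid_add"
  assumes "\<And>m c. P (single m c)" "\<And>p q. P p \<Longrightarrow> P q \<Longrightarrow> P (p + q)"
  shows "P p"
proof -
  have "P (\<Sum>m\<in>A. single m (lookup p m))" if "finite A" for A
    using that
  proof (induction A)
    case empty
    then show ?case using assms(1)[of undefined 0] by simp
  qed (simp add: assms)
  then show ?thesis by (metis finite_keys sum_singles)
qed

text \<open>The linear extension of \<open>f\<close> from the basis of monomials. Substitution,
  division by a polynomial in one variable and restriction of the variables are all
  instances.\<close>

definition lin ::
  "('m \<Rightarrow> ('n::comm_monoid_add \<Rightarrow>\<^sub>0 'k::comm_ring_1)) \<Rightarrow> ('m \<Rightarrow>\<^sub>0 'k) \<Rightarrow> ('n \<Rightarrow>\<^sub>0 'k)"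
  where "lin f p = (\<Sum>m\<in>keys p. cst (lookup p m) * f m)"

lemma lin_superset:
  assumes "finite A" "keys p \<subseteq> A"
  shows "lin f p = (\<Sum>m\<in>A. cst (lookup p m) * f m)"
  unfolding lin_def
  by (rule sum.mono_neutral_left) (use assms in \<open>auto simp: in_keys_iff\<close>)

lemma lin_add: "lin f (p + q) = lin f p + lin f q"
proof -
  let ?A = "keys p \<union> keys q"
  have "keys (p + q) \<subseteq> ?A" by (rule keys_add)
  then show ?thesis
    by (simp add: lin_superset[where A = ?A] lookup_add cst_add ring_distribs sum.distrib)
qed

lemma lin_single: "lin f (single m c) = cst c * f m"
  by (simp add: lin_superset[where A = "{m}"])

lemma lin_zero: "lin f 0 = 0"
  by (simp add: lin_def)

lemma lin_mult:
  assumes "\<And>m n. f (m + n) = f m * f n"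
  shows "lin f (p * q) = lin f p * lin f q"
proof (induction p rule: mpoly_induct)
  case (single m c)
  show ?case
  proof (induction q rule: mpoly_induct)
    case (single n d)
    show ?case by (simp only: mult_single[of m c n d] lin_single cst_mult assms mult_ac)
  qed (simp add: lin_add distrib_left)
qed (simp add: lin_add distrib_right)

lemma keys_add_nat:
  "keys (a + b :: 'v \<Rightarrow>\<^sub>0 nat) = keys a \<union> keys b"
  by (auto simp: in_keys_iff lookup_add)

section \<open>Substitution homomorphisms\<close>

definition mpow :: "('v \<Rightarrow> 'a::comm_ring_1) \<Rightarrow> ('v \<Rightarrow>\<^sub>0 nat) \<Rightarrow> 'a"
  where "mpow g m = (\<Prod>v\<in>keys m. g v ^ lookup m v)"

lemma mpow_superset:
  assumes "finite A" "keys m \<subseteq> A"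
  shows "mpow g m = (\<Prod>v\<in>A. g v ^ lookup m v)"
  unfolding mpow_def
  by (rule prod.mono_neutral_left) (use assms in \<open>auto simp: in_keys_iff\<close>)

lemma mpow_add: "mpow g (a + b) = mpow g a * mpow g b"
proof -
  let ?A = "keys a \<union> keys b"
  show ?thesis
    by (simp add: mpow_superset[where A = ?A] keys_add_nat lookup_add power_add prod.distrib)
qed

definition psubst :: "('v \<Rightarrow> ('w, 'k) mpoly) \<Rightarrow> ('v, 'k::comm_ring_1) mpoly \<Rightarrow>
    ('w, 'k) mpoly"
  where "psubst g = lin (mpow g)"

lemma psubst_add: "psubst g (p + q) = psubst g p + psubst g q"
  by (simp add: psubst_def lin_add)

lemma psubst_mult: "psubst g (p * q) = psubst g p * psubst g q"
  unfolding psubst_def by (rule lin_mult) (rule mpow_add)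

lemma psubst_single: "psubst g (single m c) = cst c * mpow g m"
  by (simp add: psubst_def lin_single)

lemma psubst_cst: "psubst g (cst c) = cst c"
  by (simp add: psubst_single mpow_def)

lemma psubst_zero: "psubst g 0 = 0"
  by (simp add: psubst_def lin_zero)

lemma psubst_one: "psubst g 1 = 1"
  using psubst_cst[of g 1] by simp

lemma psubst_uminus: "psubst g (- p) = - psubst g p"
  by (metis add_eq_0_iff psubst_add psubst_zero add.right_inverse)

lemma psubst_diff: "psubst g (p - q) = psubst g p - psubst g q"
  using psubst_add[of g p "- q"] by (simp add: psubst_uminus)

lemma psubst_sum: "psubst g (sum f A) = (\<Sum>x\<in>A. psubst g (f x))"
  by (induction A rule: infinite_finite_induct) (auto simp: psubst_zero psubst_add)

lemma psubst_power: "psubst g (p ^ i) = psubst g p ^ i"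
  by (induction i) (auto simp: psubst_one psubst_mult)

lemma psubst_mvar: "psubst g (mvar v) = g v"
  by (simp add: mvar_def psubst_single mpow_def)

abbreviation peval :: "'k::comm_ring_1 poly \<Rightarrow> ('m::comm_monoid_add \<Rightarrow>\<^sub>0 'k) \<Rightarrow> ('m \<Rightarrow>\<^sub>0 'k)"
  where "peval f x \<equiv> poly (map_poly cst f) x"

lemma peval_altdef: "peval f x = (\<Sum>i\<le>degree f. cst (coeff f i) * x ^ i)"
proof -
  have "degree (map_poly cst f) \<le> degree f"
    by (intro degree_le) (simp add: coeff_map_poly coeff_eq_0)
  then have "peval f x = (\<Sum>i\<le>degree f. coeff (map_poly cst f) i * x ^ i)"
    unfolding poly_altdef
    by (intro sum.mono_neutral_left) (auto intro!: le_degree)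
  then show ?thesis by (simp add: coeff_map_poly)
qed

lemma map_poly_cst_add: "map_poly cst (f + g) = map_poly cst f + map_poly cst g"
  by (rule poly_eqI) (simp add: coeff_map_poly cst_add)

lemma map_poly_cst_mult: "map_poly cst (f * g) = map_poly cst f * map_poly cst g"
proof (rule poly_eqI)
  fix n
  show "coeff (map_poly cst (f * g)) n =
      coeff (map_poly cst f * map_poly cst g) n"
    by (simp add: coeff_map_poly coeff_mult cst_mult cst_sum)
qed

lemma peval_add: "peval (f + g) x = peval f x + peval g x"
  by (simp add: map_poly_cst_add)

lemma peval_mult: "peval (f * g) x = peval f x * peval g x"
  by (simp add: map_poly_cst_mult)

lemma peval_monom: "peval (monom c i) x = cst c * x ^ i"
  by (simp add: map_poly_monom poly_monom)

lemma psubst_peval: "psubst g (peval f x) = peval f (psubst g x)"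
  by (simp add: peval_altdef psubst_sum psubst_mult psubst_cst psubst_power)

section \<open>Stanley--Reisner ideals\<close>

lemma lookup_single_mult:
  fixes p :: "('v, 'k::comm_ring_1) mpoly"
  shows "lookup (single m c * p) (m + n) = c * lookup p n"
proof (induction p rule: mpoly_induct)
  case (single n' d)
  then show ?case by (auto simp: mult_single lookup_single when_def)
qed (auto simp: distrib_left lookup_add)

lemma keys_single_mult:
  fixes p :: "('v, 'k::comm_ring_1) mpoly"
  shows "keys (single m 1 * p) = (+) m ` keys p"
proof
  show "keys (single m 1 * p) \<subseteq> (+) m ` keys p"
    using keys_mult[of "single m 1" p] by auto
  show "(+) m ` keys p \<subseteq> keys (single m 1 * p)"
    by (auto simp: in_keys_iff lookup_single_mult)
qed

text \<open>The Stanley-Reisner ideal of the complex \<open>\<Delta>\<close>, taken in the ring in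
  all variables, so a variable that belongs to no face lies in it. For
  \<open>\<Delta> = Pow T\<close> the quotient is the polynomial ring on \<open>T\<close>.\<close>

definition SR :: "'v set set \<Rightarrow> ('v, 'k::comm_ring_1) mpoly set"
  where "SR \<Delta> = {p. \<forall>m\<in>keys p. keys m \<notin> \<Delta>}"

definition down_closed :: "'v set set \<Rightarrow> bool"
  where "down_closed \<Delta> \<longleftrightarrow> (\<forall>H\<in>\<Delta>. \<forall>H'\<subseteq>H. H' \<in> \<Delta>)"

lemma SR_ideal:
  assumes "down_closed \<Delta>"
  shows "is_ideal (SR \<Delta>)"
proof (rule ri.subspaceI)
  show "0 \<in> SR \<Delta>" by (simp add: SR_def)
  show "x + y \<in> SR \<Delta>" if "x \<in> SR \<Delta>" "y \<in> SR \<Delta>" for x y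
    using that keys_add[of x y] by (auto simp: SR_def)
  show "c * x \<in> SR \<Delta>" if "x \<in> SR \<Delta>" for c x
    unfolding SR_def
  proof safe
    fix m assume "m \<in> keys (c * x)" "keys m \<in> \<Delta>"
    then obtain a b where ab: "b \<in> keys x" "m = a + b"
      using keys_mult[of c x] by blast
    then have "keys b \<subseteq> keys m" by (simp add: keys_add_nat)
    then have "keys b \<in> \<Delta>" using assms \<open>keys m \<in> \<Delta>\<close> unfolding down_closed_def by blast
    then show False using that ab by (simp add: SR_def)
  qed
qed

text \<open>Multiplication by a variable shifts exponents without cancellation and inserts
  \<open>e\<close> into each support. For a down-closed \<open>\<Delta>\<close> the complex on the
  right is the closed star of \<open>e\<close>.\<close>

lemma SR_colon: "{r. mvar e * r \<in> SR \<Delta>} = SR {H. insert e H \<in> \<Delta>}"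
  by (auto simp: SR_def mvar_def keys_single_mult keys_add_nat)

text \<open>A monomial whose support is a face of \<open>\<Delta>\<close> but not of the deletion
  contains \<open>e\<close>, hence is divisible by the variable; all other nonface monomials are in
  \<open>SR \<Delta>\<close> already.\<close>

lemma SR_insert:
  fixes \<Delta> :: "'v set set"
  assumes "down_closed \<Delta>"
  shows "ispan (insert (mvar e) (SR \<Delta>)) = SR {H \<in> \<Delta>. e \<notin> H}" (is "?L = ?R")
proof
  have "down_closed {H \<in> \<Delta>. e \<notin> H}" using assms by (auto simp: down_closed_def)
  then have "is_ideal ?R" by (rule SR_ideal)
  then show "?L \<subseteq> ?R" by (intro ri.span_minimal) (auto simp: SR_def mvar_def)
  show "?R \<subseteq> ?L"
  proof
    fix p :: "('v, 'a) mpoly"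
    assume p: "p \<in> ?R"
    have "single m (lookup p m) \<in> ?L" if m: "m \<in> keys p" for m
    proof (cases "keys m \<in> \<Delta>")
      case True
      then have "e \<in> keys m" using p m by (auto simp: SR_def)
      then have "single e 1 + (m - single e 1) = m"
        by (intro poly_mapping_eqI) (auto simp: lookup_add lookup_minus lookup_single when_def in_keys_iff)
      then have "single m (lookup p m) =
          single (m - single e 1) (lookup p m) * mvar e"
        by (simp add: mvar_def mult_single add.commute)
      then show ?thesis by (simp add: ri.span_base ri.span_scale)
    next
      case False
      then show ?thesis by (intro ri.span_base) (auto simp: SR_def)
    qed
    then have "(\<Sum>m\<in>keys p. single m (lookup p m)) \<in> ?L"
      by (rule ri.span_sum)
    then show "p \<in> ?L" by (simp add: sum_singles)
  qed
qed

section \<open>Univariate polynomials in distinct variables\<close>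

lemma lin_sum: "lin f (sum g A) = (\<Sum>x\<in>A. lin f (g x))"
  by (induction A rule: infinite_finite_induct) (auto simp: lin_zero lin_add)

lemma peval_smult: "peval (smult c f) x = cst c * peval f x"
proof -
  have "peval [:c:] x = cst c" by (simp add: peval_altdef)
  then show ?thesis using peval_mult[of "[:c:]" f x] by simp
qed

lemma mvar_power: "mvar v ^ i = single (single v i) 1"
proof (induction i)
  case (Suc i)
  have "single v (Suc 0) + single v i = single v (Suc i)"
    by (simp flip: single_add)
  then show ?case by (simp add: Suc.IH) (simp add: mvar_def mult_single)
qed simp

lemma keys_peval_mvar:
  assumes "m \<in> keys (peval f (mvar v))"
  shows "keys m \<subseteq> {v}"
proof -
  have "peval f (mvar v) = (\<Sum>i\<le>degree f.
      single (single v i) (coeff f i))"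
    by (simp add: peval_altdef mvar_power mult_single)
  then have "m \<in> (\<Union>i\<in>{..degree f}.
      keys (single (single v i) (coeff f i)))"
    using assms keys_sum by fastforce
  then show ?thesis by (auto split: if_splits)
qed

text \<open>The quotient of the Euclidean division by \<open>f(v)\<close>, linear over the polynomials not involving
  \<open>v\<close>.\<close>

definition divop :: "'k::field poly \<Rightarrow> 'v \<Rightarrow> ('v, 'k) mpoly \<Rightarrow> ('v, 'k) mpoly"
  where "divop f v = lin (\<lambda>m. peval (monom 1 (lookup m v) div f) (mvar v) *
    single (m - single v (lookup m v)) 1)"

lemma divop_add: "divop f v (p + q) = divop f v p + divop f v q"
  by (simp add: divop_def lin_add)

lemma divop_mult_free:
  assumes "\<And>m. m \<in> keys b \<Longrightarrow> v \<notin> keys m"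
  shows "divop f v (q * b) = divop f v q * b"
proof -
  have single: "divop f v (q * single m d) = divop f v q * single m d"
    if "v \<notin> keys m" for m d
  proof (induction q rule: mpoly_induct)
    case (single n c)
    have m: "lookup m v = 0" using that by (simp add: in_keys_iff)
    then have eq: "(n + m) - single v (lookup n v) =
        (n - single v (lookup n v)) + m"
      by (intro poly_mapping_eqI) (auto simp: lookup_add lookup_minus lookup_single when_def)
    let ?n = "n - single v (lookup n v)"
    have d: "single m d = cst d * single m 1"
      by (simp add: mult_single)
    have n: "single (?n + m) 1 = single ?n 1 * single m (1::'b)"
      by (simp add: mult_single)
    have lk: "lookup (n + m) v = lookup n v" by (simp add: lookup_add m)
    have "divop f v (single (n + m) (c * d)) = cst (c * d) *
        (peval (monom 1 (lookup n v) div f) (mvar v) * single (?n + m) 1)"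
      unfolding divop_def lin_single lk eq ..
    also have "\<dots> = divop f v (single n c) * single m d"
      unfolding divop_def lin_single d n cst_mult by (simp only: mult_ac)
    finally show ?case by (simp only: mult_single[of n c m d])
  qed (simp add: divop_def lin_add distrib_right)
  have "divop f v (q * b) = divop f v (\<Sum>m\<in>keys b. q * single m (lookup b m))"
    by (simp add: sum_singles flip: sum_distrib_left)
  also have "\<dots> = (\<Sum>m\<in>keys b. divop f v (q * single m (lookup b m)))"
    by (simp add: divop_def lin_sum)
  also have "\<dots> = (\<Sum>m\<in>keys b. divop f v q * single m (lookup b m))"
    using assms single by (intro sum.cong) auto
  also have "\<dots> = divop f v q * b"
    by (simp add: sum_singles flip: sum_distrib_left)
  finally show ?thesis .
qed

lemma divop_peval:
  fixes a :: "'k::field poly"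
  shows "divop f v (peval a (mvar v)) = peval (a div f) (mvar v)"
proof -
  have mon: "divop f v (peval (monom d i) (mvar v)) =
      peval (monom d i div f) (mvar v)" for d i
  proof -
    have "monom d i div f = smult d (monom 1 i div f)"
      by (simp flip: div_smult_left add: smult_monom)
    then have "peval (monom d i div f) (mvar v) =
        cst d * peval (monom 1 i div f) (mvar v)"
      by (simp only: peval_smult)
    then show ?thesis
      by (simp add: peval_monom mvar_power mult_single divop_def lin_single)
  qed
  have "divop f v (peval (\<Sum>i\<in>A. monom (u i) i) (mvar v)) =
      peval ((\<Sum>i\<in>A. monom (u i) i) div f) (mvar v)" if "finite A" for A u
    using that
  proof induction
    case empty
    then show ?case by (simp add: divop_def lin_zero)
  next
    case (insert x F)
    then show ?case
      by (simp only: sum.insert peval_add divop_add poly_div_add_left mon simp_thms)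
  qed
  from this[of "{..degree a}" "coeff a"] show ?thesis
    by (simp add: poly_as_sum_of_monoms)
qed

text \<open>Splitting the power of \<open>v\<close> off a monomial reduces this to exact division in
  one variable. The operator is thus a left inverse of multiplication by
  \<open>f(v)\<close>.\<close>

lemma divop_peval_mult:
  assumes "f \<noteq> 0"
  shows "divop f v (peval f (mvar v) * r) = r"
proof (induction r rule: mpoly_induct)
  case (single m c)
  let ?m = "m - single v (lookup m v)"
  have "single v (lookup m v) + ?m = m"
    by (intro poly_mapping_eqI) (auto simp: lookup_add lookup_minus lookup_single when_def)
  then have eq: "single m c =
      peval (monom 1 (lookup m v)) (mvar v) * single ?m c"
    by (simp add: peval_monom mvar_power mult_single)
  have free: "v \<notin> keys m'" if "m' \<in> keys (single ?m c)" for m'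
    using that by (auto simp: in_keys_iff lookup_minus split: if_splits)
  have mult: "divop f v (q * single ?m c) = divop f v q * single ?m c" for q
    by (rule divop_mult_free) (rule free)
  have "divop f v (peval f (mvar v) * single m c) =
      divop f v (peval (f * monom 1 (lookup m v)) (mvar v) * single ?m c)"
    by (simp add: eq peval_mult mult.assoc)
  also have "\<dots> = peval (monom 1 (lookup m v)) (mvar v) * single ?m c"
    using assms by (simp add: mult divop_peval)
  finally show ?case using eq by simp
qed (simp add: divop_def lin_add distrib_left)

text \<open>Linearity over polynomials free of \<open>v\<close> makes \<open>divop\<close> preserve
  \<open>ispan B\<close>, and it undoes multiplication by \<open>f(v)\<close>, so
  \<open>f(v)\<close> is regular modulo \<open>B\<close>. The set \<open>B\<close> gathers the
  polynomials already treated, which avoid all variables still to come.\<close>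

lemma wreg_univariate:
  fixes f :: "'v \<Rightarrow> 'k::field poly"
  assumes "distinct vs" "\<And>v. v \<in> set vs \<Longrightarrow> f v \<noteq> 0"
    and "\<And>b m. b \<in> B \<Longrightarrow> m \<in> keys b \<Longrightarrow> keys m \<inter> set vs = {}"
  shows "wreg (ispan B) (map (\<lambda>v. peval (f v) (mvar v)) vs)"
  using assms
proof (induction vs arbitrary: B)
  case Nil
  then show ?case by simp
next
  case (Cons v vs)
  let ?F = "peval (f v) (mvar v)"
  have div: "divop (f v) v x \<in> ispan B" if "x \<in> ispan B" for x
    using that
  proof (induction rule: ri.span_induct_alt)
    case base
    then show ?case by (simp add: divop_def lin_zero ri.span_zero)
  next
    case (step c b y)
    have "divop (f v) v (c * b) = divop (f v) v c * b"
      by (rule divop_mult_free) (use Cons.prems(3)[OF step(1)] in auto)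
    then have "divop (f v) v (c * b + y) = divop (f v) v c * b + divop (f v) v y"
      by (simp add: divop_def lin_add)
    then show ?case using step by (simp add: ri.span_add ri.span_base ri.span_scale)
  qed
  have "r \<in> ispan B" if "?F * r \<in> ispan B" for r
    using div[OF that] divop_peval_mult[of "f v" v r] Cons.prems(2) by simp
  moreover have "wreg (ispan (insert ?F B)) (map (\<lambda>v. peval (f v) (mvar v)) vs)"
  proof (rule Cons.IH)
    fix b m assume bm: "b \<in> insert ?F B" "m \<in> keys b"
    show "keys m \<inter> set vs = {}"
    proof (cases "b = ?F")
      case True
      then show ?thesis using bm keys_peval_mvar[of m "f v" v] Cons.prems(1) by auto
    next
      case False
      then show ?thesis using bm Cons.prems(3)[of b m] by auto
    qed
  qed (use Cons.prems in auto)
  ultimately show ?case by (simp add: ispan_insert_ispan)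
qed

section \<open>Directed forests\<close>

text \<open>The conjuncts match the two families of generators: a pair of edges into one vertex
  violates the first, a cycle the second.\<close>

definition forest :: "('v \<times> 'v) set \<Rightarrow> bool"
  where "forest F \<longleftrightarrow> single_valued (F\<inverse>) \<and> acyclic F"

lemma forest_mono: "forest F \<Longrightarrow> F' \<subseteq> F \<Longrightarrow> forest F'"
  unfolding forest_def by (meson acyclic_subset converse_mono single_valued_subset)

lemma forest_parent_unique: "forest F \<Longrightarrow> (i, j) \<in> F \<Longrightarrow> (l, j) \<in> F \<Longrightarrow> i = l"
  by (auto simp: forest_def single_valued_def)

lemma forest_insert:
  "forest (insert (i, j) F) \<longleftrightarrow> forest F \<and> (\<forall>l. (l, j) \<in> F \<longrightarrow> l = i) \<and> (j, i) \<notin> F\<^sup>*"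
  by (auto simp: forest_def acyclic_insert single_valued_def)

text \<open>The forest complex after deleting the edges outside \<open>G\<close> and contracting
  those in \<open>F\<close>. For \<open>F \<subseteq> G\<close> the contracted edges stay in the
  ground set as cone points, so the ring need not change.\<close>

definition rel_faces :: "('v \<times> 'v) set \<Rightarrow> ('v \<times> 'v) set \<Rightarrow> ('v \<times> 'v) set set"
  where "rel_faces F G = {H. H \<subseteq> G \<and> forest (H \<union> F)}"

lemma down_closed_rel_faces: "down_closed (rel_faces F G)"
  by (auto simp: down_closed_def rel_faces_def intro: forest_mono)

text \<open>Cut the path at its first visit to \<open>s\<close>: up to there it uses no edge leaving
  \<open>s\<close>.\<close>

lemma rtrancl_to_source:
  assumes "(j, s) \<in> G\<^sup>*" "\<And>a b. (a, b) \<in> G \<Longrightarrow> a \<noteq> s \<Longrightarrow> (a, b) \<in> F"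
  shows "(j, s) \<in> F\<^sup>*"
  using assms(1)
proof (induction rule: converse_rtrancl_induct)
  case (step y z)
  then show ?case using assms(2) by (metis converse_rtrancl_into_rtrancl rtrancl.rtrancl_refl)
qed simp

text \<open>Induction over deletions and contractions of edges not leaving the source \<open>s\<close>.\<close>

lemma wreg_rel_faces:
  fixes fs :: "('v \<times> 'v, 'k::comm_ring_1) mpoly list"
  assumes base: "\<And>T. T \<subseteq> E \<Longrightarrow> forest T \<Longrightarrow> (\<And>j. j \<in> V \<Longrightarrow> forest (insert (s, j) T) \<Longrightarrow> (s, j) \<in> T) \<Longrightarrow>
      wreg (SR (Pow T)) fs"
    and "finite G" "G \<subseteq> E" "F \<subseteq> G" "forest F"
    and "\<And>j. j \<in> V \<Longrightarrow> forest (insert (s, j) F) \<Longrightarrow> (s, j) \<in> G"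
  shows "wreg (SR (rel_faces F G)) fs"
  using assms(2-)
proof (induction "card (G - F)" arbitrary: F G rule: less_induct)
  case less
  have less_card: "card (G - {e} - F) < card (G - F)" "card (G - insert e F) < card (G - F)"
    if "e \<in> G - F" for e
  proof -
    have "finite (G - F)" using less.prems by simp
    moreover have "G - {e} - F = G - F - {e}" "G - insert e F = G - F - {e}" by auto
    ultimately show "card (G - {e} - F) < card (G - F)" "card (G - insert e F) < card (G - F)"
      using that by (simp_all only: card_Diff1_less)
  qed
  \<comment> \<open>An edge that cannot be added to \<open>F\<close> lies in no face and is deleted.
    An edge not leaving \<open>s\<close> yields an exact sequence from its contraction and deletion.
    If only addable edges leaving \<open>s\<close> remain, each is a cone point. An edge
    \<open>(s, j)\<close> is never deleted while it is still addable to \<open>F\<close>; hence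
    \<open>F\<close> is spanning once \<open>G = F\<close>.\<close>
  consider "G = F"
    | (nonforest) e where "e \<in> G - F" "\<not> forest (insert e F)"
    | (split) i j where "(i, j) \<in> G - F" "i \<noteq> s" "forest (insert (i, j) F)"
    | (cone) j where "(s, j) \<in> G - F" "\<And>i j. (i, j) \<in> G - F \<Longrightarrow> i = s \<and> forest (insert (i, j) F)"
    using less.prems(3) by (metis (no_types, lifting) Diff_eq_empty_iff equals0I prod.exhaust subset_antisym)
  then show ?case
  proof cases
    case 1
    then have "rel_faces F G = Pow F"
      using less.prems(4) by (auto simp: rel_faces_def Un_absorb2 sup.absorb2)
    then show ?thesis using base[of F] less.prems 1 by auto
  next
    case nonforest
    have "rel_faces F G = rel_faces F (G - {e})"
      using nonforest forest_mono unfolding rel_faces_def by blast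
    moreover have "wreg (SR (rel_faces F (G - {e}))) fs"
    proof (rule less.hyps)
      show "card (G - {e} - F) < card (G - F)" using less_card nonforest by blast
      show "(s, j) \<in> G - {e}" if "j \<in> V" "forest (insert (s, j) F)" for j
        using that less.prems(5)[OF that] nonforest by auto
    qed (use less.prems(1-4) nonforest in auto)
    ultimately show ?thesis by simp
  next
    case split
    let ?e = "(i, j)"
    have colon: "{H. insert ?e H \<in> rel_faces F G} = rel_faces (insert ?e F) G"
      using split by (auto simp: rel_faces_def)
    have deletion: "{H \<in> rel_faces F G. ?e \<notin> H} = rel_faces F (G - {?e})"
      by (auto simp: rel_faces_def)
    have "wreg (SR (rel_faces (insert ?e F) G)) fs"
    proof (rule less.hyps)
      show "card (G - insert ?e F) < card (G - F)" using less_card split by blast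
      show "(s, l) \<in> G" if "l \<in> V" "forest (insert (s, l) (insert ?e F))" for l
        using less.prems(5)[of l] that forest_mono[of _ "insert (s, l) F"] by blast
    qed (use less.prems(1-4) split in auto)
    moreover have "wreg (SR (rel_faces F (G - {?e}))) fs"
    proof (rule less.hyps)
      show "card (G - {?e} - F) < card (G - F)" using less_card split by blast
      show "(s, l) \<in> G - {?e}" if "l \<in> V" "forest (insert (s, l) F)" for l
        using that less.prems(5)[OF that] split by auto
    qed (use less.prems(1-4) split in auto)
    ultimately show ?thesis
      using wreg_colon[OF SR_ideal[OF down_closed_rel_faces[of F G]], of "mvar ?e" fs]
      by (simp add: SR_colon SR_insert[OF down_closed_rel_faces] colon deletion)
  next
    case cone
    let ?e = "(s, j)"
    have Fe: "forest (insert ?e F)" using cone by blast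
    \<comment> \<open>Edges of \<open>H\<close> outside \<open>F\<close> all leave \<open>s\<close>,
      so a path from \<open>j\<close> to \<open>s\<close> in \<open>H \<union> F\<close>, cut at the
      first visit to \<open>s\<close>, already runs in \<open>F\<close>.\<close>
    have "forest (insert ?e (H \<union> F))" if H: "H \<subseteq> G" "forest (H \<union> F)" for H
      unfolding forest_insert
    proof (intro conjI allI impI)
      show "forest (H \<union> F)" by fact
      show "l = s" if "(l, j) \<in> H \<union> F" for l
        using that H cone(2)[of l j] Fe less.prems(3) unfolding forest_insert by blast
      show "(j, s) \<notin> (H \<union> F)\<^sup>*"
      proof
        assume "(j, s) \<in> (H \<union> F)\<^sup>*"
        then have "(j, s) \<in> F\<^sup>*"
          by (rule rtrancl_to_source) (use H cone(2) in blast)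
        then show False using Fe unfolding forest_insert by blast
      qed
    qed
    then have "rel_faces F G = rel_faces (insert ?e F) G"
      using forest_mono unfolding rel_faces_def by (auto simp: forest_mono[of "insert ?e _"])
    moreover have "wreg (SR (rel_faces (insert ?e F) G)) fs"
    proof (rule less.hyps)
      show "card (G - insert ?e F) < card (G - F)" using less_card cone by blast
      show "(s, l) \<in> G" if "l \<in> V" "forest (insert (s, l) (insert ?e F))" for l
        using less.prems(5)[of l] that forest_mono[of _ "insert (s, l) F"] by blast
    qed (use less.prems(1-4) cone(1) Fe in auto)
    ultimately show ?thesis by simp
  qed
qed

section \<open>Substitutions modulo an ideal\<close>

lemma ideal_mult_cong:
  assumes "is_ideal J" "a - a' \<in> J" "b - b' \<in> J"
  shows "a * b - a' * b' \<in> J"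
proof -
  have "a * b - a' * b' = b * (a - a') + a' * (b - b')" by (simp add: algebra_simps)
  then show ?thesis using assms by (simp add: ri.subspace_add ri.subspace_scale)
qed

lemma ideal_power_cong: "is_ideal J \<Longrightarrow> a - a' \<in> J \<Longrightarrow> a ^ i - a' ^ i \<in> J"
  by (induction i) (auto intro: ideal_mult_cong ri.subspace_0)

lemma ideal_mpow_cong:
  assumes "is_ideal J" "\<And>v. v \<in> keys m \<Longrightarrow> g v - g' v \<in> J"
  shows "mpow g m - mpow g' m \<in> J"
proof -
  have "(\<Prod>v\<in>A. g v ^ lookup m v) - (\<Prod>v\<in>A. g' v ^ lookup m v) \<in> J"
    if "finite A" "A \<subseteq> keys m" for A
    using that
    by (induction A) (use assms in \<open>auto intro!: ideal_mult_cong ideal_power_cong ri.subspace_0\<close>)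
  then show ?thesis by (simp add: mpow_def)
qed

lemma mpow_zero [simp]: "mpow g 0 = 1"
  by (simp add: mpow_def)

lemma mpow_mvar: "mpow mvar m = (single m 1 :: ('v, 'k::comm_ring_1) mpoly)"
proof -
  have "(\<Prod>v\<in>A. mvar v ^ lookup m v) =
      single (\<Sum>v\<in>A. single v (lookup m v)) (1::'k)" if "finite A" for A
    using that by (induction A) (auto simp: mvar_power mult_single)
  then show ?thesis by (simp add: mpow_def sum_singles)
qed

lemma psubst_mpow: "psubst g (mpow h m) = mpow (\<lambda>v. psubst g (h v)) m"
proof -
  have "psubst g (\<Prod>v\<in>A. h v ^ lookup m v) = (\<Prod>v\<in>A. psubst g (h v) ^ lookup m v)"
    if "finite A" for A
    using that by (induction A) (auto simp: psubst_one psubst_mult psubst_power)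
  then show ?thesis by (simp add: mpow_def)
qed

text \<open>Substitutions fix constants and congruence respects sums and products, so it is enough
  to compare the values on variables.\<close>

lemma psubst_comp_cong:
  assumes "is_ideal J" "\<And>v. psubst h (g v) - mvar v \<in> J"
  shows "psubst h (psubst g r) - r \<in> J"
proof (induction r rule: mpoly_induct)
  case (single m c)
  have "single m c = cst c * mpow mvar m"
    by (simp add: mpow_mvar mult_single)
  moreover have "psubst h (psubst g (single m c)) =
      cst c * mpow (\<lambda>v. psubst h (g v)) m"
    by (simp add: psubst_single psubst_mult psubst_cst psubst_mpow)
  moreover have "cst c * (mpow (\<lambda>v. psubst h (g v)) m - mpow mvar m) \<in> J"
    using assms by (intro ri.subspace_scale ideal_mpow_cong)
  ultimately show ?case by (simp only: right_diff_distrib)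
next
  case (add p q)
  then have "(psubst h (psubst g p) - p) + (psubst h (psubst g q) - q) \<in> J"
    using assms(1) ri.subspace_add by blast
  then show ?case by (simp only: psubst_add add_diff_add)
qed

section \<open>Spanning trees\<close>

definition descendants :: "'v set \<Rightarrow> ('v \<times> 'v) set \<Rightarrow> 'v \<Rightarrow> 'v set"
  where "descendants V T v = {w \<in> V. (v, w) \<in> T\<^sup>*}"

definition in_edges :: "('v \<times> 'v) set \<Rightarrow> 'v \<Rightarrow> ('v \<times> 'v) set"
  where "in_edges E v = {e \<in> E. snd e = v}"

definition out_edges :: "('v \<times> 'v) set \<Rightarrow> 'v \<Rightarrow> ('v \<times> 'v) set"
  where "out_edges E v = {e \<in> E. fst e = v}"

text \<open>At \<open>x = mvar\<close> this is the form \<open>\<theta>\<^sub>v\<close>. The edge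
  set is a parameter because the forms of \<open>E\<close> are compared with those of a tree
  \<open>T\<close>.\<close>

definition excess :: "('v \<times> 'v) set \<Rightarrow> ('v \<times> 'v \<Rightarrow> 'a::ab_group_add) \<Rightarrow> 'v \<Rightarrow> 'a"
  where "excess E x v = sum x (in_edges E v) - sum x (out_edges E v)"

text \<open>Parents are unique, so walking backwards from \<open>x\<close> is deterministic and both
  ancestors lie on one backward path.\<close>

lemma forest_comparable:
  assumes "forest T" "(a, x) \<in> T\<^sup>*" "(b, x) \<in> T\<^sup>*"
  shows "(a, b) \<in> T\<^sup>* \<or> (b, a) \<in> T\<^sup>*"
proof -
  have "(x, a) \<in> (T\<inverse>)\<^sup>*" "(x, b) \<in> (T\<inverse>)\<^sup>*" using assms by (auto simp: rtrancl_converse)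
  then have "(a, b) \<in> (T\<inverse>)\<^sup>* \<or> (b, a) \<in> (T\<inverse>)\<^sup>*"
    using single_valued_confluent[of "T\<inverse>" x a b] assms(1) by (auto simp: forest_def)
  then show ?thesis by (auto simp: rtrancl_converse)
qed

text \<open>Otherwise the path from \<open>j\<close> to \<open>l\<close> passes through the parent
  \<open>v\<close> of \<open>l\<close> and closes a cycle with the edge to \<open>j\<close>. Hence
  the subtrees of different children are disjoint.\<close>

lemma forest_siblings:
  assumes "forest T" "(v, j) \<in> T" "(v, l) \<in> T" "(j, l) \<in> T\<^sup>*"
  shows "j = l"
proof (rule ccontr)
  assume "j \<noteq> l"
  then obtain p where "(j, p) \<in> T\<^sup>*" "(p, l) \<in> T" using assms(4) by (metis rtranclE)
  then have "(j, v) \<in> T\<^sup>*" using forest_parent_unique assms by metis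
  then have "(v, v) \<in> T\<^sup>+" using assms(2) by auto
  then show False using assms(1) by (auto simp: forest_def acyclic_def)
qed

lemma sum_descendants:
  fixes g :: "'v \<Rightarrow> 'a::ab_group_add"
  assumes "forest T" "finite V" "T \<subseteq> V \<times> V" "v \<in> V"
  shows "sum g (descendants V T v) = g v + (\<Sum>j\<in>T `` {v}. sum g (descendants V T j))"
proof -
  have fin: "finite (T `` {v})" by (rule finite_subset[of _ V]) (use assms in auto)
  have eq: "descendants V T v = insert v (\<Union>j\<in>T `` {v}. descendants V T j)"
    unfolding descendants_def using assms(3,4)
    by (auto intro: converse_rtrancl_into_rtrancl elim: converse_rtranclE)
  have notin: "v \<notin> (\<Union>j\<in>T `` {v}. descendants V T j)"
  proof
    assume "v \<in> (\<Union>j\<in>T `` {v}. descendants V T j)"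
    then obtain j where "(v, j) \<in> T" "(j, v) \<in> T\<^sup>*" by (auto simp: descendants_def)
    then have "(v, v) \<in> T\<^sup>+" by auto
    then show False using assms(1) by (auto simp: forest_def acyclic_def)
  qed
  have disj: "descendants V T j \<inter> descendants V T l = {}"
    if "(v, j) \<in> T" "(v, l) \<in> T" "j \<noteq> l" for j l
    using forest_comparable[OF assms(1), of j _ l] forest_siblings[OF assms(1), of v] that
    by (fastforce simp: descendants_def)
  have finD: "finite (descendants V T j)" for j using assms(2) by (simp add: descendants_def)
  show ?thesis
    unfolding eq using notin fin finD disj
    by (simp add: sum.UNION_disjoint)
qed

lemma in_edges_child: "forest T \<Longrightarrow> (v, j) \<in> T \<Longrightarrow> in_edges T j = {(v, j)}"
  by (auto simp: in_edges_def dest: forest_parent_unique)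

text \<open>The sum telescopes: an edge between two descendants occurs once with each sign, no edge
  leaves the set of descendants, and only edges into \<open>v\<close> survive. This is the explicit
  integral inverse of the incidence matrix of a tree.\<close>

lemma sum_excess_descendants:
  fixes x :: "'v \<times> 'v \<Rightarrow> 'a::ab_group_add"
  assumes T: "forest T" "finite V" "T \<subseteq> V \<times> V" and "v \<in> V"
  shows "sum (excess T x) (descendants V T v) = sum x (in_edges T v)"
proof -
  have "finite T" using T finite_subset by fastforce
  then have "wf (T\<inverse>)" using T(1) finite_acyclic_wf_converse by (auto simp: forest_def)
  then show ?thesis using \<open>v \<in> V\<close>
  proof (induction v rule: wf_induct_rule)
    case (less v)
    have "(\<Sum>j\<in>T `` {v}. sum (excess T x) (descendants V T j)) = (\<Sum>j\<in>T `` {v}. x (v, j))"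
      using less.IH T in_edges_child[OF T(1)] by (intro sum.cong) auto
    also have "\<dots> = sum x (out_edges T v)"
      by (rule sum.reindex_bij_witness[of _ snd "\<lambda>j. (v, j)"]) (auto simp: out_edges_def)
    finally show ?case
      using sum_descendants[OF T less.prems, of "excess T x"] by (simp add: excess_def)
  qed
qed

text \<open>A root that did not reach \<open>s\<close> could receive the edge from \<open>s\<close>
  without a second parent or a cycle, contradicting the spanning condition. So every root reaches
  \<open>s\<close>; vertices reaching \<open>s\<close> are comparable, which leaves one root. It may
  differ from \<open>s\<close>, since edges into \<open>s\<close> are allowed.\<close>

lemma descendants_root:
  assumes T: "forest T" "finite V" "T \<subseteq> V \<times> V"
    and span: "\<And>j. j \<in> V - {s} \<Longrightarrow> forest (insert (s, j) T) \<Longrightarrow> (s, j) \<in> T"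
    and v: "v \<in> V" "in_edges T v = {}"
  shows "descendants V T v = V"
proof -
  have root: "(r, s) \<in> T\<^sup>*" if "r \<in> V" "in_edges T r = {}" for r
  proof (rule ccontr)
    assume not: "(r, s) \<notin> T\<^sup>*"
    then have "r \<noteq> s" by auto
    have "forest (insert (s, r) T)"
      unfolding forest_insert using T(1) not that(2) by (auto simp: in_edges_def)
    then have "(s, r) \<in> T" using span \<open>r \<noteq> s\<close> that by auto
    then show False using that(2) by (auto simp: in_edges_def)
  qed
  have root_unique: "r = v" if "r \<in> V" "in_edges T r = {}" for r
  proof -
    have no_in: "(a, b) \<in> T\<^sup>* \<Longrightarrow> in_edges T b = {} \<Longrightarrow> a = b" for a b
      by (erule rtranclE) (auto simp: in_edges_def)
    show ?thesis
      using forest_comparable[OF T(1) root[OF that] root[OF v]] no_in that v by blast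
  qed
  have "finite T" using T finite_subset by fastforce
  then have wf: "wf T" using T(1) finite_acyclic_wf by (auto simp: forest_def)
  have "(v, w) \<in> T\<^sup>*" if "w \<in> V" for w
    using wf that
  proof (induction w rule: wf_induct_rule)
    case (less w)
    show ?case
    proof (cases "in_edges T w = {}")
      case True
      then show ?thesis using root_unique less.prems by auto
    next
      case False
      then obtain p where p: "(p, w) \<in> T" by (auto simp: in_edges_def)
      then have "(v, p) \<in> T\<^sup>*" using less.IH T(3) by auto
      then show ?thesis using p by auto
    qed
  qed
  then show ?thesis by (auto simp: descendants_def)
qed

text \<open>On a spanning tree the excesses at the vertices other than \<open>s\<close> form a linear coordinate
  system, because the value of an edge is the sum of the excesses over its descendants.\<close>

lemma wreg_spanning:
  fixes f :: "'v \<Rightarrow> 'k::field poly"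
  assumes E: "finite V" "E \<subseteq> V \<times> V" "s \<in> V"
    and T: "T \<subseteq> E" "forest T"
    and span: "\<And>j. j \<in> V - {s} \<Longrightarrow> forest (insert (s, j) T) \<Longrightarrow> (s, j) \<in> T"
    and vs: "set vs \<subseteq> V - {s}" "distinct vs" "\<And>v. v \<in> set vs \<Longrightarrow> f v \<noteq> 0"
  shows "wreg (SR (Pow T)) (map (\<lambda>v. peval (f v) (excess E mvar v)) vs)"
proof -
  have TV: "T \<subseteq> V \<times> V" using E T by auto
  have finE: "finite E" using E finite_subset by fastforce
  \<comment> \<open>The new coordinates belong to the vertices other than \<open>s\<close>. The
    value at \<open>s\<close> is forced because the excesses of all vertices sum to zero.\<close>
  define Y :: "'v \<Rightarrow> ('v, 'k) mpoly" where
    "Y = (\<lambda>w. if w = s then - (\<Sum>u\<in>V - {s}. mvar u) else mvar w)"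
  define D where "D = (\<lambda>v. sum Y (descendants V T v))"
  \<comment> \<open>By the telescoping identity a tree edge has to go to the sum of the coordinates
    below it; edges outside \<open>T\<close> vanish on the quotient.\<close>
  define \<phi> where "\<phi> = psubst (\<lambda>e. if e \<in> T then D (snd e) else 0)"
  define \<psi> :: "('v, 'k) mpoly \<Rightarrow> ('v \<times> 'v, 'k) mpoly"
    where "\<psi> = psubst (excess E mvar)"
  let ?J = "SR (Pow T) :: ('v \<times> 'v, 'k) mpoly set"
  have J: "is_ideal ?J" by (rule SR_ideal) (auto simp: down_closed_def)
  have var_J: "mvar e \<in> ?J" if "e \<notin> T" for e
    using that by (auto simp: SR_def mvar_def)
  have sumY: "sum Y V = 0"
    using E by (simp add: sum.remove[of V s] Y_def)
  have \<phi>_excess: "\<phi> (excess E mvar v) = Y v" if "v \<in> V" for v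
  proof -
    have "\<phi> (excess E mvar v) = sum (\<lambda>e. if e \<in> T then D (snd e) else 0) (in_edges E v) -
        sum (\<lambda>e. if e \<in> T then D (snd e) else 0) (out_edges E v)"
      by (simp add: \<phi>_def excess_def psubst_diff psubst_sum psubst_mvar)
    also have "sum (\<lambda>e. if e \<in> T then D (snd e) else 0) (in_edges E v) =
        (\<Sum>e\<in>in_edges T v. D (snd e))"
      by (rule sum.mono_neutral_cong_right) (use finE T in \<open>auto simp: in_edges_def\<close>)
    also have "sum (\<lambda>e. if e \<in> T then D (snd e) else 0) (out_edges E v) =
        (\<Sum>e\<in>out_edges T v. D (snd e))"
      by (rule sum.mono_neutral_cong_right) (use finE T in \<open>auto simp: out_edges_def\<close>)
    also have "(\<Sum>e\<in>out_edges T v. D (snd e)) = (\<Sum>j\<in>T `` {v}. D j)"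
      by (rule sum.reindex_bij_witness[of _ "\<lambda>j. (v, j)" snd]) (auto simp: out_edges_def)
    also have "\<dots> = D v - Y v"
      using sum_descendants[OF T(2) E(1) TV that, of Y] by (simp add: D_def)
    \<comment> \<open>The root has no incoming edge, but there \<open>D v\<close> is the sum of
      \<open>Y\<close> over all of \<open>V\<close>, which is zero by the choice of
      \<open>Y s\<close>.\<close>
    also have "(\<Sum>e\<in>in_edges T v. D (snd e)) = D v"
    proof (cases "in_edges T v = {}")
      case True
      then show ?thesis
        using descendants_root[OF T(2) E(1) TV span that] sumY by (simp add: D_def)
    next
      case False
      then obtain i where "(i, v) \<in> T" by (auto simp: in_edges_def)
      then show ?thesis by (simp add: in_edges_child[OF T(2)])
    qed
    finally show ?thesis by simp
  qed
  let ?x = "mvar :: 'v \<times> 'v \<Rightarrow> ('v \<times> 'v, 'k) mpoly"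
  have excess_sum: "(\<Sum>v\<in>V. excess E mvar v) = (0 :: ('v \<times> 'v, 'k) mpoly)"
  proof -
    have "(\<Sum>v\<in>V. sum ?x (in_edges E v)) = sum ?x E"
      unfolding in_edges_def by (rule sum.group) (use E finE in auto)
    moreover have "(\<Sum>v\<in>V. sum ?x (out_edges E v)) = sum ?x E"
      unfolding out_edges_def by (rule sum.group) (use E finE in auto)
    ultimately show ?thesis by (simp add: excess_def sum_subtractf)
  qed
  have \<psi>_Y: "\<psi> (Y w) = excess E mvar w" for w
  proof (cases "w = s")
    case True
    have "(\<Sum>u\<in>V. excess E mvar u) = excess E mvar s + (\<Sum>u\<in>V - {s}. excess E mvar u :: ('v \<times> 'v, 'k) mpoly)"
      using E by (simp add: sum.remove)
    then have "excess E mvar s = - (\<Sum>u\<in>V - {s}. excess E mvar u :: ('v \<times> 'v, 'k) mpoly)"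
      using excess_sum by (simp add: eq_neg_iff_add_eq_0)
    then show ?thesis using True
      by (simp add: Y_def \<psi>_def psubst_uminus psubst_sum psubst_mvar)
  qed (simp add: Y_def \<psi>_def psubst_mvar)
  have excess_T: "excess E mvar w - excess T mvar w \<in> ?J" for w
  proof -
    have "in_edges T w \<subseteq> in_edges E w" "out_edges T w \<subseteq> out_edges E w"
      "finite (in_edges E w)" "finite (out_edges E w)"
      using finE T by (auto simp: in_edges_def out_edges_def)
    then have "sum ?x (in_edges E w) = sum ?x (in_edges E w - in_edges T w) + sum ?x (in_edges T w)"
      "sum ?x (out_edges E w) = sum ?x (out_edges E w - out_edges T w) + sum ?x (out_edges T w)"
      by - (rule sum.subset_diff, assumption, assumption)+
    then have "excess E ?x w - excess T ?x w =
        sum ?x (in_edges E w - in_edges T w) - sum ?x (out_edges E w - out_edges T w)"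
      unfolding excess_def by (simp only: add_diff_add add_diff_cancel_right')
    also have "\<dots> \<in> ?J"
      by (intro ri.subspace_diff ri.subspace_sum J)
        (auto intro!: var_J simp: in_edges_def out_edges_def)
    finally show ?thesis .
  qed
  have \<psi>\<phi>: "psubst (excess E mvar) (if e \<in> T then D (snd e) else 0) - mvar e \<in> ?J" for e
  proof (cases "e \<in> T")
    case True
    then obtain i v where e: "e = (i, v)" "(i, v) \<in> T" "v \<in> V" using TV by (cases e) auto
    have "?x e = sum (excess T ?x) (descendants V T v)"
      using sum_excess_descendants[OF T(2) E(1) TV e(3), of ?x] in_edges_child[OF T(2) e(2)] e
      by simp
    moreover have "\<psi> (D v) = sum (excess E ?x) (descendants V T v)"
      by (simp add: D_def \<psi>_def psubst_sum flip: \<psi>_Y)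
    moreover have "sum (excess E ?x) (descendants V T v) - sum (excess T ?x) (descendants V T v) \<in> ?J"
      unfolding sum_subtractf[symmetric] by (intro ri.subspace_sum J excess_T)
    ultimately show ?thesis using e True by (simp add: \<psi>_def)
  next
    case False
    then show ?thesis using ri.subspace_neg[OF J var_J] by (simp add: psubst_zero)
  qed
  have \<phi>_J: "\<phi> p = 0" if "p \<in> ?J" for p
  proof -
    have "mpow (\<lambda>e. if e \<in> T then D (snd e) else 0) m = 0" if m: "m \<in> keys p" for m
    proof -
      obtain e where "e \<in> keys m" "e \<notin> T"
        using m \<open>p \<in> ?J\<close> unfolding SR_def by blast
      then show ?thesis
        unfolding mpow_def by (intro prod_zero) (auto simp: in_keys_iff zero_power intro!: bexI[of _ e])
    qed
    then show ?thesis by (simp add: \<phi>_def psubst_def lin_def)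
  qed
  have \<phi>_map: "map \<phi> (map (\<lambda>v. peval (f v) (excess E mvar v)) vs) = map (\<lambda>v. peval (f v) (mvar v)) vs"
    using vs(1) by (auto simp: \<phi>_def psubst_peval) (auto simp: \<phi>_excess[unfolded \<phi>_def] Y_def subset_iff)
  show ?thesis
  proof (rule wreg_transfer[where \<phi> = \<phi> and \<psi> = \<psi> and K = "{0}"])
    show "wreg {0} (map \<phi> (map (\<lambda>v. peval (f v) (excess E mvar v)) vs))"
      unfolding \<phi>_map using wreg_univariate[of vs f "{}"] vs by simp
    show "\<psi> (\<phi> r) - r \<in> ?J" for r
      unfolding \<phi>_def \<psi>_def by (rule psubst_comp_cong[OF J \<psi>\<phi>])
    show "\<psi> k \<in> ?J" if "k \<in> {0}" for k
      using that J by (simp add: \<psi>_def psubst_zero ri.subspace_0)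
  qed (use J \<phi>_J in \<open>auto simp: \<phi>_def \<psi>_def psubst_add psubst_mult\<close>)
qed

section \<open>Localizations are commutative rings\<close>

locale localization_at = cring R for R (structure) +
  fixes S
  assumes S_sub: "S \<subseteq> carrier R" and one_S: "\<one> \<in> S"
    and mult_S: "\<And>s t. s \<in> S \<Longrightarrow> t \<in> S \<Longrightarrow> s \<otimes> t \<in> S"
begin

lemma S_carr [simp]: "s \<in> S \<Longrightarrow> s \<in> carrier R"
  using S_sub by blast

lemma loc_rel_iff:
  "((r, s), (r', s')) \<in> loc_rel R S \<longleftrightarrow>
    r \<in> carrier R \<and> s \<in> S \<and> r' \<in> carrier R \<and> s' \<in> S \<and>
    (\<exists>u\<in>S. u \<otimes> (r \<otimes> s') = u \<otimes> (r' \<otimes> s))"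
proof -
  have "u \<otimes> (a \<ominus> b) = \<zero> \<longleftrightarrow> u \<otimes> a = u \<otimes> b"
    if "u \<in> carrier R" "a \<in> carrier R" "b \<in> carrier R" for u a b
  proof -
    have "u \<otimes> (a \<ominus> b) = u \<otimes> a \<ominus> u \<otimes> b"
      using that by (simp add: a_minus_def r_distr r_minus)
    then show ?thesis using that by (simp add: r_right_minus_eq)
  qed
  then show ?thesis unfolding loc_rel_def by auto
qed

lemma equiv_loc_rel: "equiv (carrier R \<times> S) (loc_rel R S)"
proof (rule equivI)
  show "loc_rel R S \<subseteq> (carrier R \<times> S) \<times> (carrier R \<times> S)"
    unfolding loc_rel_def by auto
  show "refl_on (carrier R \<times> S) (loc_rel R S)"
    using one_S by (auto simp: refl_on_def loc_rel_iff)
  show "sym (loc_rel R S)"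
    by (auto simp: sym_def loc_rel_iff) metis
  show "trans (loc_rel R S)"
  proof (rule transI, clarify)
    fix a b c d e f
    assume "((a, b), (c, d)) \<in> loc_rel R S" "((c, d), (e, f)) \<in> loc_rel R S"
    then obtain u v where *: "a \<in> carrier R" "b \<in> S" "c \<in> carrier R" "d \<in> S" "e \<in> carrier R"
        "f \<in> S" "u \<in> S" "v \<in> S"
      and u: "u \<otimes> (a \<otimes> d) = u \<otimes> (c \<otimes> b)" and v: "v \<otimes> (c \<otimes> f) = v \<otimes> (e \<otimes> d)"
      by (auto simp: loc_rel_iff)
    \<comment> \<open>The middle denominator \<open>d\<close> joins the multiplier because it has to
      be cancelled.\<close>
    have "(u \<otimes> v \<otimes> d) \<otimes> (a \<otimes> f) = (v \<otimes> f) \<otimes> (u \<otimes> (a \<otimes> d))"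
      using * by (simp add: m_ac)
    also have "\<dots> = (u \<otimes> b) \<otimes> (v \<otimes> (c \<otimes> f))" unfolding u using * by (simp add: m_ac)
    also have "\<dots> = (u \<otimes> v \<otimes> d) \<otimes> (e \<otimes> b)" unfolding v using * by (simp add: m_ac)
    finally show "((a, b), (e, f)) \<in> loc_rel R S"
      using * mult_S by (auto simp: loc_rel_iff intro!: bexI[of _ "u \<otimes> v \<otimes> d"])
  qed
qed

abbreviation frac where "frac \<equiv> loc_frac R S"

abbreviation Q where "Q \<equiv> localization R S"

lemma frac_eq_iff:
  assumes "r \<in> carrier R" "s \<in> S" "r' \<in> carrier R" "s' \<in> S"
  shows "frac r s = frac r' s' \<longleftrightarrow> (\<exists>u\<in>S. u \<otimes> (r \<otimes> s') = u \<otimes> (r' \<otimes> s))"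
  unfolding loc_frac_def
  using eq_equiv_class_iff[OF equiv_loc_rel, of "(r, s)" "(r', s')"] assms
  by (auto simp: loc_rel_iff)

lemma mem_frac_iff:
  "p \<in> frac r s \<longleftrightarrow> ((r, s), p) \<in> loc_rel R S"
  by (simp add: loc_frac_def)

lemma frac_self: "r \<in> carrier R \<Longrightarrow> s \<in> S \<Longrightarrow> (r, s) \<in> frac r s"
  using one_S by (auto simp: mem_frac_iff loc_rel_iff)

lemma frac_carrier [simp]: "r \<in> carrier R \<Longrightarrow> s \<in> S \<Longrightarrow> frac r s \<in> carrier Q"
  by (auto simp: localization_def loc_frac_def intro!: quotientI)

lemma frac_cases:
  assumes "A \<in> carrier Q"
  obtains r s where "r \<in> carrier R" "s \<in> S" "A = frac r s"
  using assms by (auto simp: localization_def loc_frac_def elim!: quotientE)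

lemma frac_mult:
  assumes "a \<in> carrier R" "b \<in> S" "c \<in> carrier R" "d \<in> S"
  shows "frac a b \<otimes>\<^bsub>Q\<^esub> frac c d = frac (a \<otimes> c) (b \<otimes> d)"
proof -
  have "frac (fst p \<otimes> fst q) (snd p \<otimes> snd q) = frac (a \<otimes> c) (b \<otimes> d)"
    if pq_in: "p \<in> frac a b" "q \<in> frac c d" for p q
  proof -
    obtain a' b' c' d' where pq: "p = (a', b')" "q = (c', d')" by fastforce
    obtain u v where *: "a' \<in> carrier R" "b' \<in> S" "c' \<in> carrier R" "d' \<in> S" "u \<in> S" "v \<in> S"
      and u: "u \<otimes> (a \<otimes> b') = u \<otimes> (a' \<otimes> b)" and v: "v \<otimes> (c \<otimes> d') = v \<otimes> (c' \<otimes> d)"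
      using pq_in pq by (auto simp: mem_frac_iff loc_rel_iff)
    have "(u \<otimes> v) \<otimes> ((a' \<otimes> c') \<otimes> (b \<otimes> d)) = (u \<otimes> (a' \<otimes> b)) \<otimes> (v \<otimes> (c' \<otimes> d))"
      using * assms by (simp add: m_ac)
    also have "\<dots> = (u \<otimes> v) \<otimes> ((a \<otimes> c) \<otimes> (b' \<otimes> d'))"
      unfolding u[symmetric] v[symmetric] using * assms by (simp add: m_ac)
    finally show ?thesis
      using * assms pq mult_S by (auto simp: frac_eq_iff intro!: bexI[of _ "u \<otimes> v"])
  qed
  then show ?thesis
    using frac_self[of a b] frac_self[of c d] assms
    by (auto simp: localization_def)
qed

lemma frac_add:
  assumes "a \<in> carrier R" "b \<in> S" "c \<in> carrier R" "d \<in> S"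
  shows "frac a b \<oplus>\<^bsub>Q\<^esub> frac c d = frac ((a \<otimes> d) \<oplus> (c \<otimes> b)) (b \<otimes> d)"
proof -
  have "frac ((fst p \<otimes> snd q) \<oplus> (fst q \<otimes> snd p)) (snd p \<otimes> snd q) =
      frac ((a \<otimes> d) \<oplus> (c \<otimes> b)) (b \<otimes> d)"
    if pq_in: "p \<in> frac a b" "q \<in> frac c d" for p q
  proof -
    obtain a' b' c' d' where pq: "p = (a', b')" "q = (c', d')" by fastforce
    obtain u v where *: "a' \<in> carrier R" "b' \<in> S" "c' \<in> carrier R" "d' \<in> S" "u \<in> S" "v \<in> S"
      and u: "u \<otimes> (a \<otimes> b') = u \<otimes> (a' \<otimes> b)" and v: "v \<otimes> (c \<otimes> d') = v \<otimes> (c' \<otimes> d)"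
      using pq_in pq by (auto simp: mem_frac_iff loc_rel_iff)
    have "(u \<otimes> v) \<otimes> (((a' \<otimes> d') \<oplus> (c' \<otimes> b')) \<otimes> (b \<otimes> d)) =
        (u \<otimes> (a' \<otimes> b)) \<otimes> (v \<otimes> d \<otimes> d') \<oplus> (v \<otimes> (c' \<otimes> d)) \<otimes> (u \<otimes> b \<otimes> b')"
      using * assms by (simp add: m_ac r_distr l_distr)
    also have "\<dots> = (u \<otimes> v) \<otimes> (((a \<otimes> d) \<oplus> (c \<otimes> b)) \<otimes> (b' \<otimes> d'))"
      unfolding u[symmetric] v[symmetric] using * assms by (simp add: m_ac r_distr l_distr)
    finally show ?thesis
      using * assms pq mult_S by (auto simp: frac_eq_iff intro!: bexI[of _ "u \<otimes> v"])
  qed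
  then show ?thesis
    using frac_self[of a b] frac_self[of c d] assms
    by (auto simp: localization_def)
qed

lemma frac_one: "\<one>\<^bsub>Q\<^esub> = frac \<one> \<one>" and frac_zero: "\<zero>\<^bsub>Q\<^esub> = frac \<zero> \<one>"
  by (simp_all add: localization_def)

lemma frac_eqI:
  assumes "r \<in> carrier R" "s \<in> S" "r' \<in> carrier R" "s' \<in> S" "r \<otimes> s' = r' \<otimes> s"
  shows "frac r s = frac r' s'"
  using assms one_S by (auto simp: frac_eq_iff intro!: bexI[of _ \<one>])

lemma localization_cring: "cring Q"
proof (rule cringI)
  show "abelian_group Q"
  proof (rule abelian_groupI)
    fix x assume "x \<in> carrier Q"
    then obtain a b where x: "a \<in> carrier R" "b \<in> S" "x = frac a b" by (rule frac_cases)
    show "\<zero>\<^bsub>Q\<^esub> \<oplus>\<^bsub>Q\<^esub> x = x" using x one_S by (simp add: frac_zero frac_add)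
    show "\<exists>y\<in>carrier Q. y \<oplus>\<^bsub>Q\<^esub> x = \<zero>\<^bsub>Q\<^esub>"
    proof (rule bexI[of _ "frac (\<ominus> a) b"])
      have "\<ominus> a \<otimes> b \<oplus> a \<otimes> b = \<zero>" using x by (simp add: l_minus l_neg)
      then show "frac (\<ominus> a) b \<oplus>\<^bsub>Q\<^esub> x = \<zero>\<^bsub>Q\<^esub>"
        using x one_S mult_S by (simp add: frac_zero frac_add) (rule frac_eqI; simp)
    qed (use x in auto)
    fix y assume "y \<in> carrier Q"
    then obtain c d where y: "c \<in> carrier R" "d \<in> S" "y = frac c d" by (rule frac_cases)
    show "x \<oplus>\<^bsub>Q\<^esub> y \<in> carrier Q" using x y mult_S by (simp add: frac_add)
    show "x \<oplus>\<^bsub>Q\<^esub> y = y \<oplus>\<^bsub>Q\<^esub> x" using x y mult_S by (simp add: frac_add a_comm m_comm)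
    fix z assume "z \<in> carrier Q"
    then obtain e f where z: "e \<in> carrier R" "f \<in> S" "z = frac e f" by (rule frac_cases)
    show "x \<oplus>\<^bsub>Q\<^esub> y \<oplus>\<^bsub>Q\<^esub> z = x \<oplus>\<^bsub>Q\<^esub> (y \<oplus>\<^bsub>Q\<^esub> z)"
      using x y z mult_S by (simp add: frac_add m_ac a_ac l_distr r_distr)
  qed (use one_S in \<open>auto simp: frac_zero\<close>)
  show "comm_monoid Q"
  proof (rule comm_monoidI)
    fix x assume "x \<in> carrier Q"
    then obtain a b where x: "a \<in> carrier R" "b \<in> S" "x = frac a b" by (rule frac_cases)
    show "\<one>\<^bsub>Q\<^esub> \<otimes>\<^bsub>Q\<^esub> x = x" using x one_S by (simp add: frac_one frac_mult)
    fix y assume "y \<in> carrier Q"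
    then obtain c d where y: "c \<in> carrier R" "d \<in> S" "y = frac c d" by (rule frac_cases)
    show "x \<otimes>\<^bsub>Q\<^esub> y \<in> carrier Q" using x y mult_S by (simp add: frac_mult)
    show "x \<otimes>\<^bsub>Q\<^esub> y = y \<otimes>\<^bsub>Q\<^esub> x" using x y mult_S by (simp add: frac_mult m_comm)
    fix z assume "z \<in> carrier Q"
    then obtain e f where z: "e \<in> carrier R" "f \<in> S" "z = frac e f" by (rule frac_cases)
    show "x \<otimes>\<^bsub>Q\<^esub> y \<otimes>\<^bsub>Q\<^esub> z = x \<otimes>\<^bsub>Q\<^esub> (y \<otimes>\<^bsub>Q\<^esub> z)"
      using x y z mult_S by (simp add: frac_mult m_ac)
  qed (use one_S in \<open>auto simp: frac_one\<close>)
  fix x y z assume "x \<in> carrier Q" "y \<in> carrier Q" "z \<in> carrier Q"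
  then obtain a b c d e f where *: "a \<in> carrier R" "b \<in> S" "x = frac a b"
    "c \<in> carrier R" "d \<in> S" "y = frac c d" "e \<in> carrier R" "f \<in> S" "z = frac e f"
    by (metis frac_cases)
  have "(a \<otimes> d \<oplus> c \<otimes> b) \<otimes> e \<otimes> (b \<otimes> f \<otimes> (d \<otimes> f)) =
      (a \<otimes> e \<otimes> (d \<otimes> f) \<oplus> c \<otimes> e \<otimes> (b \<otimes> f)) \<otimes> (b \<otimes> d \<otimes> f)"
    using * by (simp add: m_ac l_distr r_distr)
  then show "(x \<oplus>\<^bsub>Q\<^esub> y) \<otimes>\<^bsub>Q\<^esub> z = x \<otimes>\<^bsub>Q\<^esub> z \<oplus>\<^bsub>Q\<^esub> y \<otimes>\<^bsub>Q\<^esub> z"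
    using * mult_S by (simp add: frac_add frac_mult) (rule frac_eqI; simp)
qed

end

section \<open>Depth and dimension\<close>

lemma (in noetherian_ring) exists_maximal_ideal_in:
  assumes "\<A> \<noteq> {}" "\<A> \<subseteq> {I. ideal I R}"
  shows "\<exists>I\<in>\<A>. \<forall>K\<in>\<A>. I \<subseteq> K \<longrightarrow> K = I"
proof (rule subset_Zorn_nonempty[OF assms(1)])
  fix C assume C: "C \<noteq> {}" "subset.chain \<A> C"
  then have "subset.chain {I. ideal I R} C" using assms(2) by (auto simp: subset.chain_def)
  then have "\<Union>C \<in> C" using C(1) by (rule ideal_chain_is_trivial[rotated])
  then show "\<Union>C \<in> \<A>" using C(2) by (auto simp: subset.chain_def)
qed

lemma (in ideal) adjoin_element:
  assumes "cring R" "a \<in> carrier R"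
  obtains K where "ideal K R" "I \<subseteq> K" "a \<in> K"
    "\<And>x. x \<in> K \<Longrightarrow> \<exists>q\<in>I. \<exists>r\<in>carrier R. x = q \<oplus> r \<otimes> a"
proof -
  interpret cring R by fact
  define K where "K = I <+>\<^bsub>R\<^esub> PIdl a"
  have ideal_K: "ideal K R"
    unfolding K_def using assms(2) by (intro add_ideals is_ideal cgenideal_ideal)
  have I_K: "q \<in> K" if "q \<in> I" for q
  proof -
    have "\<zero> \<in> PIdl a" using assms(2) by (auto simp: cgenideal_def intro!: exI[of _ \<zero>])
    moreover have "q = q \<oplus> \<zero>" using Icarr[OF that] by simp
    ultimately show ?thesis unfolding K_def set_add_def' using that by blast
  qed
  have a_K: "a \<in> K"
  proof -
    have "a = \<zero> \<oplus> a" using assms(2) by simp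
    moreover have "a \<in> PIdl a" using assms(2) by (rule cgenideal_self)
    moreover have "\<zero> \<in> I" by (rule additive_subgroup.zero_closed[OF is_additive_subgroup])
    ultimately show ?thesis unfolding K_def set_add_def' by blast
  qed
  have "\<exists>q\<in>I. \<exists>r\<in>carrier R. x = q \<oplus> r \<otimes> a" if "x \<in> K" for x
    using that unfolding K_def by (auto simp: set_add_def' cgenideal_def)
  then show thesis using I_K by (intro that[OF ideal_K _ a_K]) auto
qed

text \<open>An ideal maximal among those containing \<open>J\<close> and missing a multiplicative
  set is prime. The set generated by \<open>x\<close> and the complement of \<open>P\<close> misses
  \<open>J\<close>, because powers of \<open>x\<close> cancel modulo \<open>J\<close>. A prime
  missing it lies in \<open>P\<close> and omits \<open>x\<close>.\<close>

lemma prime_below: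
  fixes R (structure)
  assumes "cring R" "noetherian_ring R" "ideal J R" "x \<in> carrier R"
    and reg: "\<And>r. r \<in> carrier R \<Longrightarrow> x \<otimes> r \<in> J \<Longrightarrow> r \<in> J"
    and P: "primeideal P R" "J \<subseteq> P" "x \<in> P"
  obtains P' where "primeideal P' R" "J \<subseteq> P'" "P' \<subset> P"
proof -
  interpret cring R by fact
  interpret noetherian_ring R by fact
  interpret P: primeideal P R by fact
  define T where "T = {x [^] (i::nat) \<otimes> s | i s. s \<in> carrier R - P}"
  have T_mult: "a \<otimes> b \<in> T" if ab: "a \<in> T" "b \<in> T" for a b
  proof -
    obtain i s k t where *: "a = x [^] (i::nat) \<otimes> s" "b = x [^] (k::nat) \<otimes> t"
      "s \<in> carrier R - P" "t \<in> carrier R - P"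
      using ab unfolding T_def by blast
    then have "a \<otimes> b = x [^] (i + k) \<otimes> (s \<otimes> t)"
      using assms(4) by (simp add: m_ac flip: nat_pow_mult)
    moreover have "s \<otimes> t \<in> carrier R - P" using * P.I_prime by auto
    ultimately show ?thesis unfolding T_def by blast
  qed
  have powJ: "r \<in> J" if "r \<in> carrier R" "x [^] (i::nat) \<otimes> r \<in> J" for r i
    using that
  proof (induction i)
    case 0
    then show ?case by simp
  next
    case (Suc i)
    have "x \<otimes> (x [^] i \<otimes> r) = x [^] Suc i \<otimes> r"
      using assms(4) Suc.prems(1) by (simp add: m_ac)
    then have "x [^] i \<otimes> r \<in> J"
      using reg[of "x [^] i \<otimes> r"] Suc.prems assms(4) by simp
    then show ?case using Suc.IH Suc.prems(1) by blast
  qed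
  define \<A> where "\<A> = {I. ideal I R \<and> J \<subseteq> I \<and> I \<inter> T = {}}"
  have "J \<inter> T = {}"
  proof (rule ccontr)
    assume "J \<inter> T \<noteq> {}"
    then obtain i s where "s \<in> carrier R - P" "x [^] (i::nat) \<otimes> s \<in> J"
      unfolding T_def by blast
    then show False using powJ[of s i] P(2) by blast
  qed
  then have "J \<in> \<A>" "\<A> \<subseteq> {I. ideal I R}" using assms(3) by (auto simp: \<A>_def)
  then obtain P' where "P' \<in> \<A>" and max: "\<And>K. K \<in> \<A> \<Longrightarrow> P' \<subseteq> K \<Longrightarrow> K = P'"
    using exists_maximal_ideal_in[of \<A>] by blast
  then have P': "ideal P' R" "J \<subseteq> P'" "P' \<inter> T = {}" by (auto simp: \<A>_def)
  interpret P': ideal P' R by (rule P'(1))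
  have "\<one> \<notin> P" using P.I_notcarr P.one_imp_carrier by blast
  then have one: "\<one> \<in> carrier R - P" by simp
  have T_I: "x [^] (i::nat) \<otimes> s \<in> T" if "s \<in> carrier R - P" for i s
    unfolding T_def using that by blast
  have T1: "\<one> \<in> T" and Tx: "x \<in> T"
    using T_I[OF one, of 0] T_I[OF one, of 1] assms(4) by simp_all
  have TP: "s \<in> T" if "s \<in> carrier R - P" for s
    using T_I[OF that, of 0] that by simp
  have meets: "\<exists>q\<in>P'. \<exists>r\<in>carrier R. q \<oplus> r \<otimes> a \<in> T" if a: "a \<in> carrier R - P'" for a
  proof -
    have "a \<in> carrier R" using a by blast
    then obtain K where K: "ideal K R" "P' \<subseteq> K" "a \<in> K"
      "\<And>x. x \<in> K \<Longrightarrow> \<exists>q\<in>P'. \<exists>r\<in>carrier R. x = q \<oplus> r \<otimes> a"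
      using P'.adjoin_element[OF assms(1), of a] by metis
    then have "K \<notin> \<A>" using max[of K] a by blast
    then have "K \<inter> T \<noteq> {}" using K(1,2) P'(2) unfolding \<A>_def by blast
    then show ?thesis using K(4) by blast
  qed
  have "primeideal P' R"
  proof (rule primeidealI)
    show "ideal P' R" by (rule P'.is_ideal)
    show "cring R" by fact
    show "carrier R \<noteq> P'" using T1 P' by blast
    fix a b assume ab: "a \<in> carrier R" "b \<in> carrier R" "a \<otimes> b \<in> P'"
    show "a \<in> P' \<or> b \<in> P'"
    proof (rule ccontr)
      assume "\<not> ?thesis"
      then obtain q r q' r' where *: "q \<in> P'" "r \<in> carrier R" "q \<oplus> r \<otimes> a \<in> T"
        "q' \<in> P'" "r' \<in> carrier R" "q' \<oplus> r' \<otimes> b \<in> T"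
        using meets[of a] meets[of b] ab by blast
      have carr: "q \<in> carrier R" "q' \<in> carrier R" using * P'.Icarr by auto
      have "(q \<oplus> r \<otimes> a) \<otimes> (q' \<oplus> r' \<otimes> b) =
          q \<otimes> (q' \<oplus> r' \<otimes> b) \<oplus> ((r \<otimes> a) \<otimes> q' \<oplus> (r \<otimes> r') \<otimes> (a \<otimes> b))"
        using * ab carr by (simp add: l_distr r_distr m_ac a_ac)
      also have "\<dots> \<in> P'"
        using * ab carr P'.I_l_closed P'.I_r_closed P'.a_closed by (intro P'.a_closed) auto
      finally show False using T_mult * P' by blast
    qed
  qed
  moreover have "P' \<subseteq> P" using TP P' P'.Icarr by blast
  moreover have "x \<notin> P'" using Tx P' by blast
  ultimately show thesis using that P' P(3) by blast
qed

text \<open>The last element is regular modulo the ideal of the others, so one can step down from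
  \<open>P\<close> to a smaller prime still containing the others, and repeat. This is the
  inequality between depth and dimension.\<close>

lemma regular_sequence_prime_chain:
  fixes R (structure)
  assumes R: "cring R" "noetherian_ring R"
    and "set xs \<subseteq> carrier R"
    and "\<And>i r. i < length xs \<Longrightarrow> r \<in> carrier R \<Longrightarrow> xs ! i \<otimes> r \<in> Idl (set (take i xs)) \<Longrightarrow>
      r \<in> Idl (set (take i xs))"
    and "primeideal P R" "set xs \<subseteq> P"
  shows "\<exists>Q :: nat \<Rightarrow> 'a set. Q (length xs) = P \<and> (\<forall>i\<le>length xs. primeideal (Q i) R) \<and>
    (\<forall>i<length xs. Q i \<subset> Q (Suc i))"
  using assms(3-)
proof (induction xs arbitrary: P rule: rev_induct)
  case Nil
  then show ?case by auto
next
  case (snoc x xs)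
  interpret cring R by fact
  have P: "ideal P R" using snoc.prems(3) primeideal.axioms by blast
  obtain P' where P': "primeideal P' R" "Idl (set xs) \<subseteq> P'" "P' \<subset> P"
  proof (rule prime_below[OF R])
    show "ideal (Idl (set xs)) R" using snoc.prems(1) by (intro genideal_ideal) auto
    show "r \<in> Idl (set xs)" if "r \<in> carrier R" "x \<otimes> r \<in> Idl (set xs)" for r
      using snoc.prems(2)[of "length xs" r] that by simp
    show "Idl (set xs) \<subseteq> P" using snoc.prems(4) P by (intro genideal_minimal) auto
  qed (use snoc.prems in auto)
  have "set xs \<subseteq> P'" using P'(2) genideal_self[of "set xs"] snoc.prems(1) by auto
  then have "\<exists>Q :: nat \<Rightarrow> 'a set. Q (length xs) = P' \<and> (\<forall>i\<le>length xs. primeideal (Q i) R) \<and>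
      (\<forall>i<length xs. Q i \<subset> Q (Suc i))"
  proof (intro snoc.IH)
    show "r \<in> Idl (set (take i xs))"
      if "i < length xs" "r \<in> carrier R" "xs ! i \<otimes> r \<in> Idl (set (take i xs))" for i r
      using snoc.prems(2)[of i r] that by (simp add: nth_append)
  qed (use snoc.prems(1) P'(1) in auto)
  then obtain Q :: "nat \<Rightarrow> 'a set" where Q: "Q (length xs) = P'"
    "\<forall>i\<le>length xs. primeideal (Q i) R" "\<forall>i<length xs. Q i \<subset> Q (Suc i)" by blast
  show ?case
    using Q P' snoc.prems(3)
    by (intro exI[of _ "\<lambda>i. if i \<le> length xs then Q i else P"]) (auto simp: less_Suc_eq le_Suc_eq)
qed

lemma ideal_depth_le_krull_dim:
  fixes R (structure)
  assumes "cring R" "noetherian_ring R" "primeideal P R"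
  shows "ideal_depth R P \<le> krull_dim R"
  unfolding ideal_depth_def krull_dim_def
proof (rule Sup_mono, clarify)
  fix xs assume xs: "regular_sequence R xs" "set xs \<subseteq> P"
  have "\<exists>Q :: nat \<Rightarrow> 'a set. Q (length xs) = P \<and> (\<forall>i\<le>length xs. primeideal (Q i) R) \<and>
      (\<forall>i<length xs. Q i \<subset> Q (Suc i))"
    by (rule regular_sequence_prime_chain) (use assms xs in \<open>auto simp: regular_sequence_def\<close>)
  then show "\<exists>b\<in>{enat l |l. \<exists>P. (\<forall>i\<le>l. primeideal (P i) R) \<and> (\<forall>i<l. P i \<subset> P (Suc i))}.
      enat (length xs) \<le> b" by blast
qed

section \<open>Rings of fractions of quotients of type-class rings\<close>

definition is_prime :: "'a::comm_ring_1 set \<Rightarrow> bool"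
  where "is_prime P \<longleftrightarrow> is_ideal P \<and> 1 \<notin> P \<and> (\<forall>a b. a * b \<in> P \<longrightarrow> a \<in> P \<or> b \<in> P)"

text \<open>\<open>L\<close> is the ring of fractions of the quotient by \<open>J\<close> with denominators in \<open>S\<close>.\<close>

locale frac_hom = cring L for L (structure) +
  fixes h :: "'r::comm_ring_1 \<Rightarrow> 'a" and S J :: "'r set"
  assumes h_closed [simp]: "h r \<in> carrier L"
    and h_add: "h (r + r') = h r \<oplus> h r'"
    and h_mult: "h (r * r') = h r \<otimes> h r'"
    and h_one: "h 1 = \<one>"
    and one_S: "1 \<in> S"
    and mult_S: "s \<in> S \<Longrightarrow> t \<in> S \<Longrightarrow> s * t \<in> S"
    and h_unit: "s \<in> S \<Longrightarrow> h s \<in> Units L"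
    and h_surj: "l \<in> carrier L \<Longrightarrow> \<exists>r s. s \<in> S \<and> l \<otimes> h s = h r"
    and h_kernel: "h r = \<zero> \<longleftrightarrow> (\<exists>u\<in>S. u * r \<in> J)"
    and J_ideal: "is_ideal J"
begin

lemma h_zero: "h 0 = \<zero>"
  using h_kernel one_S J_ideal by (auto intro!: bexI[of _ 1] simp: ri.subspace_0)

lemma h_eq_iff: "h r = h r' \<longleftrightarrow> (\<exists>u\<in>S. u * (r - r') \<in> J)"
proof -
  have "h (r - r') \<oplus> h r' = h r" by (simp flip: h_add)
  then have "h r = h r' \<longleftrightarrow> h (r - r') = \<zero>"
    by (metis h_closed h_add add_0 h_zero l_zero add.r_cancel)
  then show ?thesis by (simp add: h_kernel)
qed

definition contr :: "'a set \<Rightarrow> 'r set" where "contr a = {r. h r \<in> a}"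

text \<open>Extension of an ideal, written with fractions: \<open>l\<close> is \<open>h r\<close>
  divided by \<open>h s\<close>.\<close>

definition extn :: "'r set \<Rightarrow> 'a set"
  where "extn K = {l \<in> carrier L. \<exists>r\<in>K. \<exists>s\<in>S. l \<otimes> h s = h r}"

lemma contr_ideal:
  assumes "ideal a L"
  shows "is_ideal (contr a)" "J \<subseteq> contr a"
proof -
  interpret a: ideal a L by fact
  show "is_ideal (contr a)"
    by (rule ri.subspaceI) (auto simp: contr_def h_zero h_add h_mult a.a_closed a.I_l_closed)
  have "h r = \<zero>" if "r \<in> J" for r using that one_S by (auto simp: h_kernel intro!: bexI[of _ 1])
  then show "J \<subseteq> contr a" by (auto simp: contr_def)
qed

lemma mem_ideal_iff:
  assumes "ideal a L" "l \<in> carrier L" "s \<in> S" "l \<otimes> h s = h r"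
  shows "l \<in> a \<longleftrightarrow> r \<in> contr a"
proof -
  interpret a: ideal a L by fact
  have "l = h r \<otimes> inv (h s)"
    using assms h_unit[OF assms(3)] by (simp add: m_assoc flip: assms(4))
  then show ?thesis
    using assms a.I_r_closed h_unit[OF assms(3)] unfolding contr_def
    by (metis Units_inv_closed h_closed mem_Collect_eq)
qed

lemma extn_contr:
  assumes "ideal a L"
  shows "extn (contr a) = a"
proof -
  interpret a: ideal a L by fact
  show ?thesis
  proof
    show "extn (contr a) \<subseteq> a"
      using mem_ideal_iff[OF assms] by (auto simp: extn_def)
    show "a \<subseteq> extn (contr a)"
    proof
      fix l assume l: "l \<in> a"
      obtain r s where "s \<in> S" "l \<otimes> h s = h r" using h_surj[OF a.Icarr[OF l]] by blast
      then show "l \<in> extn (contr a)"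
        using mem_ideal_iff[OF assms a.Icarr[OF l]] l a.Icarr[OF l] by (auto simp: extn_def)
    qed
  qed
qed

lemma extn_ideal:
  assumes K: "is_ideal K"
  shows "ideal (extn K) L"
proof (rule idealI)
  show "ring L" by (rule ring_axioms)
  have mult: "x \<otimes> l \<in> extn K" if l: "l \<in> extn K" and x: "x \<in> carrier L" for x l
  proof -
    obtain r s r' s' where *: "r \<in> K" "s \<in> S" "s' \<in> S" "l \<in> carrier L" "l \<otimes> h s = h r" "x \<otimes> h s' = h r'"
      using l h_surj[OF x] unfolding extn_def by blast
    have "(x \<otimes> l) \<otimes> h (s' * s) = (x \<otimes> h s') \<otimes> (l \<otimes> h s)"
      using *(4) x by (simp add: h_mult m_ac)
    also have "\<dots> = h (r' * r)" unfolding *(5,6) by (simp add: h_mult)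
    finally show ?thesis
      using * x mult_S ri.subspace_scale[OF K] unfolding extn_def by blast
  qed
  then show "x \<otimes> l \<in> extn K" "l \<otimes> x \<in> extn K" if "l \<in> extn K" "x \<in> carrier L" for x l
    using that m_comm[of l x] unfolding extn_def by auto
  have carr: "extn K \<subseteq> carrier L" by (auto simp: extn_def)
  show "subgroup (extn K) (add_monoid L)"
  proof (rule add.subgroupI)
    show "extn K \<subseteq> carrier L" by fact
    have "\<zero> \<otimes> h 1 = h 0" by (simp add: h_zero)
    then have "\<zero> \<in> extn K" using one_S ri.subspace_0[OF K] zero_closed unfolding extn_def by blast
    then show "extn K \<noteq> {}" by blast
    show "\<ominus> l \<in> extn K" if "l \<in> extn K" for l
      using mult[OF that, of "\<ominus> \<one>"] that carr by (auto simp: l_minus)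
    show "l \<oplus> l' \<in> extn K" if ll: "l \<in> extn K" "l' \<in> extn K" for l l'
    proof -
      obtain r s r' s' where *: "r \<in> K" "s \<in> S" "l \<in> carrier L" "l \<otimes> h s = h r"
        "r' \<in> K" "s' \<in> S" "l' \<in> carrier L" "l' \<otimes> h s' = h r'"
        using ll unfolding extn_def by blast
      have "(l \<oplus> l') \<otimes> h (s * s') = (l \<otimes> h s) \<otimes> h s' \<oplus> (l' \<otimes> h s') \<otimes> h s"
        using *(3,7) by (simp add: h_mult l_distr r_distr m_ac)
      also have "\<dots> = h (s' * r + s * r')" unfolding *(4,8) by (simp add: h_mult h_add m_comm)
      finally have "(l \<oplus> l') \<otimes> h (s * s') = h (s' * r + s * r')" .
      moreover have "s' * r + s * r' \<in> K" "s * s' \<in> S" "l \<oplus> l' \<in> carrier L"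
        using * mult_S ri.subspace_scale[OF K] ri.subspace_add[OF K] by auto
      ultimately show ?thesis unfolding extn_def by blast
    qed
  qed
qed

lemma h_mem_extn_iff:
  assumes K: "is_ideal K" "J \<subseteq> K"
  shows "h r \<in> extn K \<longleftrightarrow> (\<exists>u\<in>S. u * r \<in> K)"
proof
  assume "h r \<in> extn K"
  then obtain k s where *: "k \<in> K" "s \<in> S" "h r \<otimes> h s = h k" unfolding extn_def by blast
  then have "h (s * r) = h k" by (simp add: h_mult m_comm)
  then obtain u where u: "u \<in> S" "u * (s * r - k) \<in> K" using h_eq_iff K(2) by blast
  have "u * (s * r - k) + u * k \<in> K"
    using u * K(1) by (simp add: ri.subspace_add ri.subspace_scale)
  moreover have "u * (s * r - k) + u * k = (u * s) * r" by (simp add: algebra_simps)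
  ultimately show "\<exists>u\<in>S. u * r \<in> K" using mult_S[OF u(1) *(2)] by auto
next
  assume "\<exists>u\<in>S. u * r \<in> K"
  then obtain u where "u \<in> S" "u * r \<in> K" by blast
  moreover have "h r \<otimes> h u = h (u * r)" by (simp add: h_mult m_comm)
  ultimately show "h r \<in> extn K" unfolding extn_def by auto
qed

text \<open>Generation of ideals commutes with extension once \<open>J\<close> is adjoined, so
  finite generation and regularity in \<open>L\<close> can be read off from spans in the original
  ring.\<close>

lemma Idl_image: "Idl (h ` Y) = extn (ispan (J \<union> Y))"
proof
  have JY: "is_ideal (ispan (J \<union> Y))" by simp
  have sub: "J \<subseteq> ispan (J \<union> Y)" "Y \<subseteq> ispan (J \<union> Y)" using ri.span_superset by blast+
  have "h ` Y \<subseteq> extn (ispan (J \<union> Y))"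
  proof safe
    fix y assume "y \<in> Y"
    then have "1 * y \<in> ispan (J \<union> Y)" using sub(2) by auto
    then show "h y \<in> extn (ispan (J \<union> Y))" using h_mem_extn_iff[OF JY sub(1)] one_S by blast
  qed
  then show "Idl (h ` Y) \<subseteq> extn (ispan (J \<union> Y))"
    by (intro genideal_minimal extn_ideal) auto
  have id: "ideal (Idl (h ` Y)) L" by (rule genideal_ideal) auto
  have "h ` Y \<subseteq> Idl (h ` Y)" by (rule genideal_self) auto
  then have "J \<union> Y \<subseteq> contr (Idl (h ` Y))"
    using contr_ideal[OF id] by (auto simp: contr_def)
  then have "ispan (J \<union> Y) \<subseteq> contr (Idl (h ` Y))"
    using contr_ideal[OF id] by (intro ri.span_minimal) auto
  then show "extn (ispan (J \<union> Y)) \<subseteq> Idl (h ` Y)"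
    using extn_contr[OF id] unfolding extn_def by blast
qed

lemma noetherian:
  assumes "\<And>K. is_ideal K \<Longrightarrow> J \<subseteq> K \<Longrightarrow> \<exists>B. finite B \<and> K = ispan (J \<union> B)"
  shows "noetherian_ring L"
proof (rule noetherian_ringI)
  fix a assume a: "ideal a L"
  obtain B where B: "finite B" "contr a = ispan (J \<union> B)"
    using assms contr_ideal[OF a] by blast
  then have "a = Idl (h ` B)" using extn_contr[OF a] Idl_image by metis
  then show "\<exists>A\<subseteq>carrier L. finite A \<and> a = Idl A" using B(1) by (intro exI[of _ "h ` B"]) auto
qed

lemma contr_prime:
  assumes "primeideal P L"
  shows "is_prime (contr P)" "J \<subseteq> contr P"
proof -
  interpret P: primeideal P L by fact
  have id: "ideal P L" by (rule P.is_ideal)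
  show "J \<subseteq> contr P" using contr_ideal[OF id] by blast
  have "1 \<notin> contr P"
    using P.I_notcarr P.one_imp_carrier by (auto simp: contr_def h_one)
  then show "is_prime (contr P)"
    using contr_ideal[OF id] P.I_prime by (auto simp: is_prime_def contr_def h_mult)
qed

text \<open>Every ideal of \<open>L\<close> is the extension of its contraction, so contraction
  keeps strict inclusions strict and moves prime chains to primes above \<open>J\<close>.\<close>

lemma krull_dim_le:
  assumes "\<And>Q :: nat \<Rightarrow> 'r set. (\<And>i. i \<le> Suc d \<Longrightarrow> is_prime (Q i) \<and> J \<subseteq> Q i) \<Longrightarrow>
    (\<And>i. i \<le> d \<Longrightarrow> Q i \<subset> Q (Suc i)) \<Longrightarrow> False"
  shows "krull_dim L \<le> enat d"
  unfolding krull_dim_def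
proof (rule Sup_least, clarify)
  fix l and P :: "nat \<Rightarrow> 'a set"
  assume P: "\<forall>i\<le>l. primeideal (P i) L" "\<forall>i<l. P i \<subset> P (Suc i)"
  show "enat l \<le> enat d"
  proof (rule ccontr)
    assume "\<not> enat l \<le> enat d"
    then have l: "Suc d \<le> l" by simp
    show False
    proof (rule assms[of "\<lambda>i. contr (P i)"])
      show "is_prime (contr (P i)) \<and> J \<subseteq> contr (P i)" if "i \<le> Suc d" for i
        using contr_prime P(1) that l by simp
      show "contr (P i) \<subset> contr (P (Suc i))" if "i \<le> d" for i
      proof -
        have "P i \<subset> P (Suc i)" using P(2) that l by simp
        moreover have "extn (contr (P k)) = P k" if "k \<le> Suc d" for k
        proof -
          have "primeideal (P k) L" using P(1) that l by simp
          then show ?thesis by (intro extn_contr primeideal.axioms(1))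
        qed
        ultimately have "contr (P i) \<noteq> contr (P (Suc i))"
          using that by (metis Suc_le_mono le_SucI less_irrefl)
        then show ?thesis using \<open>P i \<subset> P (Suc i)\<close> by (auto simp: contr_def)
      qed
    qed
  qed
qed

text \<open>The length of \<open>fs\<close> bounds the depth from below and, by the assumption on
  chains, the dimension from above; since depth never exceeds dimension, all three agree.\<close>

lemma cohen_macaulay_local:
  assumes M: "is_prime M" "J \<subseteq> M" "S = - M"
    and noeth: "\<And>K. is_ideal K \<Longrightarrow> J \<subseteq> K \<Longrightarrow> \<exists>B. finite B \<and> K = ispan (J \<union> B)"
    and dim: "\<And>Q :: nat \<Rightarrow> 'r set. (\<And>i. i \<le> Suc (length fs) \<Longrightarrow> is_prime (Q i) \<and> J \<subseteq> Q i) \<Longrightarrow>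
      (\<And>i. i \<le> length fs \<Longrightarrow> Q i \<subset> Q (Suc i)) \<Longrightarrow> False"
    and fs: "wreg J fs" "set fs \<subseteq> M"
  shows "cohen_macaulay_local L"
proof -
  have M_ideal: "is_ideal M" using M(1) by (simp add: is_prime_def)
  let ?m = "extn M"
  have m: "ideal ?m L" by (rule extn_ideal) fact
  have h_m: "h r \<in> ?m \<longleftrightarrow> r \<in> M" for r
    using h_mem_extn_iff[OF M_ideal M(2), of r] M by (auto simp: is_prime_def ri.subspace_scale intro!: bexI[of _ 1])
  have proper: "?m \<noteq> carrier L"
    using h_m[of 1] M(1) by (auto simp: is_prime_def h_one)
  have in_m: "a \<subseteq> ?m" if a: "ideal a L" "a \<noteq> carrier L" for a
  proof
    interpret a: ideal a L by fact
    fix l assume l: "l \<in> a"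
    then obtain r s where rs: "s \<in> S" "l \<otimes> h s = h r" using h_surj a.Icarr by blast
    have "r \<in> M"
    proof (rule ccontr)
      assume "r \<notin> M"
      then have u: "h r \<in> Units L" using h_unit M(3) by auto
      have "h r \<in> a" using rs l a.I_r_closed by (metis h_closed)
      then have "inv (h r) \<otimes> h r \<in> a" using u by (intro a.I_l_closed) auto
      then have "\<one> \<in> a" using u by (simp add: Units_l_inv)
      then show False using a(2) a.one_imp_carrier by blast
    qed
    then show "l \<in> ?m" using rs l a.Icarr unfolding extn_def by blast
  qed
  have max: "maximalideal ?m L"
  proof (rule maximalidealI)
    show "J' = ?m \<or> J' = carrier L" if "ideal J' L" "?m \<subseteq> J'" for J'
      using in_m[OF that(1)] that(2) by blast
  qed (use m proper in auto)
  have unique: "m' = ?m" if "maximalideal m' L" for m'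
  proof -
    interpret m': maximalideal m' L by fact
    have "m' \<subseteq> ?m" using in_m[OF m'.is_ideal] m'.I_notcarr by blast
    then show ?thesis using m'.I_maximal[OF m] proper m unfolding extn_def by blast
  qed
  have noetherian: "noetherian_ring L" using noeth by (rule noetherian)
  have "regular_sequence L (map h fs)"
    unfolding regular_sequence_def
  proof (intro conjI allI impI ballI)
    have Idl_take: "Idl (set (take i (map h fs))) = extn (ispan (J \<union> set (take i fs)))" for i
      using Idl_image[of "set (take i fs)"] by (simp add: take_map)
    show "set (map h fs) \<subseteq> carrier L" by auto
    fix i l assume i: "i < length (map h fs)" and l: "l \<in> carrier L"
      and mem: "map h fs ! i \<otimes> l \<in> Idl (set (take i (map h fs)))"
    let ?K = "ispan (J \<union> set (take i fs))"
    have K: "is_ideal ?K" "J \<subseteq> ?K" using ri.span_superset[of "J \<union> set (take i fs)"] by auto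
    interpret K: ideal "extn ?K" L using extn_ideal[OF K(1)] .
    obtain r s where rs: "s \<in> S" "l \<otimes> h s = h r" using h_surj l by blast
    have "(h (fs ! i) \<otimes> l) \<otimes> h s \<in> extn ?K"
      using mem i K.I_r_closed unfolding Idl_take by simp
    moreover have "(h (fs ! i) \<otimes> l) \<otimes> h s = h (fs ! i * r)"
      using l rs by (simp add: m_assoc h_mult)
    ultimately obtain u where "u \<in> S" "u * (fs ! i * r) \<in> ?K"
      using h_mem_extn_iff[OF K] by auto
    \<comment> \<open>Regularity is applied to \<open>u * r\<close> instead of \<open>r\<close>: the
      multiplier \<open>u\<close> from \<open>S\<close> clears the denominators and becomes a unit
      in \<open>L\<close>.\<close>
    then have "u * r \<in> ?K"
      using wreg_nth[OF J_ideal fs(1), of i "u * r"] i by (simp add: mult.left_commute)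
    then have "h r \<in> extn ?K" using h_mem_extn_iff[OF K] \<open>u \<in> S\<close> by blast
    then show "l \<in> Idl (set (take i (map h fs)))"
      unfolding Idl_take using mem_ideal_iff[OF K.is_ideal l rs] by (simp add: contr_def)
  next
    have "Idl (set (map h fs)) \<subseteq> ?m"
      using fs(2) h_m by (intro genideal_minimal m) auto
    then show "Idl (set (map h fs)) \<noteq> carrier L"
      using proper unfolding extn_def by blast
  qed
  moreover have "set (map h fs) \<subseteq> ?m" using fs(2) h_m by auto
  ultimately have "enat (length fs) \<le> ideal_depth L ?m"
    unfolding ideal_depth_def by (intro Sup_upper) force
  moreover have "krull_dim L \<le> enat (length fs)" using dim by (rule krull_dim_le)
  moreover have "ideal_depth L ?m \<le> krull_dim L"
    using ideal_depth_le_krull_dim[OF cring_axioms noetherian] maximalideal_prime[OF max] by blast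
  ultimately have "ideal_depth L ?m = krull_dim L" by auto
  then show ?thesis
    unfolding cohen_macaulay_local_def using cring_axioms noetherian max unique by blast
qed

end

section \<open>Adjoining an element to a subring\<close>

text \<open>Subrings are subsets of one fixed ring, so variables can be adjoined one at a time
  without changing the type.\<close>

definition is_subring :: "'a::comm_ring_1 set \<Rightarrow> bool"
  where "is_subring E \<longleftrightarrow> 0 \<in> E \<and> 1 \<in> E \<and> (\<forall>x\<in>E. \<forall>y\<in>E. x + y \<in> E \<and> x * y \<in> E) \<and> (\<forall>x\<in>E. - x \<in> E)"

lemma is_subring_closed:
  assumes "is_subring E"
  shows "0 \<in> E" "1 \<in> E" "x \<in> E \<Longrightarrow> y \<in> E \<Longrightarrow> x + y \<in> E" "x \<in> E \<Longrightarrow> y \<in> E \<Longrightarrow> x * y \<in> E"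
    "x \<in> E \<Longrightarrow> - x \<in> E" "x \<in> E \<Longrightarrow> y \<in> E \<Longrightarrow> x - y \<in> E" "x \<in> E \<Longrightarrow> x ^ n \<in> E"
    "(\<And>i. i \<in> A \<Longrightarrow> f i \<in> E) \<Longrightarrow> sum f A \<in> E"
proof -
  show *: "0 \<in> E" "1 \<in> E" "x \<in> E \<Longrightarrow> y \<in> E \<Longrightarrow> x + y \<in> E" "x \<in> E \<Longrightarrow> y \<in> E \<Longrightarrow> x * y \<in> E"
    "x \<in> E \<Longrightarrow> - x \<in> E" for x y
    using assms by (auto simp: is_subring_def)
  show "x \<in> E \<Longrightarrow> y \<in> E \<Longrightarrow> x - y \<in> E" using *(3)[of x "- y"] *(5)[of y] by simp
  show "x \<in> E \<Longrightarrow> x ^ n \<in> E" by (induction n) (auto intro: *)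
  show "(\<And>i. i \<in> A \<Longrightarrow> f i \<in> E) \<Longrightarrow> sum f A \<in> E"
    by (induction A rule: infinite_finite_induct) (auto intro: *)
qed

definition polys_over :: "'a::comm_ring_1 set \<Rightarrow> 'a poly set"
  where "polys_over E = {P. \<forall>i. coeff P i \<in> E}"

lemma polys_overD: "P \<in> polys_over E \<Longrightarrow> coeff P i \<in> E"
  by (simp add: polys_over_def)

lemma polys_over_closed:
  assumes E: "is_subring E"
  shows "0 \<in> polys_over E" "1 \<in> polys_over E"
    "P \<in> polys_over E \<Longrightarrow> Q \<in> polys_over E \<Longrightarrow> P + Q \<in> polys_over E"
    "P \<in> polys_over E \<Longrightarrow> Q \<in> polys_over E \<Longrightarrow> P * Q \<in> polys_over E"
    "P \<in> polys_over E \<Longrightarrow> - P \<in> polys_over E"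
    "P \<in> polys_over E \<Longrightarrow> Q \<in> polys_over E \<Longrightarrow> P - Q \<in> polys_over E"
    "c \<in> E \<Longrightarrow> monom c i \<in> polys_over E"
    "c \<in> E \<Longrightarrow> P \<in> polys_over E \<Longrightarrow> pCons c P \<in> polys_over E"
    "c \<in> E \<Longrightarrow> P \<in> polys_over E \<Longrightarrow> smult c P \<in> polys_over E"
  using is_subring_closed(1-6)[OF E]
  by (auto simp: polys_over_def coeff_mult coeff_1 coeff_monom coeff_pCons
      intro!: is_subring_closed(8)[OF E] split: nat.splits)

definition adjoin :: "'a::comm_ring_1 set \<Rightarrow> 'a \<Rightarrow> 'a set"
  where "adjoin E v = (\<lambda>P. poly P v) ` polys_over E"

lemma adjoin_subring:
  assumes E: "is_subring E"
  shows "is_subring (adjoin E v)"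
proof -
  note c = polys_over_closed[OF E]
  have "0 \<in> adjoin E v" "1 \<in> adjoin E v"
    unfolding adjoin_def using c(1,2) by (metis image_eqI poly_0, metis image_eqI poly_1)
  moreover have "x + y \<in> adjoin E v" "x * y \<in> adjoin E v" if "x \<in> adjoin E v" "y \<in> adjoin E v" for x y
    using that c(3,4) unfolding adjoin_def by (auto simp flip: poly_add poly_mult)
  moreover have "- x \<in> adjoin E v" if "x \<in> adjoin E v" for x
    using that c(5) unfolding adjoin_def by (auto simp flip: poly_minus)
  ultimately show ?thesis by (simp add: is_subring_def)
qed

lemma subset_adjoin:
  assumes "is_subring E"
  shows "E \<subseteq> adjoin E v"
proof
  fix x assume "x \<in> E"
  then have "[:x:] \<in> polys_over E" using polys_over_closed[OF assms] by auto
  then show "x \<in> adjoin E v" unfolding adjoin_def by (force intro!: image_eqI[of _ _ "[:x:]"])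
qed

lemma adjoin_self:
  assumes "is_subring E"
  shows "v \<in> adjoin E v"
proof -
  have "[:0, 1:] \<in> polys_over E"
    using polys_over_closed[OF assms] is_subring_closed[OF assms] by auto
  then show ?thesis unfolding adjoin_def by (force intro!: image_eqI[of _ _ "[:0, 1:]"])
qed

section \<open>Hilbert's basis theorem\<close>

definition ideal_in :: "'a::comm_ring_1 set \<Rightarrow> 'a set \<Rightarrow> bool"
  where "ideal_in E J \<longleftrightarrow> J \<subseteq> E \<and> 0 \<in> J \<and> (\<forall>x\<in>J. \<forall>y\<in>J. x + y \<in> J) \<and> (\<forall>e\<in>E. \<forall>x\<in>J. e * x \<in> J)"

text \<open>The \<open>E\<close>-submodule generated by \<open>B\<close>; unlike in
  \<open>ispan\<close>, coefficients are confined to \<open>E\<close>.\<close>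

inductive_set gen_in :: "'a::comm_ring_1 set \<Rightarrow> 'a set \<Rightarrow> 'a set" for E B where
  zero: "0 \<in> gen_in E B"
| step: "e \<in> E \<Longrightarrow> b \<in> B \<Longrightarrow> x \<in> gen_in E B \<Longrightarrow> e * b + x \<in> gen_in E B"

definition noetherian_in :: "'a::comm_ring_1 set \<Rightarrow> bool"
  where "noetherian_in E \<longleftrightarrow> (\<forall>J. ideal_in E J \<longrightarrow> (\<exists>B\<subseteq>J. finite B \<and> J \<subseteq> gen_in E B))"

lemma gen_in_add: "x \<in> gen_in E B \<Longrightarrow> y \<in> gen_in E B \<Longrightarrow> x + y \<in> gen_in E B"
  by (induction rule: gen_in.induct) (auto simp: add.assoc intro: gen_in.step)

lemma gen_in_subset_ideal:
  assumes "ideal_in E J" "B \<subseteq> J" "x \<in> gen_in E B"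
  shows "x \<in> J"
  using assms(3) by induction (use assms in \<open>auto simp: ideal_in_def\<close>)

lemma gen_in_mono: "x \<in> gen_in E B \<Longrightarrow> B \<subseteq> B' \<Longrightarrow> x \<in> gen_in E B'"
  by (induction rule: gen_in.induct) (auto intro: gen_in.intros)

lemma gen_in_subset_ispan: "x \<in> gen_in E B \<Longrightarrow> x \<in> ispan B"
  by (induction rule: gen_in.induct) (auto intro: ri.span_add ri.span_scale ri.span_base ri.span_zero)

text \<open>The classical argument with leading coefficients. As \<open>v\<close> may satisfy
  relations over \<open>E\<close>, degrees and coefficients are taken from representing polynomials,
  not from elements of \<open>E[v]\<close>.\<close>

theorem hilbert_basis:
  assumes E: "is_subring E" and noeth: "noetherian_in E"
  shows "noetherian_in (adjoin E v)"
  unfolding noetherian_in_def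
proof (intro allI impI)
  fix J assume J: "ideal_in (adjoin E v) J"
  note c = polys_over_closed[OF E]
  \<comment> \<open>\<open>C j\<close> consists of the possible coefficients in degree
    \<open>j\<close>, zero included, of representatives of degree at most \<open>j\<close>. It grows
    with \<open>j\<close> because representatives can be multiplied by the indeterminate.\<close>
  define W where "W j = {P \<in> polys_over E. degree P \<le> j \<and> poly P v \<in> J}" for j
  define C where "C j = (\<lambda>P. coeff P j) ` W j" for j
  have W_add: "P + Q \<in> W j" if "P \<in> W j" "Q \<in> W j" for P Q j
    using that J c(3) by (auto simp: W_def ideal_in_def intro: degree_add_le)
  have W_smult: "smult e P \<in> W j" if "e \<in> E" "P \<in> W j" for e P j
  proof -
    have "e * poly P v \<in> J" using that J subset_adjoin[OF E, of v] by (auto simp: W_def ideal_in_def)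
    then show ?thesis using that c(9) by (auto simp: W_def intro: order_trans[OF degree_smult_le])
  qed
  have W_0: "0 \<in> W j" for j using J c(1) by (auto simp: W_def ideal_in_def)
  have W_shift: "pCons 0 P \<in> W (Suc j)" if "P \<in> W j" for P j
  proof -
    have "v * poly P v \<in> J" using that J adjoin_self[OF E, of v] by (auto simp: W_def ideal_in_def)
    then show ?thesis
      using that c(8) is_subring_closed(1)[OF E]
      by (auto simp: W_def intro: order_trans[OF degree_pCons_le])
  qed
  have C_ideal: "ideal_in E (C j)" for j
    unfolding ideal_in_def
  proof (intro conjI ballI)
    show "C j \<subseteq> E" by (auto simp: C_def W_def polys_over_def)
    show "0 \<in> C j" using W_0[of j] unfolding C_def by (metis coeff_0 image_eqI)
    show "x + y \<in> C j" if "x \<in> C j" "y \<in> C j" for x y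
      using that W_add unfolding C_def by (auto simp flip: coeff_add)
    show "e * x \<in> C j" if "e \<in> E" "x \<in> C j" for e x
      using that W_smult unfolding C_def by (auto simp flip: coeff_smult)
  qed
  have C_Suc: "C j \<subseteq> C (Suc j)" for j
    unfolding C_def using W_shift by (force intro: image_eqI[of _ _ "pCons 0 _"])
  have C_mono: "C i \<subseteq> C j" if "i \<le> j" for i j
    using C_Suc that by (rule lift_Suc_mono_le)
  have "ideal_in E (\<Union>j. C j)"
    unfolding ideal_in_def
  proof (intro conjI ballI)
    show "(\<Union>j. C j) \<subseteq> E" "0 \<in> (\<Union>j. C j)" using C_ideal unfolding ideal_in_def by blast+
    show "x + y \<in> (\<Union>j. C j)" if xy: "x \<in> (\<Union>j. C j)" "y \<in> (\<Union>j. C j)" for x y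
    proof -
      obtain i j where "x \<in> C i" "y \<in> C j" using xy by blast
      then have "x \<in> C (max i j)" "y \<in> C (max i j)" using C_mono by (meson max.cobounded1 max.cobounded2 subsetD)+
      then show ?thesis using C_ideal unfolding ideal_in_def by blast
    qed
    show "e * x \<in> (\<Union>j. C j)" if "e \<in> E" "x \<in> (\<Union>j. C j)" for e x
      using that C_ideal unfolding ideal_in_def by blast
  qed
  then obtain B where B: "B \<subseteq> (\<Union>j. C j)" "finite B" "(\<Union>j. C j) \<subseteq> gen_in E B"
    using noeth unfolding noetherian_in_def by blast
  have "\<exists>N. B \<subseteq> C N"
    using B(2,1)
  proof (induction B)
    case (insert b B)
    then obtain N j where "B \<subseteq> C N" "b \<in> C j" by auto
    then have "insert b B \<subseteq> C (max N j)" using C_mono by (meson insert_subset max.cobounded1 max.cobounded2 subsetD order_trans)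
    then show ?case by blast
  qed simp
  then obtain N where N: "B \<subseteq> C N" by blast
  have top: "C j \<subseteq> C N" for j
    using B(3) gen_in_subset_ideal[OF C_ideal N] by blast
  have "\<forall>j. \<exists>D. finite D \<and> D \<subseteq> W j \<and> C j \<subseteq> gen_in E ((\<lambda>P. coeff P j) ` D)"
  proof
    fix j
    obtain D' where "D' \<subseteq> C j" "finite D'" "C j \<subseteq> gen_in E D'"
      using noeth C_ideal[of j] unfolding noetherian_in_def by blast
    then show "\<exists>D. finite D \<and> D \<subseteq> W j \<and> C j \<subseteq> gen_in E ((\<lambda>P. coeff P j) ` D)"
      unfolding C_def using finite_subset_image[of D' "\<lambda>P. coeff P j" "W j"] by metis
  qed
  then obtain D where D: "\<And>j. finite (D j)" "\<And>j. D j \<subseteq> W j"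
    "\<And>j. C j \<subseteq> gen_in E ((\<lambda>P. coeff P j) ` D j)" by metis
  \<comment> \<open>Levels up to \<open>N\<close> suffice: every \<open>C j\<close> lies in
    \<open>C N\<close>, and higher levels are reached by multiplying by powers of
    \<open>v\<close>.\<close>
  define G where "G = (\<lambda>P. poly P v) ` (\<Union>j\<le>N. D j)"
  have combine: "\<exists>Q\<in>W j. coeff Q j = x \<and> poly Q v \<in> gen_in (adjoin E v) G"
    if "x \<in> gen_in E ((\<lambda>P. coeff P j) ` D j)" "j \<le> N" for x j
    using that(1)
  proof induction
    case zero
    then show ?case using W_0 gen_in.zero by (intro bexI[of _ 0]) auto
  next
    case (step e b x)
    then obtain P Q where P: "P \<in> D j" "b = coeff P j"
      and Q: "Q \<in> W j" "coeff Q j = x" "poly Q v \<in> gen_in (adjoin E v) G" by blast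
    have "e * poly P v + poly Q v \<in> gen_in (adjoin E v) G"
    proof (rule gen_in.step)
      show "e \<in> adjoin E v" using subset_adjoin[OF E] step(1) by blast
      show "poly P v \<in> G" unfolding G_def using P(1) that(2) by blast
    qed fact
    moreover have "smult e P + Q \<in> W j" using W_add W_smult step(1) P(1) Q(1) D(2) by blast
    ultimately show ?case using P Q by (intro bexI[of _ "smult e P + Q"]) auto
  qed
  have lead: "\<exists>Q\<in>W j. coeff Q j = x \<and> poly Q v \<in> gen_in (adjoin E v) G"
    if x: "x \<in> C j" for x j
  proof (cases "j \<le> N")
    case True
    then show ?thesis using combine D(3) x by blast
  next
    case False
    then obtain k where k: "j = k + N" by (metis add.commute le_Suc_ex nat_le_linear)
    have "x \<in> C N" using top x by blast
    then obtain Q where Q: "Q \<in> W N" "coeff Q N = x" "poly Q v \<in> gen_in (adjoin E v) G"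
      using combine[of x N] D(3) by blast
    have "\<exists>Q\<in>W (k + N). coeff Q (k + N) = x \<and> poly Q v \<in> gen_in (adjoin E v) G" for k
    proof (induction k)
      case 0
      then show ?case using Q by auto
    next
      case (Suc k)
      then obtain Q where Q: "Q \<in> W (k + N)" "coeff Q (k + N) = x"
        "poly Q v \<in> gen_in (adjoin E v) G" by blast
      have "v * y \<in> gen_in (adjoin E v) G" if "y \<in> gen_in (adjoin E v) G" for y
        using that
      proof induction
        case (step e b x)
        have "(v * e) * b + v * x \<in> gen_in (adjoin E v) G"
          using step adjoin_self[OF E, of v] is_subring_closed(4)[OF adjoin_subring[OF E]]
          by (intro gen_in.step) auto
        then show ?case by (simp add: distrib_left mult.assoc)
      qed (simp add: gen_in.zero)
      then show ?case using Q W_shift by (intro bexI[of _ "pCons 0 Q"]) auto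
    qed
    then show ?thesis using k by blast
  qed
  \<comment> \<open>Subtract a generated element with the same coefficient in degree
    \<open>j\<close> and descend on the degree bound.\<close>
  have "poly P v \<in> gen_in (adjoin E v) G" if "P \<in> W j" for P j
    using that
  proof (induction j arbitrary: P)
    case 0
    obtain Q where Q: "Q \<in> W 0" "coeff Q 0 = coeff P 0"
      "poly Q v \<in> gen_in (adjoin E v) G"
      using lead[of "coeff P 0" 0] 0 unfolding C_def by blast
    have "P = Q" using 0 Q by (auto simp: W_def elim!: degree_eq_zeroE)
    then show ?case using Q by simp
  next
    case (Suc j)
    obtain Q where Q: "Q \<in> W (Suc j)" "coeff Q (Suc j) = coeff P (Suc j)"
      "poly Q v \<in> gen_in (adjoin E v) G"
      using lead[of "coeff P (Suc j)" "Suc j"] Suc.prems unfolding C_def by blast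
    have "P - Q \<in> W (Suc j)"
      using W_add[OF Suc.prems W_smult[OF is_subring_closed(5)[OF E is_subring_closed(2)[OF E]] Q(1)]] by simp
    moreover have "degree (P - Q) \<le> j"
      using Q Suc.prems by (intro degree_le) (auto simp: W_def less_eq_Suc_le coeff_eq_0 dest!: le_imp_less_or_eq)
    ultimately have "P - Q \<in> W j" by (auto simp: W_def)
    then have "poly (P - Q) v \<in> gen_in (adjoin E v) G" by (rule Suc.IH)
    from gen_in_add[OF this Q(3)] show ?case by simp
  qed
  moreover have "\<exists>j. \<exists>P\<in>W j. x = poly P v" if "x \<in> J" for x
    using that J unfolding ideal_in_def adjoin_def W_def by blast
  ultimately have "J \<subseteq> gen_in (adjoin E v) G" by blast
  moreover have "G \<subseteq> J" using D(2) by (auto simp: G_def W_def)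
  moreover have "finite G" using D(1) by (simp add: G_def)
  ultimately show "\<exists>B\<subseteq>J. finite B \<and> J \<subseteq> gen_in (adjoin E v) B" by blast
qed

section \<open>A form of the Nullstellensatz\<close>

locale prime_mod =
  fixes p :: "'r::comm_ring_1 set"
  assumes is_prime: "is_prime p"
begin

lemma p_ideal: "is_ideal p"
  using is_prime by (simp add: is_prime_def)

lemma one_notin: "1 \<notin> p"
  using is_prime by (simp add: is_prime_def)

lemma mult_mem_iff: "a * b \<in> p \<longleftrightarrow> a \<in> p \<or> b \<in> p"
  using is_prime p_ideal is_ideal_mult ri.subspace_scale by (auto simp: is_prime_def)

lemma power_mem: "a ^ n \<in> p \<Longrightarrow> a \<in> p"
  by (induction n) (auto simp: one_notin mult_mem_iff)

definition eqv :: "'r \<Rightarrow> 'r \<Rightarrow> bool" (infix \<open>\<asymp>\<close> 50) where "a \<asymp> b \<longleftrightarrow> a - b \<in> p"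

lemma eqv_refl [simp]: "a \<asymp> a"
  using p_ideal by (simp add: eqv_def ri.subspace_0)

lemma eqv_sym: "a \<asymp> b \<Longrightarrow> b \<asymp> a"
  using ri.subspace_neg[OF p_ideal, of "a - b"] by (simp add: eqv_def)

lemma eqv_trans [trans]: "a \<asymp> b \<Longrightarrow> b \<asymp> c \<Longrightarrow> a \<asymp> c"
  using ri.subspace_add[OF p_ideal, of "a - b" "b - c"] by (simp add: eqv_def)

lemma eqv_add: "a \<asymp> b \<Longrightarrow> c \<asymp> d \<Longrightarrow> a + c \<asymp> b + d"
  using ri.subspace_add[OF p_ideal, of "a - b" "c - d"] by (simp add: eqv_def add_diff_add)

lemma eqv_mult: "a \<asymp> b \<Longrightarrow> c \<asymp> d \<Longrightarrow> a * c \<asymp> b * d"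
proof -
  assume "a \<asymp> b" "c \<asymp> d"
  then have "c * (a - b) + b * (c - d) \<in> p"
    using p_ideal by (simp add: eqv_def ri.subspace_add ri.subspace_scale)
  then show ?thesis by (simp add: eqv_def algebra_simps)
qed

lemma eqv_minus: "a \<asymp> b \<Longrightarrow> - a \<asymp> - b"
  using eqv_mult[of "-1" "-1" a b] by simp

lemma eqv_diff: "a \<asymp> b \<Longrightarrow> c \<asymp> d \<Longrightarrow> a - c \<asymp> b - d"
  using eqv_add[of a b "- c" "- d"] eqv_minus[of c d] by simp

lemma eqv_power: "a \<asymp> b \<Longrightarrow> a ^ n \<asymp> b ^ n"
  by (induction n) (auto intro: eqv_mult)

lemma eqv_zero_iff: "a \<asymp> 0 \<longleftrightarrow> a \<in> p"
  by (simp add: eqv_def)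

lemma eqv_mem_iff: "a \<asymp> b \<Longrightarrow> a \<in> p \<longleftrightarrow> b \<in> p"
  using eqv_trans eqv_sym by (metis eqv_zero_iff)

definition null :: "'r poly \<Rightarrow> bool" where "null P \<longleftrightarrow> (\<forall>i. coeff P i \<in> p)"

lemma null_poly: "null P \<Longrightarrow> poly P v \<in> p"
  using p_ideal by (auto simp: null_def poly_altdef intro!: ri.subspace_sum is_ideal_mult)

lemma null_mult:
  assumes "null P"
  shows "null (P * Q)"
  using assms p_ideal by (auto simp: null_def coeff_mult intro!: ri.subspace_sum is_ideal_mult)

lemma top_index:
  assumes "\<not> null P"
  obtains i where "i \<le> degree P" "coeff P i \<notin> p" "\<And>j. i < j \<Longrightarrow> coeff P j \<in> p"
proof -
  let ?A = "{i. coeff P i \<notin> p}"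
  have deg: "i \<le> degree P" if "i \<in> ?A" for i
    using that p_ideal by (auto simp: ri.subspace_0 intro!: le_degree)
  then have fin: "finite ?A" by (auto intro: finite_subset[of _ "{..degree P}"])
  have "?A \<noteq> {}" using assms by (auto simp: null_def)
  then have in_A: "Max ?A \<in> ?A" using Max_in[OF fin] by blast
  show thesis
  proof (rule that[of "Max ?A"])
    show "coeff P j \<in> p" if "Max ?A < j" for j
      using Max_ge[OF fin, of j] that by force
  qed (use in_A deg in auto)
qed

text \<open>The degree is not invariant modulo \<open>p\<close>. Cutting off the coefficients above
  the last one outside \<open>p\<close> produces a representative whose formal degree bound is the
  true degree modulo \<open>p\<close>.\<close>

lemma trim:
  assumes E: "is_subring E" and P: "P \<in> polys_over E" "\<not> null P"
  obtains i P' where "i \<le> degree P" "P' \<in> polys_over E" "degree P' \<le> i"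
    "coeff P' i \<notin> p" "\<And>v. poly P v \<asymp> poly P' v"
proof -
  obtain i where i: "i \<le> degree P" "coeff P i \<notin> p"
    "\<And>j. i < j \<Longrightarrow> coeff P j \<in> p"
    using top_index[OF P(2)] by blast
  let ?P = "poly_cutoff (Suc i) P"
  have "null (P - ?P)"
    using i(3) p_ideal by (auto simp: null_def coeff_poly_cutoff ri.subspace_0)
  then have "poly P v \<asymp> poly ?P v" for v using null_poly by (force simp: eqv_def)
  moreover have "?P \<in> polys_over E"
    using P(1) is_subring_closed(1)[OF E] by (auto simp: polys_over_def coeff_poly_cutoff)
  moreover have "degree ?P \<le> i" by (rule degree_le) (simp add: coeff_poly_cutoff)
  ultimately show thesis using that[of i ?P] i by (simp add: coeff_poly_cutoff)
qed

lemma top_coeff_mult: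
  assumes "\<And>a. i < a \<Longrightarrow> coeff P a \<in> p" "\<And>a. j < a \<Longrightarrow> coeff Q a \<in> p"
  shows "coeff (P * Q) (i + j) \<asymp> coeff P i * coeff Q j"
proof -
  have "coeff P a * coeff Q (i + j - a) \<in> p" if "a \<le> i + j" "a \<noteq> i" for a
    using assms(1)[of a] assms(2)[of "i + j - a"] that by (cases "a < i") (auto simp: mult_mem_iff)
  then have "(\<Sum>a\<in>{..i + j} - {i}. coeff P a * coeff Q (i + j - a)) \<in> p"
    by (intro ri.subspace_sum p_ideal) auto
  then show ?thesis by (simp add: eqv_def coeff_mult sum.remove[of _ i])
qed

text \<open>Some element \<open>s\<close> lies in every nonzero prime ideal of the image of \<open>E\<close> modulo \<open>p\<close>, that is,
  inverting \<open>s\<close> turns the image into a field.\<close>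

definition goldman :: "'r set \<Rightarrow> bool"
  where "goldman E \<longleftrightarrow> (\<exists>s\<in>E - p. \<forall>f\<in>E - p. \<exists>g\<in>E. \<exists>N. f * g \<asymp> s ^ N)"

definition field_mod :: "'r set \<Rightarrow> bool"
  where "field_mod E \<longleftrightarrow> (\<forall>f\<in>E - p. \<exists>g\<in>E. f * g \<asymp> 1)"

definition algebraic_mod :: "'r set \<Rightarrow> 'r \<Rightarrow> bool"
  where "algebraic_mod E v \<longleftrightarrow>
    (\<exists>H e. H \<in> polys_over E \<and> degree H \<le> e \<and> coeff H e \<notin> p \<and> poly H v \<in> p)"

lemma minus_one_power_mod:
  assumes E: "is_subring E" "f \<in> E"
  shows "\<exists>h\<in>E. (f - 1) ^ N = (- 1) ^ N + f * h"
proof (induction N)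
  case 0
  then show ?case using is_subring_closed[OF E(1)] by (intro bexI[of _ 0]) auto
next
  case (Suc N)
  then obtain h where h: "h \<in> E" "(f - 1) ^ N = (- 1) ^ N + f * h" by blast
  have "(f - 1) ^ Suc N = (- 1) ^ Suc N + f * ((- 1) ^ N + (f - 1) * h)"
    by (simp add: h(2) algebra_simps)
  moreover have "(- 1) ^ N + (f - 1) * h \<in> E"
    using is_subring_closed[OF E(1)] E(2) h(1) by metis
  ultimately show ?case by blast
qed

text \<open>If \<open>v\<close> were transcendental, then \<open>1 + v * s\<close> would be a nonconstant unit.\<close>

lemma goldman_algebraic:
  assumes E: "is_subring E" and G: "goldman (adjoin E v)"
  shows "algebraic_mod E v"
proof (rule ccontr)
  assume not: "\<not> algebraic_mod E v"
  note Ev = adjoin_subring[OF E, of v]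
  note c = is_subring_closed[OF Ev]
  have trans: "null P" if P: "P \<in> polys_over E" "poly P v \<in> p" for P
  proof (rule ccontr)
    assume "\<not> null P"
    then obtain i P' where "P' \<in> polys_over E" "degree P' \<le> i" "coeff P' i \<notin> p"
      "poly P v \<asymp> poly P' v"
      using trim[OF E P(1)] by metis
    then show False using not P(2) eqv_mem_iff unfolding algebraic_mod_def by blast
  qed
  obtain s where s: "s \<in> adjoin E v" "s \<notin> p"
    and inv: "\<And>f. f \<in> adjoin E v - p \<Longrightarrow> \<exists>g\<in>adjoin E v. \<exists>N. f * g \<asymp> s ^ N"
    using G unfolding goldman_def by blast
  obtain S where S: "S \<in> polys_over E" "s = poly S v" using s(1) unfolding adjoin_def by blast
  have "\<not> null S" using null_poly s(2) S(2) by blast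
  then obtain i where i: "coeff S i \<notin> p" "\<And>j. i < j \<Longrightarrow> coeff S j \<in> p"
    using top_index by blast
  define P where "P = 1 + pCons 0 S"
  have P_over: "P \<in> polys_over E"
    using polys_over_closed[OF E] S(1) is_subring_closed[OF E] by (simp add: P_def)
  have P_Suc: "coeff P (Suc j) = coeff S j" for j
    by (simp add: P_def coeff_1)
  define f where "f = 1 + v * s"
  have fP: "f = poly P v" by (simp add: f_def P_def S(2))
  have f_in: "f \<in> adjoin E v" using P_over fP unfolding adjoin_def by blast
  have "\<not> null P" using i(1) P_Suc unfolding null_def by metis
  then have "f \<notin> p" using trans[OF P_over] fP by blast
  then obtain g N where g: "g \<in> adjoin E v" "f * g \<asymp> s ^ N" using inv f_in by blast
  obtain h where h: "h \<in> adjoin E v" "(f - 1) ^ N = (- 1) ^ N + f * h"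
    using minus_one_power_mod[OF Ev f_in] by blast
  \<comment> \<open>As \<open>v * s = f - 1\<close>, multiplying \<open>f * g \<asymp> s ^ N\<close>
    by \<open>v ^ N\<close> gives a power of \<open>f - 1\<close>, which is a sign plus a multiple
    of \<open>f\<close>. Solving for the sign shows that \<open>k\<close> inverts
    \<open>f\<close>.\<close>
  define k where "k = (- 1) ^ N * (v ^ N * g - h)"
  have "v ^ N * (f * g) \<asymp> v ^ N * s ^ N" using g(2) by (intro eqv_mult) auto
  also have "v ^ N * s ^ N = (- 1) ^ N + f * h"
    using h(2) by (simp add: f_def power_mult_distrib)
  finally have "v ^ N * (f * g) - f * h \<asymp> ((- 1) ^ N + f * h) - f * h"
    by (intro eqv_diff) auto
  then have "(- 1) ^ N * (v ^ N * (f * g) - f * h) \<asymp> (- 1) ^ N * (- 1) ^ N"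
    by (intro eqv_mult) auto
  moreover have "(- 1) ^ N * (v ^ N * (f * g) - f * h) = f * k"
    by (simp add: k_def algebra_simps)
  ultimately have fk: "f * k \<asymp> 1" by (simp flip: power_mult_distrib)
  have "k \<in> adjoin E v"
    unfolding k_def
    by (intro c(4) c(6) c(7) c(5)[OF c(2)] g(1) h(1) adjoin_self[OF E])
  then obtain K where K: "K \<in> polys_over E" "k = poly K v" unfolding adjoin_def by blast
  have "\<not> null K"
  proof
    assume "null K"
    then have "f * k \<in> p" using null_poly K(2) mult_mem_iff by blast
    then show False using eqv_mem_iff[OF fk] one_notin by blast
  qed
  then obtain j where j: "coeff K j \<notin> p" "\<And>l. j < l \<Longrightarrow> coeff K l \<in> p"
    using top_index by blast
  \<comment> \<open>For transcendental \<open>v\<close> an identity of values is one of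
    coefficients. But in the positive degree \<open>Suc i + j\<close> the product has the top
    coefficient \<open>coeff S i * coeff K j\<close>, which is not in \<open>p\<close>.\<close>
  have "null (P * K - 1)"
  proof (rule trans)
    show "P * K - 1 \<in> polys_over E" using polys_over_closed[OF E] P_over K(1) by simp
    show "poly (P * K - 1) v \<in> p" using fk by (simp add: eqv_def fP K(2))
  qed
  then have "coeff (P * K - 1) (Suc i + j) \<in> p" unfolding null_def by blast
  then have "coeff (P * K) (Suc i + j) \<in> p" by (simp add: coeff_1)
  moreover have "coeff (P * K) (Suc i + j) \<asymp> coeff P (Suc i) * coeff K j"
  proof (rule top_coeff_mult)
    show "coeff P a \<in> p" if "Suc i < a" for a
      using that i(2) P_Suc by (cases a) auto
  qed (rule j(2))
  ultimately have "coeff S i * coeff K j \<in> p"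
    using eqv_mem_iff P_Suc by metis
  then show False using i(1) j(1) mult_mem_iff by blast
qed

text \<open>Multiplying by powers of the top coefficient replaces division over a field of
  fractions. The bound on the degree of \<open>Q\<close> is what later allows the minimality of a
  relation for \<open>v\<close> to be applied to a quotient.\<close>

lemma pseudo_division:
  assumes E: "is_subring E" and B: "B \<in> polys_over E" "degree B \<le> j" "1 \<le> j"
    and A: "A \<in> polys_over E"
  shows "\<exists>M Q R. Q \<in> polys_over E \<and> R \<in> polys_over E \<and> degree R < j \<and>
    degree Q \<le> degree A - j \<and> smult (coeff B j ^ M) A = Q * B + R"
  using A
proof (induction "degree A" arbitrary: A rule: less_induct)
  case less
  note c = polys_over_closed[OF E]
  let ?b = "coeff B j"
  have b: "?b \<in> E" using B(1) by (rule polys_overD)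
  show ?case
  proof (cases "degree A < j")
    case True
    then show ?thesis using less.prems c(1) by (intro exI[of _ 0] exI[of _ A] exI[of _ "0::nat"]) auto
  next
    case False
    let ?n = "degree A"
    define T where "T = monom (coeff A ?n) (?n - j)"
    define A' where "A' = smult ?b A - T * B"
    have T: "T \<in> polys_over E" "degree T \<le> ?n - j"
      using c(7) polys_overD[OF less.prems] by (auto simp: T_def degree_monom_le)
    have A': "A' \<in> polys_over E" unfolding A'_def using c less.prems T B b by simp
    have deg_TB: "degree (T * B) \<le> ?n"
      using degree_mult_le[of T B] T(2) B(2) False by linarith
    have "coeff (T * B) ?n = coeff A ?n * ?b"
      using False by (simp add: T_def coeff_monom_mult)
    then have "coeff A' ?n = 0" by (simp add: A'_def mult.commute)
    moreover have "degree A' \<le> ?n"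
      unfolding A'_def using deg_TB degree_smult_le by (intro degree_diff_le)
    ultimately have deg: "degree A' < ?n"
      using False B(3) by (metis degree_0 leD leI le_neq_implies_less leading_coeff_0_iff le_zero_eq not_one_le_zero)
    obtain M Q R where *: "Q \<in> polys_over E" "R \<in> polys_over E" "degree R < j"
      "degree Q \<le> degree A' - j" "smult (?b ^ M) A' = Q * B + R"
      using less.hyps[OF deg A'] by blast
    have "smult (?b ^ Suc M) A = smult (?b ^ M) A' + smult (?b ^ M) (T * B)"
      by (simp add: A'_def smult_diff_right mult.commute)
    also have "\<dots> = (Q + smult (?b ^ M) T) * B + R"
      by (simp add: *(5) algebra_simps)
    finally have "smult (?b ^ Suc M) A = (Q + smult (?b ^ M) T) * B + R" .
    moreover have "Q + smult (?b ^ M) T \<in> polys_over E"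
      using c * T(1) is_subring_closed(7)[OF E b] by simp
    moreover have "degree (Q + smult (?b ^ M) T) \<le> ?n - j"
      using *(4) deg T(2) degree_smult_le[of "?b ^ M" T] by (intro degree_add_le) linarith+
    ultimately show ?thesis using * by blast
  qed
qed

lemma algebraic_minimal:
  assumes E: "is_subring E" and alg: "algebraic_mod E v"
  obtains H e where "H \<in> polys_over E" "degree H \<le> e" "coeff H e \<notin> p"
    "poly H v \<in> p" "1 \<le> e"
    "\<And>U. U \<in> polys_over E \<Longrightarrow> degree U < e \<Longrightarrow> poly U v \<in> p \<Longrightarrow> null U"
proof -
  define Pr where "Pr e \<longleftrightarrow> (\<exists>H. H \<in> polys_over E \<and> degree H \<le> e \<and>
    coeff H e \<notin> p \<and> poly H v \<in> p)" for e
  define e where "e = (LEAST e. Pr e)"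
  have "\<exists>e. Pr e" using alg unfolding algebraic_mod_def Pr_def by blast
  then have "Pr e" unfolding e_def by (rule LeastI_ex)
  then obtain H where H: "H \<in> polys_over E" "degree H \<le> e" "coeff H e \<notin> p" "poly H v \<in> p"
    unfolding Pr_def by blast
  have "e \<noteq> 0"
  proof
    assume "e = 0"
    then have "poly H v = coeff H e" using H(2) by (auto elim!: degree_eq_zeroE)
    then show False using H by simp
  qed
  moreover have "null U" if U: "U \<in> polys_over E" "degree U < e" "poly U v \<in> p" for U
  proof (rule ccontr)
    assume "\<not> null U"
    then obtain i U' where "i \<le> degree U" "U' \<in> polys_over E" "degree U' \<le> i"
      "coeff U' i \<notin> p" "poly U v \<asymp> poly U' v"
      using trim[OF E U(1)] by metis
    then have "Pr i" "i < e" using U eqv_mem_iff unfolding Pr_def by auto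
    then show False unfolding e_def using not_less_Least by blast
  qed
  ultimately show thesis using that[of H e] H by simp
qed

text \<open>Among polynomials over \<open>E\<close> whose value at \<open>v\<close> is a multiple of
  \<open>s\<close>, one of least degree modulo \<open>p\<close> is sought; it must be constant. This
  is Euclid's algorithm for \<open>s\<close> and the minimal relation \<open>H\<close>, carried out
  without fractions.\<close>

lemma algebraic_multiple:
  assumes E: "is_subring E" and alg: "algebraic_mod E v" and s: "s \<in> adjoin E v" "s \<notin> p"
  shows "\<exists>a\<in>E - p. \<exists>t\<in>adjoin E v. a \<asymp> s * t"
proof -
  note Ev = is_subring_closed[OF adjoin_subring[OF E, of v]]
  note c = is_subring_closed[OF E]
  have in_Ev: "poly P v \<in> adjoin E v" if "P \<in> polys_over E" for P
    using that unfolding adjoin_def by blast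
  have const_Ev: "x \<in> adjoin E v" if "x \<in> E" for x using that subset_adjoin[OF E] by blast
  obtain H e where H: "H \<in> polys_over E" "degree H \<le> e" "coeff H e \<notin> p"
    "poly H v \<in> p" "1 \<le> e"
    and min: "\<And>U. U \<in> polys_over E \<Longrightarrow> degree U < e \<Longrightarrow> poly U v \<in> p \<Longrightarrow> null U"
    using algebraic_minimal[OF E alg] by metis
  define Pr where "Pr j \<longleftrightarrow> (\<exists>U\<in>polys_over E. degree U \<le> j \<and> coeff U j \<notin> p \<and>
    (\<exists>t\<in>adjoin E v. poly U v \<asymp> s * t))" for j
  have Pr_trim: "\<exists>i\<le>degree U. Pr i"
    if U: "U \<in> polys_over E" "\<not> null U" "t \<in> adjoin E v" "poly U v \<asymp> s * t" for U t
  proof -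
    obtain i U' where "i \<le> degree U" "U' \<in> polys_over E" "degree U' \<le> i"
      "coeff U' i \<notin> p" "poly U v \<asymp> poly U' v"
      using trim[OF E U(1,2)] by metis
    then show ?thesis using U(3,4) eqv_trans eqv_sym unfolding Pr_def by blast
  qed
  obtain S where S: "S \<in> polys_over E" "s = poly S v" using s(1) unfolding adjoin_def by blast
  obtain M Q R where R: "Q \<in> polys_over E" "R \<in> polys_over E" "degree R < e"
    "smult (coeff H e ^ M) S = Q * H + R"
    using pseudo_division[OF E H(1,2,5) S(1)] by blast
  let ?h = "coeff H e ^ M"
  have hs: "?h * s = poly Q v * poly H v + poly R v"
    using arg_cong[OF R(4), of "\<lambda>P. poly P v"] by (simp add: S(2))
  have Rs: "poly R v \<asymp> s * ?h"
    using hs H(4) mult_mem_iff[of "poly Q v" "poly H v"] ri.subspace_neg[OF p_ideal, of "poly Q v * poly H v"]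
    by (simp add: eqv_def mult.commute[of s])
  have "?h \<notin> p" using H(3) power_mem by blast
  then have "poly R v \<notin> p" using eqv_mem_iff[OF Rs] s(2) mult_mem_iff by blast
  then have "\<not> null R" using null_poly by blast
  moreover have "?h \<in> adjoin E v" by (intro const_Ev c(7) polys_overD[OF H(1)])
  ultimately obtain i where i: "i < e" "Pr i" using Pr_trim[OF R(2) _ _ Rs] R(3) by (meson le_less_trans)
  define j where "j = (LEAST j. Pr j)"
  have "Pr j" "j < e" "\<And>l. Pr l \<Longrightarrow> j \<le> l"
    using i LeastI[of Pr i] Least_le[of Pr] unfolding j_def by (auto intro: le_less_trans)
  then obtain U t where U: "U \<in> polys_over E" "degree U \<le> j" "coeff U j \<notin> p"
    "t \<in> adjoin E v" "poly U v \<asymp> s * t"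
    unfolding Pr_def by blast
  show ?thesis
  proof (cases "j = 0")
    case True
    then have "poly U v = coeff U j" using U(2) by (auto elim!: degree_eq_zeroE)
    then show ?thesis using U polys_overD[OF U(1), of j] by auto
  next
    case False
    then have "1 \<le> j" by simp
    then obtain M Q W where W: "Q \<in> polys_over E" "W \<in> polys_over E" "degree W < j"
      "degree Q \<le> degree H - j" "smult (coeff U j ^ M) H = Q * U + W"
      using pseudo_division[OF E U(1,2) _ H(1)] by blast
    let ?u = "coeff U j ^ M"
    have eq: "?u * poly H v = poly Q v * poly U v + poly W v"
      using arg_cong[OF W(5), of "\<lambda>P. poly P v"] by simp
    have "poly W v = ?u * poly H v - poly Q v * poly U v" using eq by simp
    also have "\<dots> \<asymp> 0 - poly Q v * (s * t)"
      using H(4) U(5) by (intro eqv_diff eqv_mult) (auto simp: eqv_zero_iff mult_mem_iff)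
    also have "\<dots> = s * (- (poly Q v * t))" by (simp add: mult.left_commute)
    finally have Ws: "poly W v \<asymp> s * (- (poly Q v * t))" .
    \<comment> \<open>The remainder again takes a multiple of \<open>s\<close> as value, in smaller
      degree than the minimal \<open>j\<close>.\<close>
    have nW: "null W"
    proof (rule ccontr)
      assume "\<not> null W"
      moreover have "- (poly Q v * t) \<in> adjoin E v" using Ev(4,5) in_Ev[OF W(1)] U(4) by blast
      ultimately obtain l where "l \<le> degree W" "Pr l" using Pr_trim[OF W(2) _ _ Ws] by blast
      then show False using \<open>\<And>l. Pr l \<Longrightarrow> j \<le> l\<close>[of l] W(3) by simp
    qed
    have "poly Q v * poly U v \<in> p"
    proof -
      have "poly Q v * poly U v = ?u * poly H v - poly W v" using eq by simp
      then show ?thesis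
        using H(4) null_poly[OF nW] mult_mem_iff ri.subspace_diff[OF p_ideal] by metis
    qed
    moreover have "poly U v \<notin> p"
      using min[OF U(1)] U(2,3) \<open>j < e\<close> unfolding null_def by (meson le_less_trans)
    ultimately have "poly Q v \<in> p" using mult_mem_iff by blast
    moreover have "degree Q < e" using W(4) H(2,5) \<open>1 \<le> j\<close> by linarith
    ultimately have "null Q" using min[OF W(1)] by blast
    \<comment> \<open>With both \<open>Q\<close> and \<open>W\<close> null, the pseudo-division puts
      the coefficient of \<open>H\<close> at \<open>e\<close>, up to a power of the one of
      \<open>U\<close>, into \<open>p\<close>.\<close>
    then have "null (Q * U)" by (rule null_mult)
    then have "coeff (Q * U) e + coeff W e \<in> p"
      using nW ri.subspace_add[OF p_ideal] unfolding null_def by blast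
    also have "coeff (Q * U) e + coeff W e = ?u * coeff H e"
      using arg_cong[OF W(5), of "\<lambda>P. coeff P e"] by simp
    finally have "?u \<in> p" using H(3) mult_mem_iff by blast
    then show ?thesis using power_mem U(3) by blast
  qed
qed

text \<open>The new witness is the product of the top coefficient of the minimal relation, which
  makes reduction to degree below \<open>e\<close> possible, and a multiple of the old witness that
  lies in \<open>E\<close>.\<close>

lemma goldman_descends:
  assumes E: "is_subring E" and G: "goldman (adjoin E v)"
  shows "goldman E"
proof -
  note c = is_subring_closed[OF E]
  have alg: "algebraic_mod E v" by (rule goldman_algebraic) fact+
  obtain H e where H: "H \<in> polys_over E" "degree H \<le> e" "coeff H e \<notin> p"
    "poly H v \<in> p" "1 \<le> e"
    and min: "\<And>U. U \<in> polys_over E \<Longrightarrow> degree U < e \<Longrightarrow> poly U v \<in> p \<Longrightarrow> null U"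
    using algebraic_minimal[OF E alg] by metis
  let ?h = "coeff H e"
  have h: "?h \<in> E" using H(1) by (rule polys_overD)
  obtain s where s: "s \<in> adjoin E v" "s \<notin> p"
    and inv: "\<And>f. f \<in> adjoin E v - p \<Longrightarrow> \<exists>g\<in>adjoin E v. \<exists>N. f * g \<asymp> s ^ N"
    using G unfolding goldman_def by blast
  obtain a t where a: "a \<in> E - p" "t \<in> adjoin E v" "a \<asymp> s * t"
    using algebraic_multiple[OF E alg s] by blast
  have "\<exists>g\<in>E. \<exists>N. f * g \<asymp> (?h * a) ^ N" if f: "f \<in> E - p" for f
  proof -
    obtain g N where g: "g \<in> adjoin E v" "f * g \<asymp> s ^ N"
      using inv[of f] f subset_adjoin[OF E] by blast
    have "g * t ^ N \<in> adjoin E v"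
      using g(1) a(2) by (intro is_subring_closed(4,7)[OF adjoin_subring[OF E]])
    then obtain Y where Y: "Y \<in> polys_over E" "g * t ^ N = poly Y v" unfolding adjoin_def by blast
    have "f * (g * t ^ N) \<asymp> s ^ N * t ^ N"
      using eqv_mult[OF g(2), of "t ^ N" "t ^ N"] by (simp add: mult.assoc)
    also have "s ^ N * t ^ N = (s * t) ^ N" by (simp add: power_mult_distrib)
    also have "\<dots> \<asymp> a ^ N" by (intro eqv_power eqv_sym[OF a(3)])
    finally have fY: "f * poly Y v \<asymp> a ^ N" by (simp add: Y(2))
    obtain M Q R where R: "Q \<in> polys_over E" "R \<in> polys_over E" "degree R < e"
      "smult (?h ^ M) Y = Q * H + R"
      using pseudo_division[OF E H(1,2,5) Y(1)] by blast
    have "?h ^ M * poly Y v = poly Q v * poly H v + poly R v"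
      using arg_cong[OF R(4), of "\<lambda>P. poly P v"] by simp
    then have "poly R v = ?h ^ M * poly Y v - poly Q v * poly H v" by simp
    also have "\<dots> \<asymp> ?h ^ M * poly Y v - 0"
      using H(4) by (intro eqv_diff) (auto simp: eqv_zero_iff mult_mem_iff)
    finally have "f * poly R v \<asymp> f * (?h ^ M * poly Y v)" by (intro eqv_mult) auto
    also have "f * (?h ^ M * poly Y v) = ?h ^ M * (f * poly Y v)" by (simp add: mult_ac)
    also have "\<dots> \<asymp> ?h ^ M * a ^ N" using fY by (intro eqv_mult) auto
    \<comment> \<open>This relation for \<open>v\<close> has degree below \<open>e\<close>, so it is
      null and its constant coefficients can be compared.\<close>
    finally have "poly (smult f R - [:?h ^ M * a ^ N:]) v \<in> p" by (simp add: eqv_def)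
    moreover have "smult f R - [:?h ^ M * a ^ N:] \<in> polys_over E"
      using polys_over_closed[OF E] R(2) f a(1) h c by auto
    moreover have "degree (smult f R - [:?h ^ M * a ^ N:]) < e"
      using R(3) H(5) by (intro degree_diff_less le_less_trans[OF degree_smult_le]) auto
    ultimately have "null (smult f R - [:?h ^ M * a ^ N:])" using min by blast
    then have "f * coeff R 0 \<asymp> ?h ^ M * a ^ N"
      unfolding null_def eqv_def by (auto dest!: spec[of _ 0])
    \<comment> \<open>The extra factor evens out the exponents so that a power of the single witness
      \<open>?h * a\<close> appears.\<close>
    then have "f * coeff R 0 * (?h ^ N * a ^ M) \<asymp> ?h ^ M * a ^ N * (?h ^ N * a ^ M)"
      by (rule eqv_mult) (rule eqv_refl)
    moreover have "?h ^ M * a ^ N * (?h ^ N * a ^ M) = (?h * a) ^ (M + N)"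
      by (simp add: power_add power_mult_distrib mult_ac)
    ultimately have "f * (coeff R 0 * (?h ^ N * a ^ M)) \<asymp> (?h * a) ^ (M + N)"
      by (simp add: mult.assoc)
    moreover have "coeff R 0 * (?h ^ N * a ^ M) \<in> E"
      using c(4,7) h a(1) polys_overD[OF R(2)] by auto
    ultimately show ?thesis by blast
  qed
  moreover have "?h * a \<in> E - p" using h a(1) H(3) c(4) mult_mem_iff by blast
  ultimately show ?thesis unfolding goldman_def by blast
qed

text \<open>A nonzero element divides a nonzero element of \<open>E\<close>, and the latter is
  invertible.\<close>

lemma field_mod_adjoin:
  assumes E: "is_subring E" "field_mod E" and alg: "algebraic_mod E v"
  shows "field_mod (adjoin E v)"
  unfolding field_mod_def
proof
  fix f assume "f \<in> adjoin E v - p"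
  then obtain a t where a: "a \<in> E - p" "t \<in> adjoin E v" "a \<asymp> f * t"
    using algebraic_multiple[OF E(1) alg] by blast
  obtain g where g: "g \<in> E" "a * g \<asymp> 1" using E(2) a(1) unfolding field_mod_def by blast
  have "a * g \<asymp> f * t * g" using a(3) by (intro eqv_mult) auto
  then have "f * t * g \<asymp> 1" using eqv_trans[OF eqv_sym] g(2) by blast
  then have "f * (t * g) \<asymp> 1" by (simp only: mult.assoc)
  moreover have "t * g \<in> adjoin E v"
    using a(2) g(1) subset_adjoin[OF E(1), of v] is_subring_closed(4)[OF adjoin_subring[OF E(1)]] by blast
  ultimately show "\<exists>g\<in>adjoin E v. f * g \<asymp> 1" by blast
qed

section \<open>Finite spanning sets modulo a prime\<close>

definition spanned_mod :: "'r set \<Rightarrow> 'r set \<Rightarrow> bool"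
  where "spanned_mod K E \<longleftrightarrow> (\<exists>B. finite B \<and> (\<forall>x\<in>E. \<exists>y\<in>gen_in K B. x \<asymp> y))"

lemma gen_in_mult: "y \<in> gen_in K B \<Longrightarrow> y * w \<in> gen_in K ((\<lambda>b. b * w) ` B)"
  by (induction rule: gen_in.induct) (auto simp: distrib_right mult.assoc intro: gen_in.intros)

text \<open>The top coefficient of a relation of degree \<open>e\<close> is invertible modulo
  \<open>p\<close>, so the powers of \<open>v\<close> below \<open>e\<close> span over
  \<open>E\<close>; their products with a spanning set of \<open>E\<close> span over
  \<open>K\<close>.\<close>

lemma spanned_mod_adjoin:
  assumes E: "is_subring E" "field_mod E" "spanned_mod K E" and alg: "algebraic_mod E v"
  shows "spanned_mod K (adjoin E v)"
proof -
  note c = is_subring_closed[OF E(1)]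
  obtain B where B: "finite B" "\<And>x. x \<in> E \<Longrightarrow> \<exists>y\<in>gen_in K B. x \<asymp> y"
    using E(3) unfolding spanned_mod_def by blast
  obtain H e where H: "H \<in> polys_over E" "degree H \<le> e" "coeff H e \<notin> p"
    "poly H v \<in> p" "1 \<le> e"
    using algebraic_minimal[OF E(1) alg] by metis
  let ?h = "coeff H e"
  have h: "?h \<in> E" using H(1) by (rule polys_overD)
  obtain u where u: "u \<in> E" "?h * u \<asymp> 1" using E(2) h H(3) unfolding field_mod_def by blast
  define B' where "B' = (\<Union>i<e. (\<lambda>b. b * v ^ i) ` B)"
  have "\<exists>y\<in>gen_in K B'. x \<asymp> y" if x_in: "x \<in> adjoin E v" for x
  proof -
    obtain Y where Y: "Y \<in> polys_over E" "poly Y v = x" using x_in unfolding adjoin_def by blast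
    obtain M Q R where R: "Q \<in> polys_over E" "R \<in> polys_over E" "degree R < e"
      "smult (?h ^ M) Y = Q * H + R"
      using pseudo_division[OF E(1) H(1,2,5) Y(1)] by blast
    have "?h ^ M * x = poly Q v * poly H v + poly R v"
      using arg_cong[OF R(4), of "\<lambda>P. poly P v"] Y(2) by simp
    also have "\<dots> \<asymp> 0 + poly R v"
      using H(4) by (intro eqv_add) (auto simp: eqv_zero_iff mult_mem_iff)
    finally have hx: "?h ^ M * x \<asymp> poly R v" by simp
    have "u ^ M * (?h ^ M * x) = (?h * u) ^ M * x" by (simp add: power_mult_distrib mult_ac)
    also have "\<dots> \<asymp> 1 ^ M * x" using u(2) by (intro eqv_mult eqv_power) auto
    finally have "u ^ M * (?h ^ M * x) \<asymp> x" by simp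
    then have "x \<asymp> u ^ M * (?h ^ M * x)" by (rule eqv_sym)
    also have "\<dots> \<asymp> u ^ M * poly R v" using hx by (intro eqv_mult) auto
    also have "u ^ M * poly R v = (\<Sum>i\<le>degree R. (u ^ M * coeff R i) * v ^ i)"
      by (simp add: poly_altdef sum_distrib_left mult.assoc)
    finally have x: "x \<asymp> (\<Sum>i\<le>degree R. (u ^ M * coeff R i) * v ^ i)" .
    have "\<exists>y\<in>gen_in K B'. (\<Sum>i\<in>A. (u ^ M * coeff R i) * v ^ i) \<asymp> y"
      if "finite A" "A \<subseteq> {..<e}" for A
      using that
    proof (induction A)
      case empty
      then show ?case using gen_in.zero by (intro bexI[of _ 0]) auto
    next
      case (insert i A)
      obtain y where y: "y \<in> gen_in K B'" "(\<Sum>i\<in>A. (u ^ M * coeff R i) * v ^ i) \<asymp> y"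
        using insert by auto
      obtain z where z: "z \<in> gen_in K B" "u ^ M * coeff R i \<asymp> z"
        using B(2)[of "u ^ M * coeff R i"] c(4,7) u(1) polys_overD[OF R(2)] by blast
      have "z * v ^ i \<in> gen_in K ((\<lambda>b. b * v ^ i) ` B)" by (rule gen_in_mult) fact
      then have "z * v ^ i \<in> gen_in K B'"
        by (rule gen_in_mono) (use insert.prems in \<open>auto simp: B'_def\<close>)
      then have "z * v ^ i + y \<in> gen_in K B'" using y(1) by (rule gen_in_add)
      moreover have "(\<Sum>i\<in>insert i A. (u ^ M * coeff R i) * v ^ i) \<asymp> z * v ^ i + y"
        unfolding sum.insert[OF insert.hyps] by (intro eqv_add eqv_mult y(2) z(2) eqv_refl)
      ultimately show ?case by blast
    qed
    moreover have "{..degree R} \<subseteq> {..<e}" using R(3) by auto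
    ultimately obtain y where "y \<in> gen_in K B'"
      "(\<Sum>i\<le>degree R. (u ^ M * coeff R i) * v ^ i) \<asymp> y"
      by (metis finite_atMost)
    then show ?thesis using x eqv_trans by blast
  qed
  moreover have "finite B'" using B(1) by (simp add: B'_def)
  ultimately show ?thesis unfolding spanned_mod_def by blast
qed

lemma adjoin_list_subring: "is_subring K \<Longrightarrow> is_subring (foldl adjoin K vs)"
  by (induction vs rule: rev_induct) (auto intro: adjoin_subring)

text \<open>Goldman's property descends from the top ring through all intermediate rings, which
  makes every adjoined element algebraic over the previous ring. With this, invertibility and finite
  spanning ascend from \<open>K\<close>.\<close>

theorem nullstellensatz:
  assumes K: "is_subring K" "field_mod K" and G: "goldman (foldl adjoin K vs)"
  shows "spanned_mod K (foldl adjoin K vs)"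
proof -
  have "field_mod (foldl adjoin K vs) \<and> spanned_mod K (foldl adjoin K vs)" using G
  proof (induction vs rule: rev_induct)
    case Nil
    have "x \<in> gen_in K {1}" if "x \<in> K" for x
      using gen_in.step[OF that _ gen_in.zero, of 1 "{1}"] by simp
    then have "spanned_mod K K" unfolding spanned_mod_def using eqv_refl by blast
    then show ?case using K by simp
  next
    case (snoc v vs)
    have E: "is_subring (foldl adjoin K vs)" by (rule adjoin_list_subring) fact
    show ?case
      using snoc goldman_descends[OF E] goldman_algebraic[OF E] field_mod_adjoin[OF E]
        spanned_mod_adjoin[OF E] by simp
  qed
  then show ?thesis ..
qed

end

section \<open>Linear relations\<close>

text \<open>Gaussian elimination: a pivot \<open>a j b\<close> removes the equation
  \<open>b\<close>, which in the end determines the coefficient of \<open>j\<close>.\<close>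

lemma linear_relation:
  fixes a :: "'i \<Rightarrow> 'b \<Rightarrow> 'k::field"
  assumes "finite B" "finite I" "card B < card I"
  shows "\<exists>c. (\<exists>i\<in>I. c i \<noteq> 0) \<and> (\<forall>b\<in>B. (\<Sum>i\<in>I. c i * a i b) = 0)"
  using assms
proof (induction B arbitrary: I a rule: finite_induct)
  case empty
  then show ?case by (intro exI[of _ "\<lambda>_. 1"]) (auto simp: card_gt_0_iff)
next
  case (insert b B)
  show ?case
  proof (cases "\<forall>i\<in>I. a i b = 0")
    case True
    then show ?thesis using insert.IH[OF insert.prems(1), of a] insert by auto
  next
    case False
    then obtain j where j: "j \<in> I" "a j b \<noteq> 0" by blast
    define a' where "a' i x = a i x - a i b / a j b * a j x" for i x
    have "card B < card (I - {j})" using insert j by simp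
    then obtain c where c: "\<exists>i\<in>I - {j}. c i \<noteq> 0"
      "\<And>x. x \<in> B \<Longrightarrow> (\<Sum>i\<in>I - {j}. c i * a' i x) = 0"
      using insert.IH[of "I - {j}" a'] insert.prems by blast
    define c' where "c' = c(j := - (\<Sum>i\<in>I - {j}. c i * a i b / a j b))"
    have sum: "(\<Sum>i\<in>I. c' i * a i x) = (\<Sum>i\<in>I - {j}. c i * a' i x)" for x
    proof -
      have "(\<Sum>i\<in>I. c' i * a i x) = c' j * a j x + (\<Sum>i\<in>I - {j}. c' i * a i x)"
        using insert.prems j by (simp add: sum.remove)
      also have "(\<Sum>i\<in>I - {j}. c' i * a i x) = (\<Sum>i\<in>I - {j}. c i * a i x)"
        by (intro sum.cong) (auto simp: c'_def)
      also have "c' j * a j x = - (\<Sum>i\<in>I - {j}. c i * (a i b / a j b * a j x))"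
        by (simp add: c'_def sum_distrib_right mult.assoc)
      finally show ?thesis by (simp add: a'_def sum_subtractf right_diff_distrib)
    qed
    have "(\<Sum>i\<in>I - {j}. c i * a' i b) = 0" using j by (simp add: a'_def)
    then have "\<forall>x\<in>insert b B. (\<Sum>i\<in>I. c' i * a i x) = 0" using c(2) sum by auto
    moreover have "\<exists>i\<in>I. c' i \<noteq> 0" using c(1) by (auto simp: c'_def)
    ultimately show ?thesis by blast
  qed
qed

lemma range_cst_closed: "is_subring (range (cst :: 'k::comm_ring_1 \<Rightarrow> 'm::comm_monoid_add \<Rightarrow>\<^sub>0 'k))"
proof -
  have "0 = (cst 0 :: 'm \<Rightarrow>\<^sub>0 'k)" "1 = (cst 1 :: 'm \<Rightarrow>\<^sub>0 'k)" by simp_all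
  then have "0 \<in> range (cst :: 'k \<Rightarrow> 'm \<Rightarrow>\<^sub>0 'k)" "1 \<in> range (cst :: 'k \<Rightarrow> 'm \<Rightarrow>\<^sub>0 'k)" by blast+
  then show ?thesis
    unfolding is_subring_def by (auto simp: mult_single simp flip: single_add single_uminus)
qed

section \<open>Algebraic relations over the coefficient field\<close>

lemma gen_in_cst:
  fixes B :: "('m::comm_monoid_add \<Rightarrow>\<^sub>0 'k::comm_ring_1) set"
  assumes "finite B" "y \<in> gen_in (range cst) B"
  shows "\<exists>a. y = (\<Sum>b\<in>B. cst (a b) * b)"
  using assms(2)
proof induction
  case zero
  show ?case by (intro exI[of _ "\<lambda>_. 0"]) simp
next
  case (step e b x)
  then obtain a k where a: "x = (\<Sum>b\<in>B. cst (a b) * b)" "e = cst k" by blast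
  have "(\<Sum>b'\<in>B. cst ((a(b := a b + k)) b') * b') =
      (\<Sum>b'\<in>B. cst (a b') * b' + (if b' = b then e * b else 0))"
    by (intro sum.cong) (auto simp: a(2) cst_add distrib_right)
  also have "\<dots> = x + e * b" using step assms(1) by (simp add: sum.distrib a(1))
  finally show ?case by (intro exI[of _ "a(b := a b + k)"]) (simp add: add.commute)
qed

text \<open>Modulo \<open>p\<close>, the powers of \<open>x\<close> up to exponent
  \<open>card B\<close> outnumber the spanning elements and are linearly dependent over the
  field.\<close>

lemma spanned_mod_algebraic:
  fixes p :: "('m::comm_monoid_add \<Rightarrow>\<^sub>0 'k::field) set"
  assumes "is_prime p" and span: "prime_mod.spanned_mod p (range cst) E"
    and E: "is_subring E" "x \<in> E"
  shows "\<exists>f. f \<noteq> 0 \<and> peval f x \<in> p"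
proof -
  interpret prime_mod p by standard fact
  obtain B where B: "finite B" "\<And>y. y \<in> E \<Longrightarrow> \<exists>z\<in>gen_in (range cst) B. y \<asymp> z"
    using span unfolding spanned_mod_def by blast
  have "\<forall>i. \<exists>a. x ^ i \<asymp> (\<Sum>b\<in>B. cst (a b) * b)"
  proof
    fix i
    obtain z where "z \<in> gen_in (range cst) B" "x ^ i \<asymp> z"
      using B(2)[OF is_subring_closed(7)[OF E], of i] by (rule bexE)
    moreover from this(1) obtain a where "z = (\<Sum>b\<in>B. cst (a b) * b)" using gen_in_cst[OF B(1)] by blast
    ultimately show "\<exists>a. x ^ i \<asymp> (\<Sum>b\<in>B. cst (a b) * b)" by blast
  qed
  from choice[OF this] obtain a where a: "\<And>i. x ^ i \<asymp> (\<Sum>b\<in>B. cst (a i b) * b)" by blast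
  obtain c where c: "\<exists>i\<in>{..card B}. c i \<noteq> 0" "\<And>b. b \<in> B \<Longrightarrow> (\<Sum>i\<le>card B. c i * a i b) = 0"
    using linear_relation[OF B(1), of "{..card B}" a] by auto
  define f where "f = (\<Sum>i\<le>card B. monom (c i) i)"
  have "coeff f i = c i" if "i \<le> card B" for i
    using that by (simp add: f_def coeff_sum)
  then have "f \<noteq> 0" using c(1) by force
  have "peval (\<Sum>i\<in>A. monom (c i) i) x \<asymp> (\<Sum>i\<in>A. cst (c i) * (\<Sum>b\<in>B. cst (a i b) * b))"
    if "finite A" for A
    using that
  proof induction
    case (insert i A)
    show ?case
      unfolding sum.insert[OF insert.hyps] peval_add peval_monom
      by (intro eqv_add eqv_mult a eqv_refl insert.IH)
  qed simp
  then have "peval f x \<asymp> (\<Sum>i\<le>card B. cst (c i) * (\<Sum>b\<in>B. cst (a i b) * b))"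
    by (simp add: f_def)
  also have "\<dots> = (\<Sum>i\<le>card B. \<Sum>b\<in>B. cst (c i * a i b) * b)"
    by (simp only: sum_distrib_left cst_mult mult.assoc)
  also have "\<dots> = (\<Sum>b\<in>B. \<Sum>i\<le>card B. cst (c i * a i b) * b)" by (rule sum.swap)
  also have "\<dots> = (\<Sum>b\<in>B. cst (\<Sum>i\<le>card B. c i * a i b) * b)"
    by (simp only: cst_sum sum_distrib_right)
  also have "\<dots> = 0" using c(2) by simp
  finally show ?thesis using \<open>f \<noteq> 0\<close> eqv_zero_iff by blast
qed

section \<open>The dimension of a Stanley--Reisner ring\<close>

text \<open>Exponents are bounded one by one, not in total, because monomials are counted in
  boxes.\<close>

definition exps_le :: "nat \<Rightarrow> ('v, 'k::comm_ring_1) mpoly \<Rightarrow> bool"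
  where "exps_le K p \<longleftrightarrow> (\<forall>m\<in>keys p. \<forall>v. lookup m v \<le> K)"

lemma exps_le_mult:
  assumes "exps_le K p" "exps_le L q"
  shows "exps_le (K + L) (p * q)"
  unfolding exps_le_def
proof (intro ballI allI)
  fix m v assume "m \<in> keys (p * q)"
  then obtain a b where "a \<in> keys p" "b \<in> keys q" "m = a + b" using keys_mult[of p q] by blast
  then show "lookup m v \<le> K + L" using assms by (auto simp: exps_le_def lookup_add intro: add_mono)
qed

lemma exps_le_mono: "exps_le K p \<Longrightarrow> K \<le> L \<Longrightarrow> exps_le L p"
  by (auto simp: exps_le_def intro: order_trans)

lemma exps_le_one: "exps_le 0 1"
  by (auto simp: exps_le_def)

lemma exps_le_power: "exps_le K p \<Longrightarrow> exps_le (n * K) (p ^ n)"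
  by (induction n) (auto simp: exps_le_one intro: exps_le_mult)

lemma ex_exps_le: "\<exists>K. exps_le K p"
proof -
  have "lookup m v \<le> (\<Sum>m\<in>keys p. \<Sum>v\<in>keys m. lookup m v)" if "m \<in> keys p" for m v
  proof (cases "v \<in> keys m")
    case True
    then have "lookup m v \<le> (\<Sum>v\<in>keys m. lookup m v)" by (intro member_le_sum) auto
    also have "\<dots> \<le> (\<Sum>m\<in>keys p. \<Sum>v\<in>keys m. lookup m v)"
      using that by (intro member_le_sum[of m "keys p" "\<lambda>m. \<Sum>v\<in>keys m. lookup m v"]) auto
    finally show ?thesis .
  next
    case False
    then show ?thesis by (simp add: in_keys_iff)
  qed
  then show ?thesis by (auto simp: exps_le_def)
qed

text \<open>A monomial in \<open>y k\<close>, \<open>y (Suc k)\<close> and so on; the starting index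
  lets an induction drop the first factor.\<close>

primrec mon_from :: "(nat \<Rightarrow> 'a::comm_ring_1) \<Rightarrow> nat \<Rightarrow> nat list \<Rightarrow> 'a" where
  "mon_from y k [] = 1"
| "mon_from y k (a # as) = y k ^ a * mon_from y (Suc k) as"

lemma exps_le_mon_from:
  assumes "\<And>i. i < k + length as \<Longrightarrow> exps_le D (y i)" "\<And>a. a \<in> set as \<Longrightarrow> a \<le> M"
  shows "exps_le (length as * (M * D)) (mon_from y k as)"
  using assms
proof (induction as arbitrary: k)
  case Nil
  then show ?case by (simp add: exps_le_one)
next
  case (Cons a as)
  have "exps_le (a * D) (y k ^ a)" using Cons.prems by (intro exps_le_power) auto
  then have "exps_le (M * D) (y k ^ a)" using Cons.prems by (elim exps_le_mono) auto
  moreover have "exps_le (length as * (M * D)) (mon_from y (Suc k) as)"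
    using Cons.prems by (intro Cons.IH) auto
  ultimately show ?case using exps_le_mult by fastforce
qed

text \<open>Peeling off the variables one after the other along a chain of primes: after division by the
  lowest power of \<open>y k\<close> the terms of positive degree in \<open>y k\<close> lie in \<open>Q (Suc k)\<close>.\<close>

lemma no_relation_along_prime_chain:
  fixes Q :: "nat \<Rightarrow> ('m::comm_monoid_add \<Rightarrow>\<^sub>0 'k::field) set"
  assumes Q: "\<And>i. i \<le> n \<Longrightarrow> is_prime (Q i)" "\<And>i. i < n \<Longrightarrow> Q i \<subseteq> Q (Suc i)"
    and y: "\<And>i. i < n \<Longrightarrow> y i \<in> Q (Suc i)" "\<And>i. i < n \<Longrightarrow> y i \<notin> Q i"
    and S: "finite S" "S \<noteq> {}" "\<And>as. as \<in> S \<Longrightarrow> length as = L \<and> c as \<noteq> 0" "k + L \<le> n"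
    and rel: "(\<Sum>as\<in>S. cst (c as) * mon_from y k as) \<in> Q k"
  shows False
  using S rel
proof (induction L arbitrary: S c k)
  case 0
  interpret prime_mod "Q k" by standard (use Q 0 in auto)
  have "S = {[]}" using 0 by auto
  then have "cst (c []) \<in> Q k" "c [] \<noteq> 0" using 0 by auto
  then have "cst (inverse (c [])) * cst (c []) \<in> Q k" using mult_mem_iff by blast
  then show False using \<open>c [] \<noteq> 0\<close> one_notin by (simp add: mult_single)
next
  case (Suc L)
  have k: "k < n" using Suc.prems(4) by simp
  interpret Qk: prime_mod "Q k" by standard (use Q k in auto)
  interpret Qs: prime_mod "Q (Suc k)" by standard (use Q k in auto)
  \<comment> \<open>The common factor \<open>y k ^ m\<close> can be cancelled in the prime
    \<open>Q k\<close>, as \<open>y k\<close> is not in it.\<close>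
  define m where "m = Min (hd ` S)"
  have m_in: "m \<in> hd ` S" and m_le: "\<And>as. as \<in> S \<Longrightarrow> m \<le> hd as"
    using Suc.prems by (auto simp: m_def)
  define g where "g as = cst (c as) * y k ^ (hd as - m) * mon_from y (Suc k) (tl as)" for as
  have "cst (c as) * mon_from y k as = y k ^ m * g as" if as: "as \<in> S" for as
  proof -
    obtain a bs where abs: "as = a # bs" using Suc.prems(3)[OF as] by (cases as) auto
    then have "y k ^ a = y k ^ m * y k ^ (a - m)" using m_le[OF as] by (simp flip: power_add)
    then show ?thesis unfolding g_def abs mon_from.simps list.sel by (simp only: mult_ac)
  qed
  then have "(\<Sum>as\<in>S. cst (c as) * mon_from y k as) = y k ^ m * sum g S"
    by (simp add: sum_distrib_left)
  then have "sum g S \<in> Q k"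
    using Suc.prems(5) y(2)[OF k] Qk.mult_mem_iff Qk.power_mem by metis
  then have sum_S: "sum g S \<in> Q (Suc k)" using Q(2)[OF k] by blast
  \<comment> \<open>The surviving lists share the head \<open>m\<close>, so passing to tails is
    injective: no terms merge and the coefficients stay nonzero.\<close>
  define S' where "S' = {as \<in> S. hd as = m}"
  have "sum g (S - S') \<in> Q (Suc k)"
  proof (intro ri.subspace_sum Qs.p_ideal)
    fix as assume "as \<in> S - S'"
    then have "m < hd as" using m_le[of as] by (auto simp: S'_def)
    then obtain d where "hd as - m = Suc d" by (metis Suc_diff_Suc)
    then show "g as \<in> Q (Suc k)"
      using y(1)[OF k] by (simp add: g_def Qs.mult_mem_iff)
  qed
  moreover have "sum g S = sum g S' + sum g (S - S')"
    using Suc.prems(1) by (subst sum.subset_diff[of S' S]) (auto simp: S'_def)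
  ultimately have "sum g S' \<in> Q (Suc k)"
    using sum_S ri.subspace_diff[OF Qs.p_ideal] by (metis add_diff_cancel_right')
  moreover have "sum g S' = (\<Sum>bs\<in>tl ` S'. cst (c (m # bs)) * mon_from y (Suc k) bs)"
  proof (rule sum.reindex_bij_witness[of _ "(#) m" tl])
    fix as assume "as \<in> S'"
    then have "as \<in> S" "hd as = m" by (auto simp: S'_def)
    then obtain bs where as: "as = m # bs" using Suc.prems(3)[of as] by (cases as) auto
    then show "m # tl as = as" "cst (c (m # tl as)) * mon_from y (Suc k) (tl as) = g as"
      by (auto simp: g_def)
    show "tl as \<in> tl ` S'" using \<open>as \<in> S'\<close> by (rule imageI)
  next
    fix bs assume "bs \<in> tl ` S'"
    then obtain as where as: "as \<in> S" "hd as = m" "bs = tl as" by (auto simp: S'_def)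
    have "as \<noteq> []" using Suc.prems(3)[OF as(1)] by auto
    then have "as = m # bs" using as(2,3) list.collapse by metis
    then have "m # bs \<in> S" using as(1) by simp
    then show "m # bs \<in> S'" "tl (m # bs) = bs" by (auto simp: S'_def)
  qed
  ultimately have "(\<Sum>bs\<in>tl ` S'. cst (c (m # bs)) * mon_from y (Suc k) bs) \<in> Q (Suc k)" by simp
  moreover have "length bs = L \<and> c (m # bs) \<noteq> 0" if bs: "bs \<in> tl ` S'" for bs
  proof -
    obtain as where as: "as \<in> S" "hd as = m" "bs = tl as" using bs by (auto simp: S'_def)
    have "as \<noteq> []" using Suc.prems(3)[OF as(1)] by auto
    then have "as = m # bs" using as(2,3) list.collapse by metis
    then show ?thesis using Suc.prems(3)[OF as(1)] by auto
  qed
  moreover have "finite (tl ` S')" "tl ` S' \<noteq> {}" using Suc.prems(1) m_in by (auto simp: S'_def)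
  ultimately show False using Suc.IH[of "tl ` S'" "\<lambda>bs. c (m # bs)" "Suc k"] Suc.prems(4) by simp
qed

lemma card_bounded_monomials:
  assumes F: "finite F" "card F \<le> d"
  shows "finite {m :: 'v \<Rightarrow>\<^sub>0 nat. keys m \<subseteq> F \<and> (\<forall>v. lookup m v \<le> K)}" (is "finite ?A")
    "card {m :: 'v \<Rightarrow>\<^sub>0 nat. keys m \<subseteq> F \<and> (\<forall>v. lookup m v \<le> K)} \<le> Suc K ^ d"
proof -
  let ?r = "\<lambda>m. restrict (lookup m) F"
  have inj: "inj_on ?r ?A"
  proof (rule inj_onI)
    fix m m' assume mm: "m \<in> ?A" "m' \<in> ?A" "?r m = ?r m'"
    have "lookup m v = lookup m' v" for v
    proof (cases "v \<in> F")
      case True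
      then show ?thesis using fun_cong[OF mm(3), of v] by simp
    next
      case False
      then have "v \<notin> keys m" "v \<notin> keys m'" using mm by auto
      then show ?thesis by (simp add: in_keys_iff)
    qed
    then show "m = m'" by (rule poly_mapping_eqI)
  qed
  have sub: "?r ` ?A \<subseteq> F \<rightarrow>\<^sub>E {..K}" by auto
  have fin: "finite (F \<rightarrow>\<^sub>E {..K})" using F by (intro finite_PiE) auto
  show "finite ?A" using inj finite_subset[OF sub fin] by (rule finite_imageD[rotated])
  have "card ?A = card (?r ` ?A)" using inj by (rule card_image[symmetric])
  also have "\<dots> \<le> card (F \<rightarrow>\<^sub>E {..K})" using fin sub by (rule card_mono)
  also have "\<dots> = Suc K ^ card F" using F by (simp add: card_PiE)
  also have "\<dots> \<le> Suc K ^ d" using F by (intro power_increasing) auto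
  finally show "card ?A \<le> Suc K ^ d" .
qed

text \<open>Modulo the ideal, products of \<open>d + 1\<close> elements with exponents below
  \<open>M\<close> involve only monomials supported on faces, whose number grows like
  \<open>M ^ d\<close>, while there are \<open>M ^ (d + 1)\<close> products. This counting takes the
  place of transcendence degree and produces the relation that the chain excludes.\<close>

lemma SR_prime_chain:
  fixes Q :: "nat \<Rightarrow> ('v, 'k::field) mpoly set"
  assumes \<Delta>: "finite \<Delta>" "\<And>F. F \<in> \<Delta> \<Longrightarrow> finite F \<and> card F \<le> d"
    and Q: "\<And>i. i \<le> Suc d \<Longrightarrow> is_prime (Q i) \<and> SR \<Delta> \<subseteq> Q i" "\<And>i. i \<le> d \<Longrightarrow> Q i \<subset> Q (Suc i)"
  shows False
proof -
  have "\<forall>i. \<exists>y. i \<le> d \<longrightarrow> y \<in> Q (Suc i) - Q i" using Q(2) by blast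
  then obtain y where y: "\<And>i. i \<le> d \<Longrightarrow> y i \<in> Q (Suc i) - Q i" by metis
  have "\<forall>i. \<exists>D. exps_le D (y i)" by (intro allI ex_exps_le)
  from choice[OF this] obtain D' where D': "\<And>i. exps_le (D' i) (y i)" by blast
  define D where "D = Max (D' ` {..d})"
  have D: "exps_le D (y i)" if "i \<le> d" for i
    using D' by (rule exps_le_mono) (use that in \<open>auto simp: D_def\<close>)
  \<comment> \<open>\<open>K\<close> bounds the exponents of all products in question,
    \<open>C\<close> satisfies \<open>Suc K \<le> C * M\<close>, and \<open>M\<close> is just large
    enough that \<open>card \<Delta> * (C * M) ^ d < M * M ^ d\<close>.\<close>
  define C where "C = Suc (Suc d * D)"
  define M where "M = Suc (card \<Delta> * C ^ d)"
  define K where "K = Suc d * (M * D)"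
  define I where "I = {as. set as \<subseteq> {..<M} \<and> length as = Suc d}"
  define B where "B = (\<Union>F\<in>\<Delta>. {m :: 'v \<Rightarrow>\<^sub>0 nat. keys m \<subseteq> F \<and> (\<forall>v. lookup m v \<le> K)})"
  have finB: "finite B" unfolding B_def using \<Delta> card_bounded_monomials(1) by blast
  have finI: "finite I" unfolding I_def by (rule finite_lists_length_eq) simp
  have "card B \<le> (\<Sum>F\<in>\<Delta>. card {m :: 'v \<Rightarrow>\<^sub>0 nat. keys m \<subseteq> F \<and> (\<forall>v. lookup m v \<le> K)})"
    unfolding B_def using \<Delta>(1) by (rule card_UN_le)
  also have "\<dots> \<le> (\<Sum>F\<in>\<Delta>. Suc K ^ d)" using \<Delta>(2) card_bounded_monomials(2) by (intro sum_mono) blast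
  also have "\<dots> = card \<Delta> * Suc K ^ d" by simp
  also have "Suc K \<le> C * M" by (simp add: K_def C_def M_def algebra_simps)
  then have "card \<Delta> * Suc K ^ d \<le> card \<Delta> * (C * M) ^ d"
    by (intro mult_left_mono power_mono) auto
  also have "\<dots> = card \<Delta> * C ^ d * M ^ d" by (simp add: power_mult_distrib)
  also have "\<dots> < M * M ^ d" by (simp add: M_def)
  also have "\<dots> = card I" unfolding I_def by (simp add: card_lists_length_eq)
  \<comment> \<open>One equation per face monomial in the box; a nonface monomial lies in the ideal
    whatever its coefficient.\<close>
  finally obtain c where c: "\<exists>as\<in>I. c as \<noteq> 0"
    "\<And>m. m \<in> B \<Longrightarrow> (\<Sum>as\<in>I. c as * lookup (mon_from y 0 as) m) = 0"
    using linear_relation[OF finB finI, of "\<lambda>as. lookup (mon_from y 0 as)"] by blast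
  let ?p = "\<Sum>as\<in>I. cst (c as) * mon_from y 0 as"
  have lookup_p: "lookup ?p m = (\<Sum>as\<in>I. c as * lookup (mon_from y 0 as) m)" for m
    by (simp add: lookup_sum lookup_single_mult[of 0 _ _ m, simplified])
  have "?p \<in> SR \<Delta>"
    unfolding SR_def
  proof safe
    fix m assume m: "m \<in> keys ?p" "keys m \<in> \<Delta>"
    then have "(\<Sum>as\<in>I. c as * lookup (mon_from y 0 as) m) \<noteq> 0" by (simp add: in_keys_iff lookup_p)
    then obtain as where as: "as \<in> I" "lookup (mon_from y 0 as) m \<noteq> 0"
      by (metis (no_types, lifting) mult_zero_right sum.neutral)
    have "exps_le (length as * (M * D)) (mon_from y 0 as)"
      by (rule exps_le_mon_from) (use as(1) D in \<open>auto simp: I_def\<close>)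
    then have "\<forall>v. lookup m v \<le> K"
      using as by (auto simp: exps_le_def in_keys_iff I_def K_def)
    then have "m \<in> B" using m(2) by (auto simp: B_def)
    then show False using m(1) c(2) by (simp add: in_keys_iff lookup_p)
  qed
  moreover have "(\<Sum>as\<in>{as \<in> I. c as \<noteq> 0}. cst (c as) * mon_from y 0 as) = ?p"
    by (rule sum.mono_neutral_left) (use finI in auto)
  ultimately have "(\<Sum>as\<in>{as \<in> I. c as \<noteq> 0}. cst (c as) * mon_from y 0 as) \<in> Q 0"
    using Q(1)[of 0] by auto
  then show False
  proof (rule no_relation_along_prime_chain[rotated -1])
    show "is_prime (Q i)" if "i \<le> Suc d" for i using Q(1)[OF that] by blast
    show "Q i \<subseteq> Q (Suc i)" "y i \<in> Q (Suc i)" "y i \<notin> Q i" if "i < Suc d" for i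
      using Q(2)[of i] y[of i] that by auto
    show "finite {as \<in> I. c as \<noteq> 0}" "{as \<in> I. c as \<noteq> 0} \<noteq> {}" using finI c(1) by auto
    show "length as = Suc d \<and> c as \<noteq> 0" if "as \<in> {as \<in> I. c as \<noteq> 0}" for as
      using that by (auto simp: I_def)
  qed simp
qed

section \<open>Localizing a quotient of a type-class ring\<close>

text \<open>With \<open>S = {1}\<close> the locale describes the quotient itself. Localizing at
  \<open>m\<close> keeps \<open>J\<close> and enlarges the denominators to all elements that
  \<open>g\<close> maps outside \<open>m\<close>.\<close>

lemma frac_hom_localization:
  fixes A (structure) and g :: "'r::comm_ring_1 \<Rightarrow> 'a"
  assumes g: "frac_hom A g {1} J" and m: "primeideal m A"
  shows "frac_hom (localization A (carrier A - m)) (\<lambda>r. loc_frac A (carrier A - m) (g r) \<one>)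
    (- frac_hom.contr g m) J"
proof -
  interpret g: frac_hom A g "{1}" J by fact
  interpret m: primeideal m A by fact
  interpret loc: localization_at A "carrier A - m"
  proof
    show "\<one> \<in> carrier A - m" using m.I_notcarr m.one_imp_carrier by auto
  qed (use m.I_prime in auto)
  note one = loc.one_S
  have g_mem: "g r \<in> carrier A - m" if "r \<in> - g.contr m" for r using that by (simp add: g.contr_def)
  have carr: "\<exists>r. a = g r" if "a \<in> carrier A" for a
    using g.h_surj[OF that] that by (auto simp: g.h_one)
  show ?thesis
  proof (intro frac_hom.intro loc.localization_cring frac_hom_axioms.intro)
    show "1 \<in> - g.contr m" using one by (simp add: g.contr_def g.h_one)
    show "s * t \<in> - g.contr m" if "s \<in> - g.contr m" "t \<in> - g.contr m" for s t
      using that m.I_prime[of "g s" "g t"] by (auto simp: g.contr_def g.h_mult)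
    show "loc.frac (g s) \<one> \<in> Units loc.Q" if s: "s \<in> - g.contr m" for s
    proof -
      have gs: "g s \<in> carrier A - m" using s by (rule g_mem)
      have "loc.frac (g s) \<one> \<otimes>\<^bsub>loc.Q\<^esub> loc.frac \<one> (g s) = \<one>\<^bsub>loc.Q\<^esub>"
        using gs one by (simp add: loc.frac_mult loc.frac_one) (rule loc.frac_eqI; simp)
      moreover have "loc.frac \<one> (g s) \<otimes>\<^bsub>loc.Q\<^esub> loc.frac (g s) \<one> = \<one>\<^bsub>loc.Q\<^esub>"
        using gs one by (simp add: loc.frac_mult loc.frac_one) (rule loc.frac_eqI; simp)
      ultimately show ?thesis
        using gs one loc.frac_carrier unfolding Units_def by blast
    qed
    show "\<exists>r s. s \<in> - g.contr m \<and> l \<otimes>\<^bsub>loc.Q\<^esub> loc.frac (g s) \<one> = loc.frac (g r) \<one>"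
      if l: "l \<in> carrier loc.Q" for l
    proof -
      obtain a b where ab: "a \<in> carrier A" "b \<in> carrier A - m" "l = loc.frac a b"
        using l by (rule loc.frac_cases)
      then obtain r s where rs: "a = g r" "b = g s" using carr by blast
      have "l \<otimes>\<^bsub>loc.Q\<^esub> loc.frac (g s) \<one> = loc.frac (g r) \<one>"
        using ab one rs by (simp add: loc.frac_mult) (rule loc.frac_eqI; simp)
      then show ?thesis using ab rs by (auto simp: g.contr_def)
    qed
    show "loc.frac (g r) \<one> = \<zero>\<^bsub>loc.Q\<^esub> \<longleftrightarrow> (\<exists>u\<in>- g.contr m. u * r \<in> J)" for r
    proof -
      have "loc.frac (g r) \<one> = \<zero>\<^bsub>loc.Q\<^esub> \<longleftrightarrow> (\<exists>u\<in>carrier A - m. u \<otimes> g r = \<zero>)"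
        using one by (auto simp: loc.frac_zero loc.frac_eq_iff)
      also have "\<dots> \<longleftrightarrow> (\<exists>u\<in>- g.contr m. g (u * r) = \<zero>)"
      proof
        assume "\<exists>u\<in>carrier A - m. u \<otimes> g r = \<zero>"
        then obtain u where u: "u \<in> carrier A - m" "u \<otimes> g r = \<zero>" by blast
        then obtain v where v: "u = g v" using carr by blast
        then have "v \<in> - g.contr m" "g (v * r) = \<zero>" using u by (simp_all add: g.contr_def g.h_mult)
        then show "\<exists>u\<in>- g.contr m. g (u * r) = \<zero>" by blast
      next
        assume "\<exists>u\<in>- g.contr m. g (u * r) = \<zero>"
        then show "\<exists>u\<in>carrier A - m. u \<otimes> g r = \<zero>" using g_mem by (auto simp: g.h_mult)
      qed
      also have "\<dots> \<longleftrightarrow> (\<exists>u\<in>- g.contr m. u * r \<in> J)" by (simp add: g.h_kernel)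
      finally show ?thesis .
    qed
  qed (use one g.J_ideal in \<open>auto simp: loc.frac_add loc.frac_mult loc.frac_one g.h_add g.h_mult g.h_one\<close>)
qed

lemma (in maximalideal) inverse_mod:
  assumes "cring R" "a \<in> carrier R - I"
  shows "\<exists>y\<in>carrier R. a \<otimes> y \<ominus> \<one> \<in> I"
proof -
  interpret cring R by fact
  have "a \<in> carrier R" using assms(2) by blast
  then obtain K where K: "ideal K R" "I \<subseteq> K" "a \<in> K"
    "\<And>x. x \<in> K \<Longrightarrow> \<exists>q\<in>I. \<exists>r\<in>carrier R. x = q \<oplus> r \<otimes> a"
    using adjoin_element[OF assms(1), of a] by metis
  have "K \<subseteq> carrier R" using ideal.Icarr[OF K(1)] by blast
  then have "K = carrier R" using I_maximal[OF K(1,2)] K(3) assms by blast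
  then have "\<one> \<in> K" by simp
  then obtain q y where qy: "q \<in> I" "y \<in> carrier R" "\<one> = q \<oplus> y \<otimes> a"
    using K(4) by blast
  have "q \<in> carrier R" using qy(1) by (rule Icarr)
  have "a \<otimes> y \<ominus> \<one> = \<ominus> q"
    unfolding qy(3) using assms qy(2) \<open>q \<in> carrier R\<close>
    by (simp add: a_minus_def minus_add m_comm a_ac r_neg r_neg1 r_neg2)
  moreover have "\<ominus> q \<in> I" using qy(1) by simp
  ultimately show ?thesis using qy(2) by (metis (no_types))
qed

section \<open>Polynomials in finitely many variables\<close>

definition polys_in :: "'v set \<Rightarrow> ('v, 'k::comm_ring_1) mpoly set"
  where "polys_in V = {p. \<forall>m\<in>keys p. keys m \<subseteq> V}"

lemma polys_in_single: "keys m \<subseteq> V \<Longrightarrow> single m c \<in> polys_in V"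
  by (simp add: polys_in_def)

lemma polys_in_mvar: "v \<in> V \<Longrightarrow> mvar v \<in> polys_in V"
  by (simp add: mvar_def polys_in_single)

lemma polys_in_subring: "is_subring (polys_in V :: ('v, 'k::comm_ring_1) mpoly set)"
  unfolding is_subring_def
proof (intro conjI ballI)
  fix p q :: "('v, 'k) mpoly"
  assume pq: "p \<in> polys_in V" "q \<in> polys_in V"
  show "p + q \<in> polys_in V" using pq keys_add[of p q] by (auto simp: polys_in_def)
  show "p * q \<in> polys_in V"
    unfolding polys_in_def
  proof safe
    fix m v assume "m \<in> keys (p * q)" "v \<in> keys m"
    then show "v \<in> V" using pq keys_mult[of p q] by (force simp: polys_in_def keys_add_nat)
  qed
qed (auto simp: polys_in_def in_keys_iff)

lemma mpoly_ring_cring: "cring (mpoly_ring V :: ('v, 'k::comm_ring_1) mpoly ring)"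
proof (rule cringI)
  note c = is_subring_closed[OF polys_in_subring[of V]]
  have carr: "carrier (mpoly_ring V) = polys_in V" by (simp add: mpoly_ring_def polys_in_def)
  show "abelian_group (mpoly_ring V :: ('v, 'k) mpoly ring)"
    by (rule abelian_groupI; unfold carr)
      (auto simp: mpoly_ring_def c add_ac intro!: bexI[of _ "- _"])
  show "comm_monoid (mpoly_ring V :: ('v, 'k) mpoly ring)"
    by (rule comm_monoidI; unfold carr) (auto simp: mpoly_ring_def c mult_ac)
qed (auto simp: mpoly_ring_def distrib_right)

lemma adjoin_subset:
  assumes C: "is_subring C" "E \<subseteq> C" "v \<in> C"
  shows "adjoin E v \<subseteq> C"
proof
  fix x assume "x \<in> adjoin E v"
  then obtain P where P: "P \<in> polys_over E" "x = poly P v" unfolding adjoin_def by blast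
  then have "coeff P i \<in> C" for i using C(2) polys_overD by blast
  then show "x \<in> C" unfolding P(2) poly_altdef
    by (intro is_subring_closed(4,7,8)[OF C(1)] C(3))
qed

text \<open>Through this description the basis theorem and the Nullstellensatz, which adjoin one
  element at a time, reach polynomial rings over a field.\<close>

lemma polys_in_eq_adjoin:
  "polys_in (set vs) = foldl adjoin (range cst) (map mvar vs)"
proof (induction vs rule: rev_induct)
  case Nil
  have "p \<in> range cst" if "p \<in> polys_in {}" for p :: "('a, 'b) mpoly"
  proof -
    have "keys p \<subseteq> {0}" using that by (auto simp: polys_in_def)
    then have "p = cst (lookup p 0)"
      by (intro poly_mapping_eqI) (auto simp: lookup_single when_def in_keys_iff)
    then show ?thesis by blast
  qed
  then show ?case by (auto simp: polys_in_def split: if_splits)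
next
  case (snoc v vs)
  let ?E = "polys_in (set vs) :: ('a, 'b) mpoly set"
  have E: "is_subring ?E" by (rule polys_in_subring)
  note c = is_subring_closed[OF adjoin_subring[OF E]]
  have "adjoin ?E (mvar v) \<subseteq> polys_in (set (vs @ [v]))"
    by (rule adjoin_subset) (auto simp: polys_in_subring polys_in_mvar, auto simp: polys_in_def)
  moreover have "p \<in> adjoin ?E (mvar v)" if p: "p \<in> polys_in (set (vs @ [v]))" for p
  proof -
    have "single m (lookup p m) \<in> adjoin ?E (mvar v)" if m: "m \<in> keys p" for m
    proof -
      let ?m = "m - single v (lookup m v)"
      have "?m + single v (lookup m v) = m"
        by (intro poly_mapping_eqI) (auto simp: lookup_add lookup_minus lookup_single when_def)
      then have eq: "single m (lookup p m) =
          single ?m (lookup p m) * mvar v ^ lookup m v"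
        by (simp add: mvar_power mult_single)
      have "keys ?m \<subseteq> set vs"
      proof
        fix x assume "x \<in> keys ?m"
        then have "x \<in> keys m" "x \<noteq> v"
          by (auto simp: in_keys_iff lookup_minus lookup_single when_def split: if_splits)
        then show "x \<in> set vs" using p m by (auto simp: polys_in_def)
      qed
      then have "single ?m (lookup p m) \<in> adjoin ?E (mvar v)"
        using subset_adjoin[OF E] polys_in_single by blast
      then show ?thesis unfolding eq by (intro c(4,7) adjoin_self E)
    qed
    then have "(\<Sum>m\<in>keys p. single m (lookup p m)) \<in> adjoin ?E (mvar v)" by (rule c(8))
    then show ?thesis by (simp only: sum_singles)
  qed
  ultimately show ?case using snoc.IH by auto
qed

lemma field_cst:
  assumes "c \<noteq> (0::'k::field)"
  shows "cst (inverse c) * cst c = 1"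
  using assms by (simp add: mult_single)

lemma noetherian_in_polys_in:
  assumes "finite V"
  shows "noetherian_in (polys_in V :: ('v, 'k::field) mpoly set)"
proof -
  obtain vs where vs: "V = set vs" using assms finite_list by blast
  let ?K = "range cst :: ('v, 'k) mpoly set"
  have "noetherian_in (foldl adjoin ?K us)" for us
  proof (induction us rule: rev_induct)
    case Nil
    show ?case
      unfolding noetherian_in_def
    proof (intro allI impI)
      fix J assume J: "ideal_in (foldl adjoin ?K []) J"
      show "\<exists>B\<subseteq>J. finite B \<and> J \<subseteq> gen_in (foldl adjoin ?K []) B"
      proof (cases "J \<subseteq> {0}")
        case True
        then show ?thesis by (intro exI[of _ "{}"]) (auto intro: gen_in.zero)
      next
        case False
        then obtain x where x: "x \<in> J" "x \<noteq> 0" by blast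
        then obtain c where "x = cst c" using J by (auto simp: ideal_in_def)
        then have c: "cst c \<in> J" "c \<noteq> 0" using x by auto
        have "cst (inverse c) * cst c \<in> J" using J c(1) unfolding ideal_in_def by auto
        then have "1 \<in> J" using field_cst[OF c(2)] by metis
        moreover have "x \<in> gen_in ?K {1}" if "x \<in> ?K" for x
          using gen_in.step[OF that _ gen_in.zero, of 1 "{1}"] by simp
        ultimately show ?thesis using J by (intro exI[of _ "{1}"]) (auto simp: ideal_in_def)
      qed
    qed
  next
    case (snoc u us)
    have "is_subring (foldl adjoin ?K us)"
      by (induction us rule: rev_induct) (auto intro: adjoin_subring range_cst_closed)
    then show ?case using snoc hilbert_basis by simp
  qed
  then show ?thesis unfolding vs polys_in_eq_adjoin by blast
qed

text \<open>Sets the variables outside \<open>V\<close> to zero: a retraction onto the ring in the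
  variables \<open>V\<close>, and the identity modulo \<open>SR \<Delta>\<close> if the faces of a
  down-closed \<open>\<Delta>\<close> lie in \<open>V\<close>.\<close>

definition restrict_vars :: "'v set \<Rightarrow> ('v, 'k::comm_ring_1) mpoly \<Rightarrow> ('v, 'k) mpoly"
  where "restrict_vars V = lin (\<lambda>m. if keys m \<subseteq> V then single m 1 else 0)"

lemma restrict_vars_add: "restrict_vars V (p + q) = restrict_vars V p + restrict_vars V q"
  by (simp add: restrict_vars_def lin_add)

lemma restrict_vars_mult: "restrict_vars V (p * q) = restrict_vars V p * restrict_vars V q"
  unfolding restrict_vars_def by (rule lin_mult) (auto simp: keys_add_nat mult_single)

lemma restrict_vars_single:
  "restrict_vars V (single m c) = (if keys m \<subseteq> V then single m c else 0)"
  by (simp add: restrict_vars_def lin_single mult_single)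

lemma restrict_vars_in: "restrict_vars V p \<in> polys_in V"
proof (induction p rule: mpoly_induct)
  case (single m c)
  then show ?case using is_subring_closed(1)[OF polys_in_subring]
    by (auto simp: restrict_vars_single polys_in_single)
next
  case (add p q)
  then show ?case using is_subring_closed(3)[OF polys_in_subring] by (simp add: restrict_vars_add)
qed

lemma restrict_vars_id: "p \<in> polys_in V \<Longrightarrow> restrict_vars V p = p"
proof -
  assume p: "p \<in> polys_in V"
  have "restrict_vars V (\<Sum>m\<in>A. single m (lookup p m)) =
      (\<Sum>m\<in>A. single m (lookup p m))" if "finite A" "A \<subseteq> keys p" for A
    using that
  proof induction
    case empty
    then show ?case by (simp add: restrict_vars_def lin_zero)
  next
    case (insert m A)
    then have "keys m \<subseteq> V" using p by (auto simp: polys_in_def)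
    then show ?case using insert by (simp add: restrict_vars_add restrict_vars_single)
  qed
  from this[of "keys p"] show ?thesis by (simp add: sum_singles)
qed

lemma restrict_vars_diff:
  assumes "down_closed \<Delta>" "\<Delta> \<subseteq> Pow V"
  shows "p - restrict_vars V p \<in> SR \<Delta>"
proof (induction p rule: mpoly_induct)
  case (single m c)
  then show ?case using assms(2) by (auto simp: restrict_vars_single SR_def)
next
  case (add p q)
  then show ?case
    using ri.subspace_add[OF SR_ideal[OF assms(1)]] by (simp only: restrict_vars_add add_diff_add)
qed

section \<open>Monomials supported on pairs and cycles\<close>

text \<open>If no vertex has two parents there is a closed walk, and a shortest one has distinct
  vertices. Irreflexivity excludes length one.\<close>

lemma nonforest_cases:
  assumes "\<not> forest H" "irrefl H"
  obtains i l j where "(i, j) \<in> H" "(l, j) \<in> H" "i \<noteq> l"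
  | t c where "2 \<le> (t::nat)" "inj_on c {1..t}" "(c t, c 1) \<in> H" "\<And>j. j \<in> {1..t - 1} \<Longrightarrow> (c j, c (j + 1)) \<in> H"
proof (cases "single_valued (H\<inverse>)")
  case False
  then show thesis using that(1) by (auto simp: single_valued_def)
next
  case True
  then have "\<not> acyclic H" using assms(1) by (simp add: forest_def)
  then obtain x where "(x, x) \<in> H\<^sup>+" by (auto simp: acyclic_def)
  then obtain k where k: "0 < k" "(x, x) \<in> H ^^ k" by (auto simp: trancl_power)
  define Pr where "Pr k \<longleftrightarrow> 0 < k \<and> (\<exists>x. (x, x) \<in> H ^^ k)" for k
  define t where "t = (LEAST k. Pr k)"
  have "Pr t" unfolding t_def using k by (intro LeastI[of Pr k]) (auto simp: Pr_def)
  then obtain x where t: "0 < t" and "(x, x) \<in> H ^^ t" unfolding Pr_def by blast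
  then obtain c where "c 0 = x" "c t = x" "\<forall>i<t. (c i, c (Suc i)) \<in> H"
    unfolding relpow_fun_conv by blast
  then have c: "c 0 = c t" "\<And>i. i < t \<Longrightarrow> (c i, c (Suc i)) \<in> H" by auto
  \<comment> \<open>A repetition would cut out a closed walk of length \<open>j - i < t\<close>.
    Indices start at 1 because \<open>c 0 = c t\<close>.\<close>
  have "c i \<noteq> c j" if ij: "i \<in> {1..t}" "j \<in> {1..t}" "i < j" for i j
  proof
    assume eq: "c i = c j"
    have "(c i, c j) \<in> H ^^ (j - i)"
      unfolding relpow_fun_conv using ij c(2) by (intro exI[of _ "\<lambda>l. c (i + l)"]) auto
    then have "Pr (j - i)" using ij eq by (auto simp: Pr_def)
    moreover have "j - i < t" using ij by auto
    ultimately show False unfolding t_def using not_less_Least by blast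
  qed
  then have inj: "inj_on c {1..t}" unfolding inj_on_def by (metis linorder_neqE_nat)
  have "t \<noteq> 1"
  proof
    assume "t = 1"
    then have "(c 0, c 0) \<in> H" using c by auto
    then show False using assms(2) by (auto simp: irrefl_def)
  qed
  then have "2 \<le> t" using t by simp
  then show thesis
  proof (rule that(2))
    show "inj_on c {1..t}" by fact
    show "(c t, c 1) \<in> H" using c(1) c(2)[of 0] t by simp
    show "(c j, c (j + 1)) \<in> H" if "j \<in> {1..t - 1}" for j using c(2)[of j] that t by auto
  qed
qed

lemma prod_mvar:
  assumes "finite A"
  shows "(\<Prod>a\<in>A. mvar (e a)) =
    (single (\<Sum>a\<in>A. single (e a) (Suc 0)) 1 :: ('v, 'k::comm_ring_1) mpoly)"
  using assms by induction (auto simp: mvar_def mult_single)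

lemma lookup_sum_single:
  assumes "finite A"
  shows "lookup (\<Sum>a\<in>A. single (e a) (Suc 0)) x = card {a \<in> A. e a = x}"
  using assms by (simp add: lookup_sum lookup_single when_def sum.If_cases Int_def)

lemma keys_sum_single:
  assumes "finite A"
  shows "keys (\<Sum>a\<in>A. single (e a) (Suc 0)) = e ` A"
  using assms by (auto simp: in_keys_iff lookup_sum_single card_eq_0_iff)

text \<open>The closing edge is absorbed into a single product over an index set, the form in which
  divisibility of monomials is tested.\<close>

lemma cycle_monomial_eq:
  assumes "2 \<le> (t::nat)"
  shows "(\<Prod>j = 1..t - 1. mvar (c j, c (j + 1))) * mvar (c t, c 1) =
    (\<Prod>j = 1..t. mvar (c j, c (if j = t then 1 else j + 1)) :: (nat \<times> nat, 'k::comm_ring_1) mpoly)"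
proof -
  have "{1..t} = insert t {1..t - 1}" using assms by auto
  then have "(\<Prod>j = 1..t. mvar (c j, c (if j = t then 1 else j + 1))) =
      mvar (c t, c 1) * (\<Prod>j = 1..t - 1. mvar (c j, c (if j = t then 1 else j + 1)) :: (nat \<times> nat, 'k) mpoly)"
    using assms by simp
  also have "(\<Prod>j = 1..t - 1. mvar (c j, c (if j = t then 1 else j + 1))) =
      (\<Prod>j = 1..t - 1. mvar (c j, c (j + 1)) :: (nat \<times> nat, 'k) mpoly)"
    using assms by (intro prod.cong) auto
  finally show ?thesis by (simp add: mult.commute)
qed

lemma cycle_not_forest:
  assumes "2 \<le> (t::nat)" "(c t, c 1) \<in> H" "\<And>j. j \<in> {1..t - 1} \<Longrightarrow> (c j, c (j + 1)) \<in> H"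
  shows "\<not> forest H"
proof -
  have "(c 1, c (Suc j)) \<in> H\<^sup>*" if "Suc j \<le> t" for j
    using that
  proof (induction j)
    case (Suc j)
    then have "(c (Suc j), c (Suc (Suc j))) \<in> H" using assms(3)[of "Suc j"] by auto
    then show ?case using Suc by auto
  qed simp
  from this[of "t - 1"] have "(c 1, c t) \<in> H\<^sup>*" using assms(1) by simp
  then have "(c 1, c 1) \<in> H\<^sup>+" using assms(2) by auto
  then show ?thesis by (auto simp: forest_def acyclic_def)
qed

text \<open>A square-free monomial whose variables all occur in \<open>m\<close> divides \<open>m\<close>.\<close>

lemma single_mem_ideal:
  fixes V :: "'v set" and c :: "'k::comm_ring_1"
  assumes I: "ideal I (mpoly_ring V)" and m: "keys m \<subseteq> V"
    and e: "inj_on e A" "finite A" "e ` A \<subseteq> keys m" "(\<Prod>a\<in>A. mvar (e a)) \<in> I"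
  shows "single m c \<in> I"
proof -
  let ?g = "\<Sum>a\<in>A. single (e a) (Suc 0)"
  have le: "lookup ?g x \<le> lookup m x" for x
  proof (cases "x \<in> e ` A")
    case True
    have "card {a \<in> A. e a = x} \<le> 1"
      using e(1,2) by (auto simp: card_le_Suc0_iff_eq inj_on_def)
    moreover have "0 < lookup m x" using True e(3) by (auto simp: in_keys_iff)
    ultimately show ?thesis using e(2) by (simp add: lookup_sum_single)
  next
    case False
    then have "{a \<in> A. e a = x} = {}" by auto
    then show ?thesis using e(2) by (simp only: lookup_sum_single card.empty le0)
  qed
  have "(m - ?g) + ?g = m"
    by (intro poly_mapping_eqI) (simp add: lookup_add lookup_minus le)
  then have "single m c = single (m - ?g) c * (\<Prod>a\<in>A. mvar (e a))"
    using e(2) by (simp add: prod_mvar mult_single)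
  moreover have "keys (m - ?g) \<subseteq> V"
    using m by (auto simp: in_keys_iff lookup_minus subset_iff)
  then have "single (m - ?g) c \<in> carrier (mpoly_ring V)"
    by (simp add: mpoly_ring_def)
  ultimately show ?thesis using ideal.I_l_closed[OF I e(4)] by (simp add: mpoly_ring_def)
qed

text \<open>A monomial with nonforest support contains a pair or a cycle and is divisible by a
  generator; conversely every generator has nonforest support. The generated ideal lives in the ring
  in the variables \<open>\<Gamma>\<close>, whence the intersection.\<close>

lemma
  fixes \<Gamma> :: "(nat \<times> nat) set"
  assumes irr: "irrefl \<Gamma>"
  shows index_ideal_ideal: "ideal (index_ideal \<Gamma>)
      (mpoly_ring \<Gamma> :: (nat \<times> nat, 'k::field) mpoly ring)"
    and index_ideal_eq: "(index_ideal \<Gamma> :: (nat \<times> nat, 'k::field) mpoly set) =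
      SR (rel_faces {} \<Gamma>) \<inter> polys_in \<Gamma>"
proof -
  let ?P = "mpoly_ring \<Gamma> :: (nat \<times> nat, 'k) mpoly ring"
  let ?J = "SR (rel_faces {} \<Gamma>) :: (nat \<times> nat, 'k) mpoly set"
  let ?G = "in_pair_monomials \<Gamma> \<union> cycle_monomials \<Gamma> :: (nat \<times> nat, 'k) mpoly set"
  interpret P: cring ?P by (rule mpoly_ring_cring)
  have J: "is_ideal ?J" by (rule SR_ideal[OF down_closed_rel_faces])
  note c = is_subring_closed[OF polys_in_subring[of \<Gamma>]]
  have carr: "carrier ?P = polys_in \<Gamma>" by (simp add: mpoly_ring_def polys_in_def)
  have neg: "\<ominus>\<^bsub>?P\<^esub> p = - p" if "p \<in> polys_in \<Gamma>" for p
    using that c(5) by (intro P.minus_equality) (auto simp: carr, auto simp: mpoly_ring_def)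
  have JC: "ideal (?J \<inter> polys_in \<Gamma>) ?P"
  proof (rule idealI)
    show "ring ?P" by (rule P.ring_axioms)
    show "subgroup (?J \<inter> polys_in \<Gamma>) (add_monoid ?P)"
    proof (rule P.add.subgroupI)
      show "?J \<inter> polys_in \<Gamma> \<noteq> {}" using c(1) ri.subspace_0[OF J] by blast
      show "a \<oplus>\<^bsub>?P\<^esub> b \<in> ?J \<inter> polys_in \<Gamma>" if "a \<in> ?J \<inter> polys_in \<Gamma>" "b \<in> ?J \<inter> polys_in \<Gamma>" for a b
        using that c(3) ri.subspace_add[OF J] by (auto simp: mpoly_ring_def)
    qed (use c(5) ri.subspace_neg[OF J] in \<open>auto simp: carr neg\<close>)
  qed (use c(4) is_ideal_mult[OF J] ri.subspace_scale[OF J] in \<open>auto simp: carr, auto simp: mpoly_ring_def\<close>)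
  have mon: "(\<Prod>a\<in>A. mvar (e a)) \<in> ?J \<inter> polys_in \<Gamma>" if "finite A" "e ` A \<subseteq> \<Gamma>" "\<not> forest (e ` A)"
    for A :: "nat set" and e
  proof -
    have keys: "keys (\<Sum>a\<in>A. single (e a) (Suc 0)) = e ` A"
      using that by (simp only: keys_sum_single)
    then show ?thesis
      unfolding prod_mvar[OF that(1)] using that by (auto simp: SR_def polys_in_def rel_faces_def)
  qed
  have "?G \<subseteq> ?J \<inter> polys_in \<Gamma>"
  proof (rule subsetI, elim UnE)
    fix p :: "(nat \<times> nat, 'k) mpoly" assume "p \<in> in_pair_monomials \<Gamma>"
    then obtain i l j where p: "p = mvar (i, j) * mvar (l, j)" "(i, j) \<in> \<Gamma>" "(l, j) \<in> \<Gamma>" "i \<noteq> l"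
      unfolding in_pair_monomials_def by blast
    let ?e = "\<lambda>a::nat. if a = 0 then (i, j) else (l, j)"
    have img: "?e ` {0, 1} = {(i, j), (l, j)}" by auto
    have "(\<Prod>a\<in>{0, 1}. mvar (?e a)) \<in> ?J \<inter> polys_in \<Gamma>"
      unfolding img[symmetric]
      by (rule mon) (use p img forest_parent_unique[of "{(i, j), (l, j)}" i j l] in auto)
    then show "p \<in> ?J \<inter> polys_in \<Gamma>" using p(1) by simp
  next
    fix p :: "(nat \<times> nat, 'k) mpoly" assume "p \<in> cycle_monomials \<Gamma>"
    then obtain t :: nat and d :: "nat \<Rightarrow> nat" where
      p: "p = (\<Prod>j = 1..t - 1. mvar (d j, d (j + 1))) * mvar (d t, d 1)" and
      t: "2 \<le> t" "inj_on d {1..t}" "(d t, d 1) \<in> \<Gamma>" "\<forall>j\<in>{1..t - 1}. (d j, d (j + 1)) \<in> \<Gamma>"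
      unfolding cycle_monomials_def by blast
    let ?e = "\<lambda>j. (d j, d (if j = t then 1 else j + 1))"
    have "(\<Prod>j = 1..t. mvar (?e j)) \<in> ?J \<inter> polys_in \<Gamma>"
    proof (rule mon)
      show "?e ` {1..t} \<subseteq> \<Gamma>" using t(3,4) by auto
      show "\<not> forest (?e ` {1..t})"
      proof (rule cycle_not_forest[OF t(1)])
        show "(d t, d 1) \<in> ?e ` {1..t}" using t(1) by (intro image_eqI[of _ _ t]) auto
        show "(d j, d (j + 1)) \<in> ?e ` {1..t}" if "j \<in> {1..t - 1}" for j
          using that t(1) by (intro image_eqI[of _ _ j]) auto
      qed
    qed simp
    then show "p \<in> ?J \<inter> polys_in \<Gamma>" unfolding p cycle_monomial_eq[OF t(1)] .
  qed
  then have sub: "index_ideal \<Gamma> \<subseteq> ?J \<inter> polys_in \<Gamma>"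
    unfolding index_ideal_def using JC by (intro P.genideal_minimal)
  have G_carr: "?G \<subseteq> carrier ?P" using \<open>?G \<subseteq> ?J \<inter> polys_in \<Gamma>\<close> carr by blast
  have I: "ideal (index_ideal \<Gamma>) ?P"
    unfolding index_ideal_def using G_carr by (rule P.genideal_ideal)
  have G_I: "?G \<subseteq> index_ideal \<Gamma>"
    unfolding index_ideal_def using G_carr by (rule P.genideal_self)
  have mono: "single m x \<in> (index_ideal \<Gamma> :: (nat \<times> nat, 'k) mpoly set)"
    if m: "keys m \<subseteq> \<Gamma>" "\<not> forest (keys m)" for m x
  proof -
    have "irrefl (keys m)" using irr m(1) by (auto simp: irrefl_def)
    with m(2) show ?thesis
    proof (rule nonforest_cases)
      fix i l j assume ilj: "(i, j) \<in> keys m" "(l, j) \<in> keys m" "i \<noteq> l"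
      let ?e = "\<lambda>a::nat. if a = 0 then (i, j) else (l, j)"
      have "(\<Prod>a\<in>{0, 1}. mvar (?e a)) \<in>
          (in_pair_monomials \<Gamma> :: (nat \<times> nat, 'k) mpoly set)"
        using ilj m(1) by (auto simp: in_pair_monomials_def)
      then have prod: "(\<Prod>a\<in>{0, 1}. mvar (?e a)) \<in>
          (index_ideal \<Gamma> :: (nat \<times> nat, 'k) mpoly set)"
        by (intro subsetD[OF G_I] UnI1)
      show ?thesis
        by (rule single_mem_ideal[OF I m(1) _ _ _ prod]) (use ilj in \<open>auto simp: inj_on_def\<close>)
    next
      fix t :: nat and d assume t: "2 \<le> t" "inj_on d {1..t}" "(d t, d 1) \<in> keys m"
        "\<And>j. j \<in> {1..t - 1} \<Longrightarrow> (d j, d (j + 1)) \<in> keys m"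
      let ?e = "\<lambda>j. (d j, d (if j = t then 1 else j + 1))"
      have "(\<Prod>j = 1..t. mvar (?e j)) \<in>
          (cycle_monomials \<Gamma> :: (nat \<times> nat, 'k) mpoly set)"
        unfolding cycle_monomial_eq[OF t(1), symmetric] cycle_monomials_def
        by (rule CollectI, intro exI[of _ t] exI[of _ d] conjI refl) (use t m(1) in auto)
      then have prod: "(\<Prod>j\<in>{1..t}. mvar (?e j)) \<in>
          (index_ideal \<Gamma> :: (nat \<times> nat, 'k) mpoly set)"
        by (intro subsetD[OF G_I] UnI2)
      have inj: "inj_on ?e {1..t}"
        by (rule inj_onI) (rule inj_onD[OF t(2)], auto)
      have sub: "?e ` {1..t} \<subseteq> keys m"
      proof (rule image_subsetI)
        show "?e j \<in> keys m" if "j \<in> {1..t}" for j using that t(3) t(4)[of j] by (cases "j = t") auto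
      qed
      show ?thesis by (rule single_mem_ideal[OF I m(1) inj _ sub prod]) simp
    qed
  qed
  show "ideal (index_ideal \<Gamma>) ?P" by (rule I)
  have "?J \<inter> polys_in \<Gamma> \<subseteq> index_ideal \<Gamma>"
  proof
    fix p assume p: "p \<in> ?J \<inter> polys_in \<Gamma>"
    interpret I: ideal "index_ideal \<Gamma>" ?P by (rule I)
    have "(\<Sum>m\<in>A. single m (lookup p m)) \<in> (index_ideal \<Gamma> :: (nat \<times> nat, 'k) mpoly set)"
      if "finite A" "A \<subseteq> keys p" for A
      using that
    proof induction
      case empty
      then show ?case using I.zero_closed by (simp add: mpoly_ring_def)
    next
      case (insert m A)
      then have "keys m \<subseteq> \<Gamma>" "\<not> forest (keys m)"
        using p by (auto simp: SR_def polys_in_def rel_faces_def)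
      then have "single m (lookup p m) \<in> index_ideal \<Gamma>" by (rule mono)
      then show ?case using insert I.a_closed by (simp add: mpoly_ring_def)
    qed
    from this[of "keys p"] show "p \<in> index_ideal \<Gamma>" by (simp add: sum_singles)
  qed
  then show "index_ideal \<Gamma> = ?J \<inter> polys_in \<Gamma>" using sub by (intro equalityI)
qed

section \<open>The quotient ring\<close>

text \<open>Killing the variables outside \<open>\<Gamma>\<close> changes a polynomial only by an
  element of the Stanley-Reisner ideal, so this ideal, taken in all variables, is the exact
  kernel.\<close>

lemma frac_hom_quotient:
  fixes \<Gamma> :: "(nat \<times> nat) set"
  assumes irr: "irrefl \<Gamma>"
  defines "P \<equiv> mpoly_ring \<Gamma> :: (nat \<times> nat, 'k::field) mpoly ring"
  shows "frac_hom (P Quot index_ideal \<Gamma>) (\<lambda>r. index_ideal \<Gamma> +>\<^bsub>P\<^esub> restrict_vars \<Gamma> r) {1}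
    (SR (rel_faces {} \<Gamma>))"
proof -
  let ?I = "index_ideal \<Gamma> :: (nat \<times> nat, 'k) mpoly set"
  let ?J = "SR (rel_faces {} \<Gamma>) :: (nat \<times> nat, 'k) mpoly set"
  interpret P: cring P unfolding P_def by (rule mpoly_ring_cring)
  interpret I: ideal ?I P unfolding P_def using irr by (rule index_ideal_ideal)
  interpret A: cring "P Quot ?I" by (rule I.quotient_is_cring) (rule P.is_cring)
  have J: "is_ideal ?J" by (rule SR_ideal[OF down_closed_rel_faces])
  have carr: "carrier P = polys_in \<Gamma>" by (simp add: P_def mpoly_ring_def polys_in_def)
  have ops: "x \<otimes>\<^bsub>P\<^esub> y = x * y" "x \<oplus>\<^bsub>P\<^esub> y = x + y" "\<one>\<^bsub>P\<^esub> = 1" for x y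
    by (simp_all add: P_def mpoly_ring_def)
  have \<pi>: "restrict_vars \<Gamma> r \<in> carrier P" for r by (simp add: carr restrict_vars_in)
  have one: "restrict_vars \<Gamma> 1 = (1 :: (nat \<times> nat, 'k) mpoly)"
    by (intro restrict_vars_id is_subring_closed(2) polys_in_subring)
  have diff: "r - restrict_vars \<Gamma> r \<in> ?J" for r
    by (rule restrict_vars_diff[OF down_closed_rel_faces]) (auto simp: rel_faces_def)
  have kernel: "?I +>\<^bsub>P\<^esub> restrict_vars \<Gamma> r = \<zero>\<^bsub>P Quot ?I\<^esub> \<longleftrightarrow> r \<in> ?J" for r
  proof -
    have "?I +>\<^bsub>P\<^esub> restrict_vars \<Gamma> r = \<zero>\<^bsub>P Quot ?I\<^esub> \<longleftrightarrow> restrict_vars \<Gamma> r \<in> ?I"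
      using I.rcos_const_imp_mem[OF \<pi>] P.a_rcos_zero[OF I.is_ideal] by (auto simp: FactRing_def)
    also have "\<dots> \<longleftrightarrow> restrict_vars \<Gamma> r \<in> ?J"
      using index_ideal_eq[OF irr, where 'k = 'k] restrict_vars_in[of \<Gamma> r] by auto
    also have "\<dots> \<longleftrightarrow> r \<in> ?J"
      using ri.subspace_add[OF J diff[of r], of "restrict_vars \<Gamma> r"]
        ri.subspace_diff[OF J _ diff[of r], of r] by auto
    finally show ?thesis .
  qed
  note hom = I.rcos_ring_hom
  show ?thesis
  proof (intro frac_hom.intro frac_hom_axioms.intro A.is_cring)
    show "?I +>\<^bsub>P\<^esub> restrict_vars \<Gamma> r \<in> carrier (P Quot ?I)" for r
      using ring_hom_closed[OF hom \<pi>] .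
    show "?I +>\<^bsub>P\<^esub> restrict_vars \<Gamma> (r + r') =
        (?I +>\<^bsub>P\<^esub> restrict_vars \<Gamma> r) \<oplus>\<^bsub>P Quot ?I\<^esub> (?I +>\<^bsub>P\<^esub> restrict_vars \<Gamma> r')" for r r'
      using ring_hom_add[OF hom \<pi> \<pi>] by (simp add: restrict_vars_add ops)
    show "?I +>\<^bsub>P\<^esub> restrict_vars \<Gamma> (r * r') =
        (?I +>\<^bsub>P\<^esub> restrict_vars \<Gamma> r) \<otimes>\<^bsub>P Quot ?I\<^esub> (?I +>\<^bsub>P\<^esub> restrict_vars \<Gamma> r')" for r r'
      using ring_hom_mult[OF hom \<pi> \<pi>] by (simp add: restrict_vars_mult ops)
    show h_one: "?I +>\<^bsub>P\<^esub> restrict_vars \<Gamma> 1 = \<one>\<^bsub>P Quot ?I\<^esub>"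
      using ring_hom_one[OF hom] by (simp add: one ops)
    show "?I +>\<^bsub>P\<^esub> restrict_vars \<Gamma> s \<in> Units (P Quot ?I)" if "s \<in> {1}" for s
      using that h_one by simp
    show "\<exists>r s. s \<in> {1} \<and> l \<otimes>\<^bsub>P Quot ?I\<^esub> (?I +>\<^bsub>P\<^esub> restrict_vars \<Gamma> s) = ?I +>\<^bsub>P\<^esub> restrict_vars \<Gamma> r"
      if l: "l \<in> carrier (P Quot ?I)" for l
    proof -
      obtain r where r: "r \<in> polys_in \<Gamma>" "l = ?I +>\<^bsub>P\<^esub> r"
        using l by (auto simp: FactRing_def A_RCOSETS_def' carr)
      then have "l = ?I +>\<^bsub>P\<^esub> restrict_vars \<Gamma> r" by (simp add: restrict_vars_id)
      then show ?thesis using l h_one by (intro exI[of _ r] exI[of _ 1]) simp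
    qed
    show "?I +>\<^bsub>P\<^esub> restrict_vars \<Gamma> r = \<zero>\<^bsub>P Quot ?I\<^esub> \<longleftrightarrow> (\<exists>u\<in>{1}. u * r \<in> ?J)" for r
      using kernel by simp
  qed (use J in auto)
qed

text \<open>There may be infinitely many variables, so the ambient ring need not be Noetherian.
  Modulo \<open>SR \<Delta>\<close> every element has a representative in the finitely many
  variables \<open>V\<close>, where the basis theorem applies.\<close>

lemma ideal_finitely_generated_mod_SR:
  fixes K :: "('v, 'k::field) mpoly set"
  assumes "finite V" "down_closed \<Delta>" "\<Delta> \<subseteq> Pow V" and K: "is_ideal K" "SR \<Delta> \<subseteq> K"
  shows "\<exists>B. finite B \<and> K = ispan (SR \<Delta> \<union> B)"
proof -
  note c = is_subring_closed[OF polys_in_subring[of V]]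
  have "ideal_in (polys_in V) (K \<inter> polys_in V)"
    using K(1) c(1,3,4) by (auto simp: ideal_in_def ri.subspace_0 ri.subspace_add ri.subspace_scale)
  then obtain B where B: "B \<subseteq> K \<inter> polys_in V" "finite B" "K \<inter> polys_in V \<subseteq> gen_in (polys_in V) B"
    using noetherian_in_polys_in[OF assms(1)] unfolding noetherian_in_def by blast
  have "r \<in> ispan (SR \<Delta> \<union> B)" if r: "r \<in> K" for r
  proof -
    have d: "r - restrict_vars V r \<in> SR \<Delta>" by (rule restrict_vars_diff) fact+
    have "r - (r - restrict_vars V r) \<in> K" by (rule ri.subspace_diff[OF K(1) r subsetD[OF K(2) d]])
    then have "restrict_vars V r \<in> gen_in (polys_in V) B" using B(3) restrict_vars_in[of V r] by auto
    then have "restrict_vars V r \<in> ispan B" by (rule gen_in_subset_ispan)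
    then have "restrict_vars V r \<in> ispan (SR \<Delta> \<union> B)" using ri.span_mono[of B "SR \<Delta> \<union> B"] by blast
    moreover have "r - restrict_vars V r \<in> ispan (SR \<Delta> \<union> B)" using d by (simp add: ri.span_base)
    ultimately show ?thesis using ri.span_add by fastforce
  qed
  moreover have "ispan (SR \<Delta> \<union> B) \<subseteq> K" using B(1) K by (intro ri.span_minimal) auto
  ultimately show ?thesis using B(2) by blast
qed

text \<open>Modulo the contraction of \<open>m\<close> the polynomials in \<open>V\<close> form a
  field, hence have Goldman's property with witness 1. The Nullstellensatz makes them
  finite-dimensional over the constants.\<close>

lemma maximal_contr_algebraic:
  fixes A (structure) and g :: "('v, 'k::field) mpoly \<Rightarrow> 'a"
  assumes g: "frac_hom A g {1} J" and V: "finite V"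
    and restr: "\<And>r. g (restrict_vars V r) = g r"
    and m: "maximalideal m A" and x: "x \<in> polys_in V"
  shows "\<exists>f. f \<noteq> 0 \<and> peval f x \<in> frac_hom.contr g m"
proof -
  interpret g: frac_hom A g "{1}" J by fact
  interpret m: maximalideal m A by fact
  let ?M = "g.contr m"
  have prime: "is_prime ?M" using g.maximalideal_prime[OF m] by (rule g.contr_prime)
  interpret M: prime_mod ?M by standard fact
  obtain vs where vs: "V = set vs" using V finite_list by blast
  let ?K = "range cst :: ('v, 'k) mpoly set"
  have K: "M.field_mod ?K"
    unfolding M.field_mod_def
  proof
    fix f assume "f \<in> ?K - ?M"
    then obtain c where "f = cst c" "c \<noteq> 0" using ri.subspace_0[OF M.p_ideal] by fastforce
    then have "f * cst (inverse c) = 1" using field_cst by (simp add: mult.commute)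
    then show "\<exists>g\<in>?K. M.eqv (f * g) 1" by (metis M.eqv_refl rangeI)
  qed
  have "M.goldman (polys_in V)"
    unfolding M.goldman_def
  proof (rule bexI[of _ 1], rule ballI)
    show "1 \<in> polys_in V - ?M"
      using is_subring_closed(2)[OF polys_in_subring] M.one_notin by blast
    fix f assume "f \<in> polys_in V - ?M"
    then have "g f \<in> carrier A - m" by (simp add: g.contr_def)
    then obtain y where y: "y \<in> carrier A" "g f \<otimes> y \<ominus> \<one> \<in> m"
      using m.inverse_mod[OF g.is_cring] by blast
    obtain r where r: "y = g r" using g.h_surj[OF y(1)] y(1) by (auto simp: g.h_one)
    let ?r = "restrict_vars V r"
    have "g (f * ?r - 1) \<oplus> \<one> = g f \<otimes> y"
      using g.h_add[of "f * ?r - 1" 1] by (simp add: g.h_one g.h_mult restr r)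
    then have "g (f * ?r - 1) = g f \<otimes> y \<ominus> \<one>"
      by (simp add: a_minus_def g.a_assoc g.r_neg flip: \<open>g (f * ?r - 1) \<oplus> \<one> = g f \<otimes> y\<close>)
    then have "f * ?r - 1 ^ 1 \<in> ?M" using y(2) by (simp add: g.contr_def)
    then have "M.eqv (f * ?r) (1 ^ 1)" by (simp only: M.eqv_def)
    then show "\<exists>k\<in>polys_in V. \<exists>N. M.eqv (f * k) (1 ^ N)" using restrict_vars_in by blast
  qed
  then have "M.spanned_mod ?K (polys_in V)"
    unfolding vs polys_in_eq_adjoin by (intro M.nullstellensatz range_cst_closed K)
  then show ?thesis by (intro spanned_mod_algebraic[OF prime _ polys_in_subring x])
qed

text \<open>Edges are determined by their heads, and a minimal vertex is the head of none.\<close>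

lemma card_forest:
  assumes "forest F" "F \<subseteq> V \<times> V" "finite V"
  shows "card F \<le> card V - 1"
proof (cases "V = {}")
  case False
  have "finite F" using assms finite_subset by fastforce
  then have "wf F" using assms(1) finite_acyclic_wf by (auto simp: forest_def)
  then obtain z where z: "z \<in> V" "\<And>y. (y, z) \<in> F \<Longrightarrow> y \<notin> V"
    using False by (metis all_not_in_conv wf_eq_minimal)
  have "inj_on snd F" using forest_parent_unique[OF assms(1)] by (auto simp: inj_on_def)
  then have "card F = card (snd ` F)" by (simp add: card_image)
  also have "\<dots> \<le> card (V - {z})" using z assms by (intro card_mono) auto
  finally show ?thesis using z assms(3) by simp
qed (use assms in auto)

text \<open>The edges out of \<open>s\<close> supply the invariant with which the induction over
  deletions and contractions starts, at \<open>F = {}\<close> and \<open>G = E\<close>.\<close>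

lemma wreg_excess:
  fixes f :: "'v \<Rightarrow> 'k::field poly"
  assumes "finite V" "E \<subseteq> V \<times> V" "s \<in> V" "\<And>j. j \<in> V - {s} \<Longrightarrow> (s, j) \<in> E"
    and "set vs \<subseteq> V - {s}" "distinct vs" "\<And>v. v \<in> set vs \<Longrightarrow> f v \<noteq> 0"
  shows "wreg (SR (rel_faces {} E)) (map (\<lambda>v. peval (f v) (excess E mvar v)) vs)"
proof (rule wreg_rel_faces[where E = E and V = "V - {s}" and s = s])
  show "wreg (SR (Pow T)) (map (\<lambda>v. peval (f v) (excess E mvar v)) vs)"
    if "T \<subseteq> E" "forest T" "\<And>j. j \<in> V - {s} \<Longrightarrow> forest (insert (s, j) T) \<Longrightarrow> (s, j) \<in> T" for T
    using assms that by (intro wreg_spanning) auto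
  show "finite E" using assms(1,2) finite_subset by fastforce
qed (use assms in \<open>auto simp: forest_def acyclic_def\<close>)

lemma excess_in_polys: "excess E mvar v \<in> polys_in E"
proof -
  note c = is_subring_closed[OF polys_in_subring]
  show ?thesis
    unfolding excess_def
    by (intro c(6) c(8)) (auto simp: in_edges_def out_edges_def intro: polys_in_mvar)
qed

theorem corollary4p3p2:
  fixes n :: nat and \<Gamma> :: "(nat \<times> nat) set"
  assumes "\<Gamma> \<subseteq> {1..n} \<times> {1..n}"
    and "\<And>i. 2 \<le> i \<Longrightarrow> i \<le> n \<Longrightarrow> (1, i) \<in> \<Gamma>"
    and "\<And>i. 1 \<le> i \<Longrightarrow> i \<le> n \<Longrightarrow> (i, i) \<notin> \<Gamma>"
  shows "cohen_macaulay
    ((mpoly_ring \<Gamma> :: (((nat \<times> nat) \<Rightarrow>\<^sub>0 nat) \<Rightarrow>\<^sub>0 'k::field) ring) Quot index_ideal \<Gamma>)"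
proof -
  define P where "P = (mpoly_ring \<Gamma> :: (((nat \<times> nat) \<Rightarrow>\<^sub>0 nat) \<Rightarrow>\<^sub>0 'k) ring)"
  define A where "A = P Quot index_ideal \<Gamma>"
  define g where "g = (\<lambda>r. index_ideal \<Gamma> +>\<^bsub>P\<^esub> restrict_vars \<Gamma> r)"
  let ?J = "SR (rel_faces {} \<Gamma>) :: (((nat \<times> nat) \<Rightarrow>\<^sub>0 nat) \<Rightarrow>\<^sub>0 'k) set"
  have fin: "finite \<Gamma>" using assms(1) by (rule finite_subset) auto
  have "irrefl \<Gamma>" using assms(1,3) by (fastforce simp: irrefl_def)
  then have g: "frac_hom A g {1} ?J" unfolding A_def g_def P_def by (rule frac_hom_quotient)
  interpret g: frac_hom A g "{1}" ?J by (rule g)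
  have \<Delta>: "down_closed (rel_faces {} \<Gamma>)" "rel_faces {} \<Gamma> \<subseteq> Pow \<Gamma>"
    by (rule down_closed_rel_faces) (auto simp: rel_faces_def)
  have noeth: "\<exists>B. finite B \<and> K = ispan (?J \<union> B)" if "is_ideal K" "?J \<subseteq> K" for K
    using ideal_finitely_generated_mod_SR[OF fin \<Delta> that] .
  have "cohen_macaulay_local (localization A (carrier A - m))" if m: "maximalideal m A" for m
  proof -
    have prime: "primeideal m A" using g.maximalideal_prime[OF m] .
    interpret L: frac_hom "localization A (carrier A - m)"
        "\<lambda>r. loc_frac A (carrier A - m) (g r) \<one>\<^bsub>A\<^esub>" "- g.contr m" ?J
      using g prime by (rule frac_hom_localization)
    have restr: "g (restrict_vars \<Gamma> r) = g r" for r
      by (simp add: g_def restrict_vars_id restrict_vars_in)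
    have "\<forall>v. \<exists>f. f \<noteq> 0 \<and> peval f (excess \<Gamma> mvar v) \<in> g.contr m"
      using maximal_contr_algebraic[OF g fin restr m excess_in_polys] by blast
    from choice[OF this] obtain f where
      f: "\<And>v. f v \<noteq> 0" "\<And>v. peval (f v) (excess \<Gamma> mvar v) \<in> g.contr m" by blast
    \<comment> \<open>Vertex 1 is omitted because the excesses of all vertices sum to zero.\<close>
    let ?fs = "map (\<lambda>v. peval (f v) (excess \<Gamma> mvar v)) [2..<Suc n]"
    \<comment> \<open>Truncated subtraction also covers \<open>n = 0\<close>, where
      \<open>\<Gamma>\<close> and the sequence are empty.\<close>
    have len: "length ?fs = n - 1" by simp arith
    show ?thesis
    proof (rule L.cohen_macaulay_local)
      show "is_prime (g.contr m)" "?J \<subseteq> g.contr m" using g.contr_prime[OF prime] by auto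
      show "set ?fs \<subseteq> g.contr m" using f(2) by auto
      show "wreg ?J ?fs"
      proof (cases "n = 0")
        case False
        then show ?thesis
          using assms f(1) by (intro wreg_excess[where V = "{1..n}" and s = 1]) auto
      qed simp
      fix Q :: "nat \<Rightarrow> (((nat \<times> nat) \<Rightarrow>\<^sub>0 nat) \<Rightarrow>\<^sub>0 'k) set"
      assume Q: "\<And>i. i \<le> Suc (length ?fs) \<Longrightarrow> is_prime (Q i) \<and> ?J \<subseteq> Q i"
        "\<And>i. i \<le> length ?fs \<Longrightarrow> Q i \<subset> Q (Suc i)"
      show False
      proof (rule SR_prime_chain)
        show "finite (rel_faces {} \<Gamma>)" using fin \<Delta>(2) by (auto intro: finite_subset)
        show "finite F \<and> card F \<le> n - 1" if "F \<in> rel_faces {} \<Gamma>" for F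
          using that card_forest[of F "{1..n}"] assms(1) fin
          by (auto simp: rel_faces_def intro: finite_subset)
        show "is_prime (Q i) \<and> ?J \<subseteq> Q i" if "i \<le> Suc (n - 1)" for i
          using Q(1)[unfolded len, OF that] .
        show "Q i \<subset> Q (Suc i)" if "i \<le> n - 1" for i using Q(2)[unfolded len, OF that] .
      qed
    qed (use noeth in auto)
  qed
  moreover have "noetherian_ring A" using noeth by (rule g.noetherian)
  ultimately have "cohen_macaulay A"
    unfolding cohen_macaulay_def using g.is_cring by blast
  then show ?thesis by (simp add: A_def P_def)
qed

end
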